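(* Let $r\in\{0,1,\ldots,\infty\}$ and let $M$ be an open $C^r$-manifold such that $M$ is the interior of $\bar M$, where $\bar M$ is a compact connected $C^r$-manifold with non-empty boundary $\partial$. Suppose that $G\leq\mathcal{D}^r(M)$ is factorizable (in the wider sense), is determined on compact subsets, admits translation systems and is localizable, and that $G_c$ is non-fixing. Then $[G,G]$ is perfect.
   Context: $\mathcal{D}^r(M)$ is the group of all $C^r$-diffeomorphisms of $M$ that can be joined with the identity by a $C^r$-isotopy ($C^0$-diffeomorphism means homeomorphism). $\mathrm{supp}(g)$ is the closure of $\{x:g(x)\ne x\}$. For $U\subset M$, $G(U)$ is the subgroup of all elements of $G$ that can be joined with the identity by an isotopy in $G$ with support contained in $U$ (the support of an isotopy being the closure in $M$ of the set of points it moves). A product neighborhood of $\partial$ is a closed subset $P=\partial\times[0,1)$ of $M$ such that $\partial\times[0,1]$ is embedded in $\bar M$ and $\partial\times\{1\}$ is identified with $\partial$. A ball is an open ball whose closure is compact and contained in a chart domain. Factorizable (in the wider sense): let $\mathcal{B}$ be a cover of $M$ by balls. $G$ is $\mathcal{B}$-factorizable if the following hold. For any $f\in G$ there are a product neighborhood $P=\partial\times[0,1)$ and $g,g_1,\ldots,g_\rho\in G$ such that (1) $f=gg_1\cdots g_\rho$ with $g\in G(P)$ and $g_j\in G(B_j)$, where $B_j\in\mathcal{B}$ for $j=1,\ldots,\rho$. Furthermore, for any product neighborhood $P$ and any $g\in G(P)$ there are a sequence of reals from $(0,1)$ tending to $1$, $0<a_1<\bar a_1<\bar b_1<b_1<a_2<\cdots<a_n<\bar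 a_n<\bar b_n<b_n<\cdots<1$, and $h\in G(P)$ such that: (2) $h=g$ on $\bigcup_{n\ge1}\partial\times[\bar a_n,\bar b_n]$; (3) $h=\mathrm{id}$ if $g=\mathrm{id}$; and, putting $D_n=\partial\times(a_n,b_n)$ and $D=\bigcup_{n\ge1}D_n$: (4) $\mathrm{supp}(h)\subset D$; (5) for the resulting decomposition $h=h_1h_2\cdots$ with respect to $D=\bigcup_n D_n$ (so $h_n$ equals $h$ on $D_n$ and $\mathrm{id}$ elsewhere) one has $h_n\in G(D_n)$ for all $n$. $G$ is factorizable (in the wider sense) if it is $\mathcal{B}$-factorizable for every cover $\mathcal{B}$ of $M$ by balls. Determined on compact subsets: whenever $f\in\mathcal{D}^r(M)$ and there are relatively compact subsets $U_1\subset\overline{U}_1\subset U_2\subset\cdots\subset U_n\subset\overline{U}_n\subset U_{n+1}\subset\cdots$ with $\bigcup_nU_n=M$ and elements $g_n\in G$ with $f|_{U_n}=g_n|_{U_n}$ for $n=1,2,\ldots$, then $f\in G$. Admits translation systems: for any product neighborhood $P=\partial\times[0,1)$ and any sequence $\{\lambda_n\}_{n\ge0}$ in $(0,1)$ tending increasingly to $1$, there is a $C^r$-mapping $[0,\infty)\ni t\mapsto f_t\in G$ supported in the interior of $P$, with $f_0=\mathrm{id}$, $f_j=(f_1)^j$ for $j=2,3,\ldots$, and such that for $P_n=\partial\times[\lambda_n,1)$ one has $f_1(P_n)=P_{n+1}$ for $n=0,1,2,\ldots$. $G_c$ is the subgroup of all $f\in G$ that admit a decomposition as in (1) with $g=\mathrm{id}$,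 i.e. $f=g_1\cdots g_\rho$ with $g_j\in G(B_j)$ for balls $B_j$. $G$ is localizable if for any $f\in G$ and any compact $C\subset M$ there is $g\in G_c$ with $f=g$ on $C$. A group $H$ of homeomorphisms of $M$ is non-fixing if for every $x\in M$ the orbit $\{h(x):h\in H\}$ is different from $\{x\}$. A group $H$ is perfect if $H=[H,H]$, where $[H,H]$ is the commutator subgroup. *)

theory Defs
  imports
    "HOL-Analysis.Analysis"
    "HOL-Algebra.Generated_Groups"
    "HOL-Combinatorics.Permutations"
    "HOL-Library.Extended_Nat"
begin

section \<open>Maps of class \<open>C\<^sup>r\<close>\<close>

text \<open>The order of differentiability is \<open>r :: enat\<close>; both finite orders and \<open>\<infinity>\<close> are allowed.\<close>

primrec times_cont_diff ::
    "nat \<Rightarrow> ('a::real_normed_vector \<Rightarrow> 'b::real_normed_vector) \<Rightarrow> 'a set \<Rightarrow> bool" where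
  "times_cont_diff 0 f W \<longleftrightarrow> continuous_on W f"
| "times_cont_diff (Suc k) f W \<longleftrightarrow>
     (\<forall>x\<in>W. f differentiable (at x)) \<and>
     (\<forall>v. times_cont_diff k (\<lambda>x. frechet_derivative f (at x) v) W)"

text \<open>
  The previous notion is only meaningful on open sets. On an arbitrary subset of a vector space
  (for example a relatively open subset of a half space, possibly times a real interval), being of
  class \<open>C\<^sup>r\<close> means having local \<open>C\<^sup>r\<close> extensions to open sets.
\<close>

definition cr_on ::
    "enat \<Rightarrow> ('a::real_normed_vector \<Rightarrow> 'b::real_normed_vector) \<Rightarrow> 'a set \<Rightarrow> bool" where
  "cr_on r f S \<longleftrightarrow>
     (\<forall>x\<in>S. \<exists>W g. open W \<and> x \<in> W \<and> (\<forall>k. enat k \<le> r \<longrightarrow> times_cont_diff k g W) \<and>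
        (\<forall>y\<in>S \<inter> W. g y = f y))"

section \<open>Manifolds with boundary\<close>

text \<open>A chart is a domain together with a coordinate map, which is only relevant on that domain.\<close>

type_synonym ('a, 'e) chart = "'a set \<times> ('a \<Rightarrow> 'e)"

definition compatible ::
    "enat \<Rightarrow> ('a, 'e::euclidean_space) chart \<Rightarrow> ('a, 'e) chart \<Rightarrow> bool" where
  "compatible r = (\<lambda>(U, \<phi>) (V, \<psi>).
     cr_on r (\<psi> \<circ> inv_into U \<phi>) (\<phi> ` (U \<inter> V)) \<and>
     cr_on r (\<phi> \<circ> inv_into V \<psi>) (\<psi> ` (U \<inter> V)))"

text \<open>
  The map \<open>f\<close> is of class \<open>C\<^sup>r\<close> on the set \<open>S\<close>, with respect to charts \<open>A\<close> in the source and
  charts \<open>B\<close> in the target.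
\<close>

definition cr_map ::
    "enat \<Rightarrow> ('a::topological_space, 'd::euclidean_space) chart set \<Rightarrow>
     ('b::topological_space, 'e::euclidean_space) chart set \<Rightarrow> 'a set \<Rightarrow> ('a \<Rightarrow> 'b) \<Rightarrow> bool" where
  "cr_map r A B S f \<longleftrightarrow>
     continuous_on S f \<and>
     (\<forall>(U, \<phi>)\<in>A. \<forall>(V, \<psi>)\<in>B.
        cr_on r (\<psi> \<circ> f \<circ> inv_into U \<phi>) (\<phi> ` (S \<inter> U \<inter> f -` V)))"

definition times_line ::
    "('a, 'e::euclidean_space) chart set \<Rightarrow> ('a \<times> real, 'e \<times> real) chart set" where
  "times_line A = (\<lambda>(U, \<phi>). (U \<times> UNIV, map_prod \<phi> id)) ` A"

record ('a, 'e) bmanifold =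
  points :: "'a set"
  atlas :: "('a, 'e) chart set"

text \<open>The model half space is bounded by the hyperplane orthogonal to a fixed basis vector.\<close>

definition normal_vec :: "'e::euclidean_space" where
  "normal_vec = (SOME b. b \<in> Basis)"

definition half_space :: "'e::euclidean_space set" where
  "half_space = {y. 0 \<le> y \<bullet> normal_vec}"

definition cr_bmanifold :: "enat \<Rightarrow> ('a::t2_space, 'e::euclidean_space) bmanifold \<Rightarrow> bool" where
  "cr_bmanifold r X \<longleftrightarrow>
     (\<Union>(U, \<phi>)\<in>atlas X. U) = points X \<and>
     (\<forall>(U, \<phi>)\<in>atlas X.
        openin (top_of_set (points X)) U \<and>
        openin (top_of_set half_space) (\<phi> ` U) \<and>
        homeomorphism U (\<phi> ` U) \<phi> (inv_into U \<phi>)) \<and>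
     (\<forall>c\<in>atlas X. \<forall>d\<in>atlas X. compatible r c d)"

definition bdry :: "('a, 'e::euclidean_space) bmanifold \<Rightarrow> 'a set" where
  "bdry X = {x. \<exists>(U, \<phi>)\<in>atlas X. x \<in> U \<and> \<phi> x \<bullet> normal_vec = 0}"

text \<open>
  The manifold interior. All notions below concern the open manifold \<open>M = open_part X\<close>; its topology
  is \<open>top_of_set (open_part X)\<close>.
\<close>

definition open_part :: "('a, 'e::euclidean_space) bmanifold \<Rightarrow> 'a set" where
  "open_part X = points X - bdry X"

text \<open>All charts of the \<open>C\<^sup>r\<close>-structure of the open manifold, that is, its maximal atlas.\<close>

definition open_charts ::
    "enat \<Rightarrow> ('a::topological_space, 'e::euclidean_space) bmanifold \<Rightarrow> ('a, 'e) chart set" where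
  "open_charts r X =
     {(U, \<phi>). openin (top_of_set (open_part X)) U \<and> open (\<phi> ` U) \<and>
        homeomorphism U (\<phi> ` U) \<phi> (inv_into U \<phi>) \<and>
        (\<forall>d\<in>atlas X. compatible r (U, \<phi>) d)}"

definition is_ball ::
    "enat \<Rightarrow> ('a::topological_space, 'e::euclidean_space) bmanifold \<Rightarrow> 'a set \<Rightarrow> bool" where
  "is_ball r X B \<longleftrightarrow>
     (\<exists>(U, \<phi>)\<in>open_charts r X. \<exists>c \<rho>. 0 < \<rho> \<and> B \<subseteq> U \<and> \<phi> ` B = ball c \<rho> \<and>
        compact (top_of_set (open_part X) closure_of B) \<and> top_of_set (open_part X) closure_of B \<subseteq> U)"

text \<open>
  A parametrised product neighbourhood: a \<open>C\<^sup>r\<close>-embedding \<open>\<kappa>\<close> of \<open>\<partial> \<times> [0,1]\<close> into the compact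
  manifold. The product neighbourhood itself is the image of \<open>\<partial> \<times> [0,1)\<close>, and \<open>\<partial> \<times> J\<close> in the
  literature is \<open>strip X \<kappa> J\<close>.
\<close>

definition strip ::
    "('a, 'e::euclidean_space) bmanifold \<Rightarrow> ('a \<times> real \<Rightarrow> 'a) \<Rightarrow> real set \<Rightarrow> 'a set" where
  "strip X \<kappa> J = \<kappa> ` (bdry X \<times> J)"

definition product_nbhd ::
    "enat \<Rightarrow> ('a::topological_space, 'e::euclidean_space) bmanifold \<Rightarrow> ('a \<times> real \<Rightarrow> 'a) \<Rightarrow> bool" where
  "product_nbhd r X \<kappa> \<longleftrightarrow>
     inj_on \<kappa> (bdry X \<times> {0..1}) \<and>
     strip X \<kappa> {0..1} \<subseteq> points X \<and>
     cr_map r (times_line (atlas X)) (atlas X) (bdry X \<times> {0..1}) \<kappa> \<and>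
     cr_map r (atlas X) (times_line (atlas X)) (strip X \<kappa> {0..1})
       (inv_into (bdry X \<times> {0..1}) \<kappa>) \<and>
     (\<forall>x\<in>bdry X. \<kappa> (x, 1) = x) \<and>
     closedin (top_of_set (open_part X)) (strip X \<kappa> {0..<1})"

section \<open>Groups of diffeomorphisms of the interior\<close>

text \<open>
  Bijections of a subset are represented by functions on the ambient type that are the identity
  off the subset, so the group operation is plain composition.
\<close>

definition bij_group :: "'a set \<Rightarrow> ('a \<Rightarrow> 'a) monoid" where
  "bij_group S = \<lparr>carrier = {f. f permutes S}, mult = (\<circ>), one = id\<rparr>"

definition diffeos ::
    "enat \<Rightarrow> ('a::topological_space, 'e::euclidean_space) bmanifold \<Rightarrow> ('a \<Rightarrow> 'a) set" where
  "diffeos r X =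
     {f. f permutes open_part X \<and>
        cr_map r (atlas X) (atlas X) (open_part X) f \<and>
        cr_map r (atlas X) (atlas X) (open_part X) (inv_into UNIV f)}"

text \<open>Families of diffeomorphisms, indexed by an interval, that are \<open>C\<^sup>r\<close> jointly in both variables.\<close>

definition cr_family ::
    "enat \<Rightarrow> ('a::topological_space, 'e::euclidean_space) bmanifold \<Rightarrow> real set \<Rightarrow>
     (real \<Rightarrow> 'a \<Rightarrow> 'a) \<Rightarrow> bool" where
  "cr_family r X J F \<longleftrightarrow>
     (\<forall>t\<in>J. F t \<in> diffeos r X) \<and>
     cr_map r (times_line (atlas X)) (atlas X) (open_part X \<times> J) (\<lambda>(x, t). F t x)"

definition supp_on ::
    "('a::topological_space, 'e::euclidean_space) bmanifold \<Rightarrow> ('a \<Rightarrow> 'a) \<Rightarrow> 'a set" where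
  "supp_on X g = top_of_set (open_part X) closure_of {x \<in> open_part X. g x \<noteq> x}"

definition family_supp ::
    "('a::topological_space, 'e::euclidean_space) bmanifold \<Rightarrow> real set \<Rightarrow> (real \<Rightarrow> 'a \<Rightarrow> 'a) \<Rightarrow> 'a set"
where
  "family_supp X J F = top_of_set (open_part X) closure_of {x \<in> open_part X. \<exists>t\<in>J. F t x \<noteq> x}"

definition isotopic_diffeos ::
    "enat \<Rightarrow> ('a::topological_space, 'e::euclidean_space) bmanifold \<Rightarrow> ('a \<Rightarrow> 'a) set" where
  "isotopic_diffeos r X = {f. \<exists>F. cr_family r X {0..1} F \<and> F 0 = id \<and> F 1 = f}"

definition local_subgroup ::
    "enat \<Rightarrow> ('a::topological_space, 'e::euclidean_space) bmanifold \<Rightarrow> ('a \<Rightarrow> 'a) set \<Rightarrow> 'a set \<Rightarrow>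
     ('a \<Rightarrow> 'a) set" where
  "local_subgroup r X G U =
     {g \<in> G. \<exists>F. cr_family r X {0..1} F \<and> (\<forall>t\<in>{0..1}. F t \<in> G) \<and> F 0 = id \<and> F 1 = g \<and>
        family_supp X {0..1} F \<subseteq> U}"

definition factorizable_wrt ::
    "enat \<Rightarrow> ('a::topological_space, 'e::euclidean_space) bmanifold \<Rightarrow> 'a set set \<Rightarrow>
     ('a \<Rightarrow> 'a) set \<Rightarrow> bool" where
  "factorizable_wrt r X \<B> G \<longleftrightarrow>
     (\<forall>f\<in>G. \<exists>\<kappa>. product_nbhd r X \<kappa> \<and>
        (\<exists>g\<in>local_subgroup r X G (strip X \<kappa> {0..<1}). \<exists>gs.
           (\<forall>u\<in>set gs. \<exists>B\<in>\<B>. u \<in> local_subgroup r X G B) \<and> f = g \<circ> foldr (\<circ>) gs id)) \<and>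
     (\<forall>\<kappa>. product_nbhd r X \<kappa> \<longrightarrow>
        (\<forall>g\<in>local_subgroup r X G (strip X \<kappa> {0..<1}).
          \<exists>(a :: nat \<Rightarrow> real) a' b' b. \<exists>h\<in>local_subgroup r X G (strip X \<kappa> {0..<1}).
            (\<forall>n. 0 < a n \<and> a n < a' n \<and> a' n < b' n \<and> b' n < b n \<and> b n < a (Suc n) \<and>
               a (Suc n) < 1) \<and>
            a \<longlonglongrightarrow> 1 \<and>
            (\<forall>n. \<forall>x\<in>strip X \<kappa> {a' n..b' n}. h x = g x) \<and>
            (g = id \<longrightarrow> h = id) \<and>
            supp_on X h \<subseteq> (\<Union>n. strip X \<kappa> {a n<..<b n}) \<and>
            (\<forall>n. (\<lambda>x. if x \<in> strip X \<kappa> {a n<..<b n} then h x else x)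
               \<in> local_subgroup r X G (strip X \<kappa> {a n<..<b n}))))"

definition factorizable ::
    "enat \<Rightarrow> ('a::topological_space, 'e::euclidean_space) bmanifold \<Rightarrow> ('a \<Rightarrow> 'a) set \<Rightarrow> bool" where
  "factorizable r X G \<longleftrightarrow>
     (\<forall>\<B>. (\<forall>B\<in>\<B>. is_ball r X B) \<and> \<Union>\<B> = open_part X \<longrightarrow> factorizable_wrt r X \<B> G)"

definition determined_on_compacts ::
    "enat \<Rightarrow> ('a::topological_space, 'e::euclidean_space) bmanifold \<Rightarrow> ('a \<Rightarrow> 'a) set \<Rightarrow> bool" where
  "determined_on_compacts r X G \<longleftrightarrow>
     (\<forall>f\<in>isotopic_diffeos r X. \<forall>(U :: nat \<Rightarrow> 'a set) g.
        (\<forall>n. U n \<subseteq> open_part X \<and> compact (top_of_set (open_part X) closure_of U n) \<and>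
           top_of_set (open_part X) closure_of U n \<subseteq> U (Suc n)) \<and>
        (\<Union>n. U n) = open_part X \<and>
        (\<forall>n. g n \<in> G \<and> (\<forall>x\<in>U n. f x = g n x)) \<longrightarrow>
        f \<in> G)"

text \<open>
  The sequences \<open>\<mu>\<close> are strictly increasing: if \<open>\<partial> \<times> [\<mu> n, 1)\<close> were equal to
  \<open>\<partial> \<times> [\<mu> (n+1), 1)\<close> for some but not all \<open>n\<close>, no bijection could shift the sequence.
\<close>

definition admits_translation_systems ::
    "enat \<Rightarrow> ('a::topological_space, 'e::euclidean_space) bmanifold \<Rightarrow> ('a \<Rightarrow> 'a) set \<Rightarrow> bool" where
  "admits_translation_systems r X G \<longleftrightarrow>
     (\<forall>\<kappa> (\<mu> :: nat \<Rightarrow> real).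
        product_nbhd r X \<kappa> \<and> range \<mu> \<subseteq> {0<..<1} \<and> strict_mono \<mu> \<and> \<mu> \<longlonglongrightarrow> 1 \<longrightarrow>
        (\<exists>F. cr_family r X {0..} F \<and> (\<forall>t\<ge>0. F t \<in> G) \<and>
           family_supp X {0..} F \<subseteq> top_of_set (open_part X) interior_of strip X \<kappa> {0..<1} \<and>
           F 0 = id \<and>
           (\<forall>j\<ge>2. F (real j) = F 1 ^^ j) \<and>
           (\<forall>n. F 1 ` strip X \<kappa> {\<mu> n..<1} = strip X \<kappa> {\<mu> (Suc n)..<1})))"

definition compact_part ::
    "enat \<Rightarrow> ('a::topological_space, 'e::euclidean_space) bmanifold \<Rightarrow> ('a \<Rightarrow> 'a) set \<Rightarrow>
     ('a \<Rightarrow> 'a) set" where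
  "compact_part r X G =
     {f \<in> G. \<exists>gs. (\<forall>u\<in>set gs. \<exists>B. is_ball r X B \<and> u \<in> local_subgroup r X G B) \<and>
        f = foldr (\<circ>) gs id}"

definition localizable ::
    "enat \<Rightarrow> ('a::topological_space, 'e::euclidean_space) bmanifold \<Rightarrow> ('a \<Rightarrow> 'a) set \<Rightarrow> bool" where
  "localizable r X G \<longleftrightarrow>
     (\<forall>f\<in>G. \<forall>C. C \<subseteq> open_part X \<and> compact C \<longrightarrow>
        (\<exists>g\<in>compact_part r X G. \<forall>x\<in>C. f x = g x))"

definition non_fixing :: "'a set \<Rightarrow> ('a \<Rightarrow> 'a) set \<Rightarrow> bool" where
  "non_fixing S H \<longleftrightarrow> (\<forall>x\<in>S. (\<lambda>h. h x) ` H \<noteq> {x})"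

definition perfect :: "('g, 'm) monoid_scheme \<Rightarrow> 'g set \<Rightarrow> bool" where
  "perfect K H \<longleftrightarrow> H = derived K H"

end

theory Submission
  imports Defs "HOL-Real_Asymp.Real_Asymp"
begin

text \<open>
  Write \<open>D = [G, G]\<close> and \<open>f ~ g\<close> for \<open>[f, g] \<in> [D, D]\<close>; all elements of \<open>G\<close> have to be related.
  If conjugates of \<open>f\<close> and \<open>g\<close> by elements of \<open>G\<close> satisfy \<open>f\<^sup>s ~ g\<close>, \<open>f ~ g\<^sup>t\<close> and \<open>f\<^sup>s ~ g\<^sup>t\<close>,
  then \<open>f ~ g\<close>, since \<open>f\<close> and \<open>f\<^sup>s\<close> (and likewise \<open>g\<close> and \<open>g\<^sup>t\<close>) differ by an element of \<open>D\<close>.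

  If \<open>g\<close> is supported in a ball \<open>B\<close>, then \<open>f\<close> may be replaced by a compactly supported map that
  agrees with it on \<open>B\<close>. A diffeomorphism of the compact manifold, not necessarily in \<open>G\<close>, shrinks
  and moves \<open>B\<close> into a given product neighbourhood; hence some other product neighbourhood contains
  \<open>B\<close>, and a translation along it moves \<open>B\<close> off the support of \<open>f\<close>. So \<open>f ~ g\<close>.

  Up to such \<open>g\<close>, the group is generated by maps supported in a union of disjoint strips
  \<open>\<partial> \<times> (t\<^sub>n, s\<^sub>n\<^sub>+\<^sub>1)\<close> (the blocks) of some product neighbourhood, separated by gaps \<open>\<partial> \<times> [s\<^sub>n, t\<^sub>n]\<close>:
  factorizability provides the gaps and localizability cuts off a compact part. A translation moves
  the blocks into the gaps. Two such maps for the same blocks are therefore related. For different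
  product neighbourhoods, gaps are dropped until the remaining ones of either map lie in blocks of
  the other, so that each map is related to any conjugate of the other that lives in the gaps.
\<close>

section \<open>Commutation modulo the second derived subgroup\<close>

text \<open>The elements related to a fixed \<open>f\<close> form a subgroup, the preimage of a
  centralizer in G/[D, D]; hence generators suffice. The conjugating elements must lie in
  \<open>G\<close>, and the only elements of \<open>G\<close> whose motion is known are
  translations. They exist along every product neighbourhood, but each is controlled only on the
  strips of its own. Product neighbourhoods are not tied to \<open>G\<close>, so a ball need not be
  carried into a collar by \<open>G\<close>: it is enough to drag the collar over the ball by any
  diffeomorphism of the compact manifold. The same freedom is the main obstacle: two factorized
  elements come with unrelated product neighbourhoods, and no single translation is adapted to both.
  What remains is that each neighbourhood, far enough towards the boundary, lies in any given end of
  the other. This suffices to interleave gaps, and then each required comparison uses a translation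
  of one neighbourhood only, or plain disjointness. Dragging uses a radial map of class C^infinity,
  so it serves every \<open>r\<close>, and the inverse of its derivative is explicit.\<close>

context group
begin

text \<open>Commutation of the images in the quotient by the second derived subgroup. As that
  subgroup is normal, \<open>comm_mod_iff\<close> restates this with cosets, where the closure
  properties are short computations.\<close>

definition comm_mod :: "'a \<Rightarrow> 'a \<Rightarrow> bool" where
  "comm_mod a b \<longleftrightarrow>
     a \<otimes> b \<otimes> inv a \<otimes> inv b \<in> derived G (derived G (carrier G))"

lemma second_derived_normal: "derived G (derived G (carrier G)) \<lhd> G"
  by (intro derived_is_normal normal_self)

lemma comm_mod_iff:
  assumes "a \<in> carrier G" "b \<in> carrier G"
  shows "comm_mod a b \<longleftrightarrow>
    derived G (derived G (carrier G)) #> (a \<otimes> b) =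
    derived G (derived G (carrier G)) #> (b \<otimes> a)"
proof -
  interpret E: normal "derived G (derived G (carrier G))" G
    by (rule second_derived_normal)
  have "a \<otimes> b \<otimes> inv (b \<otimes> a) = a \<otimes> b \<otimes> inv a \<otimes> inv b"
    using assms by (simp add: inv_mult_group m_assoc)
  then have "comm_mod a b \<longleftrightarrow>
      a \<otimes> b \<in> derived G (derived G (carrier G)) #> (b \<otimes> a)"
    unfolding comm_mod_def
    using E.rcos_module[OF is_group, of "b \<otimes> a" "a \<otimes> b"] assms by simp
  moreover have "a \<otimes> b \<in> derived G (derived G (carrier G)) #> (a \<otimes> b)"
    using assms by (intro rcos_self E.is_subgroup) simp
  moreover have "a \<otimes> b \<in> derived G (derived G (carrier G)) #> (b \<otimes> a) \<Longrightarrow>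
      derived G (derived G (carrier G)) #> (b \<otimes> a) =
      derived G (derived G (carrier G)) #> (a \<otimes> b)"
    using assms by (intro repr_independence E.is_subgroup) simp_all
  ultimately show ?thesis by auto
qed

lemma comm_mod_sym:
  "a \<in> carrier G \<Longrightarrow> b \<in> carrier G \<Longrightarrow> comm_mod a b \<Longrightarrow> comm_mod b a"
  by (simp add: comm_mod_iff)

lemma comm_mod_commute:
  assumes "a \<in> carrier G" "b \<in> carrier G" "a \<otimes> b = b \<otimes> a"
  shows "comm_mod a b"
  using assms by (simp add: comm_mod_iff)

text \<open>Together with \<open>comm_mod_inv\<close>: the elements related to \<open>a\<close> form
  the preimage of a centralizer. Every later reduction to generators rests on this.\<close>

lemma comm_mod_mult:
  assumes "a \<in> carrier G" "b \<in> carrier G" "c \<in> carrier G" "comm_mod a b" "comm_mod a c"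
  shows "comm_mod a (b \<otimes> c)"
proof -
  interpret E: normal "derived G (derived G (carrier G))" G
    by (rule second_derived_normal)
  let ?E = "derived G (derived G (carrier G))"
  note [simp] = assms(1-3)
  have "?E #> (a \<otimes> (b \<otimes> c)) = (?E #> (a \<otimes> b)) <#> (?E #> c)"
    by (simp add: E.rcos_sum m_assoc)
  also have "\<dots> = (?E #> (b \<otimes> a)) <#> (?E #> c)"
    using assms by (simp add: comm_mod_iff)
  also have "\<dots> = (?E #> b) <#> (?E #> (a \<otimes> c))"
    by (simp add: E.rcos_sum m_assoc)
  also have "\<dots> = (?E #> b) <#> (?E #> (c \<otimes> a))"
    using assms by (simp add: comm_mod_iff)
  also have "\<dots> = ?E #> ((b \<otimes> c) \<otimes> a)"
    by (simp add: E.rcos_sum m_assoc)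
  finally show ?thesis
    by (simp add: comm_mod_iff)
qed

lemma comm_mod_inv:
  assumes "a \<in> carrier G" "b \<in> carrier G" "comm_mod a b"
  shows "comm_mod a (inv b)"
proof -
  interpret E: normal "derived G (derived G (carrier G))" G
    by (rule second_derived_normal)
  let ?E = "derived G (derived G (carrier G))"
  note [simp] = assms(1-2)
  have "?E #> (inv b \<otimes> a) = (?E #> inv b) <#> (?E #> (a \<otimes> b)) <#> (?E #> inv b)"
    by (simp add: E.rcos_sum m_assoc)
  also have "\<dots> = (?E #> inv b) <#> (?E #> (b \<otimes> a)) <#> (?E #> inv b)"
    using assms by (simp add: comm_mod_iff)
  also have "\<dots> = ?E #> (a \<otimes> inv b)"
    by (simp add: E.rcos_sum inv_solve_left m_assoc flip: m_assoc[of "inv b" b])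
  finally show ?thesis
    by (simp add: comm_mod_iff)
qed

lemma comm_mod_derived:
  assumes "a \<in> derived G (carrier G)" "b \<in> derived G (carrier G)"
  shows "comm_mod a b"
proof -
  have "a \<otimes> b \<otimes> inv a \<otimes> inv b \<in> derived_set G (derived G (carrier G))"
    using assms by blast
  then show ?thesis
    unfolding comm_mod_def derived_def[of G "derived G (carrier G)"] by (rule generate.incl)
qed

lemma commutator_in_derived:
  assumes "a \<in> carrier G" "b \<in> carrier G"
  shows "a \<otimes> inv (b \<otimes> a \<otimes> inv b) \<in> derived G (carrier G)"
proof -
  have "a \<otimes> inv (b \<otimes> a \<otimes> inv b) = a \<otimes> b \<otimes> inv a \<otimes> inv b"
    using assms by (simp add: inv_mult_group m_assoc)
  then show ?thesis
    using assms unfolding derived_def by (auto intro!: generate.incl)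
qed

text \<open>Writing \<open>f = d w\<close> and \<open>g = e u\<close> with the conjugates
  \<open>w\<close>, \<open>u\<close> leaves factors \<open>d\<close>, \<open>e\<close> in the
  derived subgroup, which are related for free. From \<open>w ~ g\<close> and \<open>w ~ u\<close>
  follows \<open>w ~ e\<close>, so \<open>f = d w ~ e\<close>; with \<open>f ~ u\<close> this gives
  \<open>f ~ e u = g\<close>.\<close>

lemma comm_mod_by_conjugates:
  assumes [simp]: "f \<in> carrier G" "g \<in> carrier G" "s \<in> carrier G" "t \<in> carrier G"
    and fsg: "comm_mod (s \<otimes> f \<otimes> inv s) g"
    and fgt: "comm_mod f (t \<otimes> g \<otimes> inv t)"
    and fsgt: "comm_mod (s \<otimes> f \<otimes> inv s) (t \<otimes> g \<otimes> inv t)"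
  shows "comm_mod f g"
proof -
  define w u where "w = s \<otimes> f \<otimes> inv s" and "u = t \<otimes> g \<otimes> inv t"
  have [simp]: "w \<in> carrier G" "u \<in> carrier G"
    by (simp_all add: w_def u_def)
  define d e where "d = f \<otimes> inv w" and "e = g \<otimes> inv u"
  have [simp]: "d \<in> carrier G" "e \<in> carrier G"
    by (simp_all add: d_def e_def)
  have fd: "f = d \<otimes> w" and ge: "g = e \<otimes> u"
    by (simp_all add: d_def e_def m_assoc)
  have "comm_mod w e"
    unfolding e_def using fsg fsgt by (simp add: comm_mod_mult comm_mod_inv w_def u_def)
  moreover have "comm_mod d e"
    unfolding d_def e_def w_def u_def by (intro comm_mod_derived commutator_in_derived) simp_all
  ultimately have "comm_mod e f"
    unfolding fd by (intro comm_mod_mult comm_mod_sym[of _ e]) simp_all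
  then have "comm_mod f e"
    by (simp add: comm_mod_sym)
  then show ?thesis
    using fgt unfolding u_def[symmetric] by (subst ge) (simp add: comm_mod_mult)
qed

lemma derived_perfect:
  assumes "\<And>f g. f \<in> carrier G \<Longrightarrow> g \<in> carrier G \<Longrightarrow> comm_mod f g"
  shows "derived G (carrier G) = derived G (derived G (carrier G))"
proof
  have "subgroup (derived G (carrier G)) G"
    by (simp add: derived_is_subgroup)
  then show "derived G (derived G (carrier G)) \<subseteq> derived G (carrier G)"
    by (simp add: derived_incl)
  have "derived_set G (carrier G) \<subseteq> derived G (derived G (carrier G))"
    using assms by (auto simp: comm_mod_def)
  moreover have "subgroup (derived G (derived G (carrier G))) G"
    by (simp add: derived_is_subgroup derived_in_carrier)
  ultimately show "derived G (carrier G) \<subseteq> derived G (derived G (carrier G))"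
    unfolding derived_def[of G "carrier G"] by (rule generate_subgroup_incl)
qed

end

section \<open>Groups of bijections and disjointness of moved sets\<close>

lemma group_bij_group: "group (bij_group S)"
proof (rule groupI)
  fix x assume "x \<in> carrier (bij_group S)"
  then have "inv_into UNIV x permutes S" "inv_into UNIV x \<circ> x = id"
    by (auto simp: bij_group_def permutes_inv permutes_inv_o)
  then show "\<exists>y\<in>carrier (bij_group S). y \<otimes>\<^bsub>bij_group S\<^esub> x = \<one>\<^bsub>bij_group S\<^esub>"
    by (auto simp: bij_group_def)
qed (auto simp: bij_group_def permutes_id o_assoc intro: permutes_compose)

lemma inv_bij_group: "f permutes S \<Longrightarrow> inv\<^bsub>bij_group S\<^esub> f = inv_into UNIV f"
  by (rule group.inv_equality[OF group_bij_group])
     (auto simp: bij_group_def permutes_inv permutes_inv_o)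

text \<open>The carrier is replaced by \<open>G\<close>, so the second derived subgroup is that of
  \<open>G\<close> and not that of all bijections; \<open>perfect_derived\<close> transfers the
  outcome back to \<open>bij_group S\<close>.\<close>

definition derived_commute :: "'a set \<Rightarrow> ('a \<Rightarrow> 'a) set \<Rightarrow> ('a \<Rightarrow> 'a) \<Rightarrow> ('a \<Rightarrow> 'a) \<Rightarrow> bool" where
  "derived_commute S G = group.comm_mod ((bij_group S) \<lparr>carrier := G\<rparr>)"

locale bij_subgroup =
  fixes S :: "'a set" and G :: "('a \<Rightarrow> 'a) set"
  assumes sub: "subgroup G (bij_group S)"
begin

definition "GG = (bij_group S) \<lparr>carrier := G\<rparr>"

lemma group_GG: "group GG"
  unfolding GG_def using group_bij_group sub by (rule group.subgroup_imp_group)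

sublocale GG: group GG
  by (rule group_GG)

lemma GG_simps [simp]: "carrier GG = G" "x \<otimes>\<^bsub>GG\<^esub> y = x \<circ> y" "\<one>\<^bsub>GG\<^esub> = id"
  by (auto simp: bij_group_def GG_def)

lemma derived_commute_eq: "derived_commute S G = GG.comm_mod"
  by (simp add: derived_commute_def GG_def)

lemma permutes: "f \<in> G \<Longrightarrow> f permutes S"
  using subgroup.subset[OF sub] by (auto simp: bij_group_def)

lemma bij: "f \<in> G \<Longrightarrow> bij f"
  using permutes permutes_bij by blast

lemma GG_inv: "f \<in> G \<Longrightarrow> inv\<^bsub>GG\<^esub> f = inv_into UNIV f"
  using group.m_inv_consistent[OF group_bij_group sub] inv_bij_group permutes by (metis GG_def)

lemma comp_closed: "f \<in> G \<Longrightarrow> g \<in> G \<Longrightarrow> f \<circ> g \<in> G"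
  using GG.m_closed by simp

lemma inv_closed: "f \<in> G \<Longrightarrow> inv_into UNIV f \<in> G"
  using GG.inv_closed GG_inv by fastforce

lemma id_closed: "id \<in> G"
  using GG.one_closed by simp

lemma derived_commute_sym: "f \<in> G \<Longrightarrow> g \<in> G \<Longrightarrow> derived_commute S G f g \<Longrightarrow> derived_commute S G g f"
  unfolding derived_commute_eq by (rule GG.comm_mod_sym) simp_all

lemma derived_commute_commute: "f \<in> G \<Longrightarrow> g \<in> G \<Longrightarrow> f \<circ> g = g \<circ> f \<Longrightarrow> derived_commute S G f g"
  unfolding derived_commute_eq by (rule GG.comm_mod_commute) simp_all

lemma derived_commute_comp:
  "f \<in> G \<Longrightarrow> g \<in> G \<Longrightarrow> h \<in> G \<Longrightarrow> derived_commute S G f g \<Longrightarrow> derived_commute S G f h \<Longrightarrow> derived_commute S G f (g \<circ> h)"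
  unfolding derived_commute_eq using GG.comm_mod_mult[of f g h] by simp

lemma derived_commute_conjugates:
  assumes "f \<in> G" "g \<in> G" "s \<in> G" "t \<in> G"
    "derived_commute S G (s \<circ> f \<circ> inv_into UNIV s) g"
    "derived_commute S G f (t \<circ> g \<circ> inv_into UNIV t)"
    "derived_commute S G (s \<circ> f \<circ> inv_into UNIV s) (t \<circ> g \<circ> inv_into UNIV t)"
  shows "derived_commute S G f g"
  using assms GG.comm_mod_by_conjugates[of f g s t] unfolding derived_commute_eq
  by (simp add: GG_inv)

text \<open>A bijection preserves its moved set: where \<open>f\<close> moves \<open>x\<close> it
  also moves \<open>f x\<close>, so \<open>g\<close> fixes both points.\<close>

lemma commute_disjoint:
  assumes "f \<in> G" "g \<in> G" and d: "\<And>x. f x = x \<or> g x = x"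
  shows "f \<circ> g = g \<circ> f"
proof
  fix x
  have inj: "f a = f b \<longleftrightarrow> a = b" "g a = g b \<longleftrightarrow> a = b" for a b
    using bij[OF assms(1)] bij[OF assms(2)] by (metis bij_def inj_eq)+
  show "(f \<circ> g) x = (g \<circ> f) x"
  proof (cases "f x = x")
    case True
    then show ?thesis
      using d[of "g x"] inj(2)[of "g x" x] by auto
  next
    case False
    then have "g x = x" "g (f x) = f x"
      using d[of x] d[of "f x"] inj(1)[of "f x" x] by auto
    then show ?thesis by simp
  qed
qed

lemma derived_commute_disjoint:
  assumes "f \<in> G" "g \<in> G" and "\<And>x. f x = x \<or> g x = x"
  shows "derived_commute S G f g"
  using assms by (intro derived_commute_commute commute_disjoint)

text \<open>In \<open>f = f' \<circ> (f'^-1 \<circ> f)\<close> the second factor is the identity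
  wherever \<open>g\<close> moves points, so it commutes with \<open>g\<close>. This lets a
  localized substitute for \<open>f\<close> be tested against \<open>g\<close>.\<close>

lemma derived_commute_local:
  assumes "f \<in> G" "f' \<in> G" "g \<in> G" and eq: "\<And>x. g x \<noteq> x \<Longrightarrow> f' x = f x" and c: "derived_commute S G f' g"
  shows "derived_commute S G f g"
proof -
  let ?w = "inv_into UNIV f' \<circ> f"
  have w: "?w \<in> G" using assms by (intro comp_closed inv_closed)
  have "inv_into UNIV f' (f x) = x \<or> g x = x" for x
    using eq[of x] bij[OF \<open>f' \<in> G\<close>] by (metis bij_inv_eq_iff)
  then have "derived_commute S G ?w g"
    by (intro derived_commute_disjoint w assms) simp
  then have "derived_commute S G g (f' \<circ> ?w)"
    using c w assms derived_commute_sym[OF w \<open>g \<in> G\<close>] derived_commute_sym[OF \<open>f' \<in> G\<close> \<open>g \<in> G\<close>]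
    by (intro derived_commute_comp[OF \<open>g \<in> G\<close> \<open>f' \<in> G\<close> w]) blast+
  moreover have "f' \<circ> ?w = f"
    using bij[OF \<open>f' \<in> G\<close>] by (auto simp: bij_def fun_eq_iff surj_f_inv_f)
  ultimately show ?thesis
    using assms by (simp add: derived_commute_sym)
qed

text \<open>
  It suffices that \<open>f\<close> is the identity on \<open>t ` B\<close> and \<open>t ` t ` B\<close>, where \<open>g\<close> is supported in \<open>B\<close>,
  because the two conjugations may go in opposite directions.
\<close>

lemma derived_commute_displaced:
  assumes G: "f \<in> G" "g \<in> G" "t \<in> G"
    and fix1: "\<And>x. g x \<noteq> x \<Longrightarrow> f (t x) = t x" and fix2: "\<And>x. g x \<noteq> x \<Longrightarrow> f (t (t x)) = t (t x)"
  shows "derived_commute S G f g"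
proof -
  let ?s = "inv_into UNIV t"
  have b: "bij t" using bij G by blast
  have ii: "inv_into UNIV ?s = t"
    using b by (simp add: inv_inv_eq)
  have ts: "t (?s x) = x" "?s (t x) = x" for x
    using b by (simp_all add: bij_def surj_f_inv_f)
  have tb: "t a = t b \<longleftrightarrow> a = b" "?s a = ?s b \<longleftrightarrow> a = b" for a b
    using ts by metis+
  have s: "?s \<in> G" using G inv_closed by blast
  have cl: "?s \<circ> f \<circ> inv_into UNIV ?s \<in> G" "t \<circ> g \<circ> inv_into UNIV t \<in> G"
    using G s by (auto intro: comp_closed inv_closed)
  show ?thesis
  proof (rule derived_commute_conjugates[OF G(1,2) s G(3)])
    have 1: "f (t x) = t x" if "t (g (?s (t x))) \<noteq> t x" for x
      using that fix1[of x] by (metis ts(2))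
    have 2: "f (t (t x)) = t (t x)" if "t (g (?s (t x))) \<noteq> t x" for x
      using that fix2[of x] by (metis ts(2))
    show "derived_commute S G (?s \<circ> f \<circ> inv_into UNIV ?s) g"
      by (rule derived_commute_disjoint[OF cl(1) G(2)]) (use fix1 ts in \<open>auto simp: ii\<close>)
    show "derived_commute S G f (t \<circ> g \<circ> ?s)"
    proof (rule derived_commute_disjoint[OF G(1) cl(2)])
      show "f x = x \<or> (t \<circ> g \<circ> ?s) x = x" for x
        using 1[of "?s x"] ts(1)[of x] by auto
    qed
    \<comment> \<open>The first map moves the points of \<open>t^-1(A)\<close> and the second those
      of \<open>t(B)\<close>, where \<open>A\<close> and \<open>B\<close> are the sets moved by
      \<open>f\<close> and \<open>g\<close>; applying \<open>t\<close> turns disjointness of these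
      into \<open>fix2\<close>.\<close>
    show "derived_commute S G (?s \<circ> f \<circ> inv_into UNIV ?s) (t \<circ> g \<circ> ?s)"
    proof (rule derived_commute_disjoint[OF cl])
      show "(?s \<circ> f \<circ> inv_into UNIV ?s) x = x \<or> (t \<circ> g \<circ> ?s) x = x" for x
        using 2[of "?s x"] ts(1)[of x] ts(2)[of x] by (auto simp: ii)
    qed
  qed
qed

lemma perfect_derived:
  assumes "\<And>f g. f \<in> G \<Longrightarrow> g \<in> G \<Longrightarrow> derived_commute S G f g"
  shows "perfect (bij_group S) (derived (bij_group S) G)"
proof -
  have c: "derived GG K = derived (bij_group S) K" if "K \<subseteq> G" for K
    unfolding GG_def using group.derived_consistent[OF group_bij_group that sub] .
  have "derived GG (carrier GG) = derived GG (derived GG (carrier GG))"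
    using assms unfolding derived_commute_eq by (intro GG.derived_perfect) simp_all
  moreover have "derived (bij_group S) G \<subseteq> G"
    using group.derived_incl[OF group_bij_group _ sub, of G] by simp
  ultimately show ?thesis
    using c[of G] c[of "derived (bij_group S) G"] by (simp add: perfect_def)
qed

end

section \<open>Calculus of \<open>C\<^sup>k\<close> maps\<close>

lemma times_cont_diff_cong:
  assumes "open W" "\<And>x. x \<in> W \<Longrightarrow> f x = g x"
  shows "times_cont_diff k f W \<longleftrightarrow> times_cont_diff k g W"
  using assms(2)
proof (induction k arbitrary: f g)
  case 0
  then show ?case by (simp cong: continuous_on_cong)
next
  case (Suc k)
  have 1: "(f has_derivative D) (at x) \<longleftrightarrow> (g has_derivative D) (at x)" if "x \<in> W" for D x
    using has_derivative_transform_within_open[of f D x UNIV W g]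
      has_derivative_transform_within_open[of g D x UNIV W f] that assms(1) Suc.prems by auto
  then have 2: "frechet_derivative f (at x) = frechet_derivative g (at x)" if "x \<in> W" for x
    using that by (simp add: frechet_derivative_def)
  have "times_cont_diff k (\<lambda>x. frechet_derivative f (at x) v) W \<longleftrightarrow>
      times_cont_diff k (\<lambda>x. frechet_derivative g (at x) v) W" for v
    by (rule Suc.IH) (simp add: 2)
  then show ?case
    using 1 by (simp add: differentiable_def)
qed

lemma times_cont_diff_subset: "times_cont_diff k f W \<Longrightarrow> V \<subseteq> W \<Longrightarrow> times_cont_diff k f V"
  by (induction k arbitrary: f) (auto intro: continuous_on_subset)

text \<open>\<open>frechet_derivative\<close> is a choice operator; this rule admits any explicit
  formula for the derivative in its place. Since \<open>W\<close> is open, the two agree on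
  neighbourhoods, as the higher derivatives require.\<close>

lemma times_cont_diff_SucI:
  assumes "open W" "\<And>x. x \<in> W \<Longrightarrow> (f has_derivative f' x) (at x)"
    and "\<And>v. times_cont_diff k (\<lambda>x. f' x v) W"
  shows "times_cont_diff (Suc k) f W"
proof -
  have "frechet_derivative f (at x) = f' x" if "x \<in> W" for x
    using assms(2)[OF that] frechet_derivative_at by metis
  then have "times_cont_diff k (\<lambda>x. frechet_derivative f (at x) v) W" for v
    using times_cont_diff_cong[OF assms(1), of "\<lambda>x. frechet_derivative f (at x) v" "\<lambda>x. f' x v"]
      assms(3) by simp
  then show ?thesis
    using assms(2) by (auto simp: differentiable_def)
qed

lemma times_cont_diff_SucD:
  assumes "times_cont_diff (Suc k) f W"
  shows "times_cont_diff k f W"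
  using assms
proof (induction k arbitrary: f)
  case 0
  then show ?case
    by (auto simp: differentiable_imp_continuous_within continuous_at_imp_continuous_on)
next
  case (Suc k)
  then show ?case
    by (metis times_cont_diff.simps(2))
qed

lemma times_cont_diff_continuous: "times_cont_diff k f W \<Longrightarrow> continuous_on W f"
  by (induction k) (auto dest: times_cont_diff_SucD simp del: times_cont_diff.simps(2))

lemma times_cont_diff_has_derivative:
  "times_cont_diff (Suc k) f W \<Longrightarrow> x \<in> W \<Longrightarrow>
    (f has_derivative frechet_derivative f (at x)) (at x)"
  by (simp add: frechet_derivative_works)

lemma times_cont_diff_const: "open W \<Longrightarrow> times_cont_diff k (\<lambda>x. c) W"
proof (induction k arbitrary: c)
  case (Suc k)
  show ?case
    by (rule times_cont_diff_SucI[where f' = "\<lambda>x v. 0"]) (use Suc in auto)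
qed simp

lemma times_cont_diff_linear:
  "open W \<Longrightarrow> bounded_linear L \<Longrightarrow> times_cont_diff k L W"
proof (induction k)
  case 0
  then show ?case by (simp add: linear_continuous_on)
next
  case (Suc k)
  show ?case
    by (rule times_cont_diff_SucI[where f' = "\<lambda>x. L"])
       (use Suc in \<open>auto intro: bounded_linear_imp_has_derivative times_cont_diff_const\<close>)
qed

lemma times_cont_diff_add:
  assumes "open W"
  shows "times_cont_diff k f W \<Longrightarrow> times_cont_diff k g W \<Longrightarrow> times_cont_diff k (\<lambda>x. f x + g x) W"
proof (induction k arbitrary: f g)
  case 0
  then show ?case by (simp add: continuous_on_add)
next
  case (Suc k)
  show ?case
    by (rule times_cont_diff_SucI[where
          f' = "\<lambda>x v. frechet_derivative f (at x) v + frechet_derivative g (at x) v"])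
       (use Suc assms in \<open>auto intro!: has_derivative_add simp: frechet_derivative_works\<close>)
qed

lemma times_cont_diff_bilinear:
  assumes "open W" "bounded_bilinear B"
  shows "times_cont_diff k f W \<Longrightarrow> times_cont_diff k g W \<Longrightarrow> times_cont_diff k (\<lambda>x. B (f x) (g x)) W"
proof (induction k arbitrary: f g)
  case 0
  then show ?case using assms(2) by (simp add: bounded_bilinear.continuous_on)
next
  case (Suc k)
  show ?case
  proof (rule times_cont_diff_SucI[where f' =
      "\<lambda>x v. B (f x) (frechet_derivative g (at x) v) + B (frechet_derivative f (at x) v) (g x)"])
    show "((\<lambda>x. B (f x) (g x)) has_derivative (\<lambda>v. B (f x) (frechet_derivative g (at x) v) +
        B (frechet_derivative f (at x) v) (g x))) (at x)" if "x \<in> W" for x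
      using Suc.prems that
      by (intro bounded_bilinear.FDERIV[OF assms(2)] times_cont_diff_has_derivative)
    show "times_cont_diff k (\<lambda>x. B (f x) (frechet_derivative g (at x) v) +
        B (frechet_derivative f (at x) v) (g x)) W" for v
    proof (intro times_cont_diff_add assms(1) Suc.IH)
      show "times_cont_diff k f W" "times_cont_diff k g W"
        using Suc.prems times_cont_diff_SucD by blast+
    qed (use Suc.prems in auto)
  qed (fact assms(1))
qed

lemma times_cont_diff_sum:
  assumes "open W" "\<And>i. i \<in> I \<Longrightarrow> times_cont_diff k (f i) W"
  shows "times_cont_diff k (\<lambda>x. \<Sum>i\<in>I. f i x) W"
  using assms(2)
  by (induction I rule: infinite_finite_induct)
     (auto intro: times_cont_diff_const times_cont_diff_add assms(1))

lemma times_cont_diff_compose: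
  fixes f :: "'a::real_normed_vector \<Rightarrow> 'b::euclidean_space" and g :: "'b \<Rightarrow> 'c::real_normed_vector"
  assumes "open W" "open V" "f ` W \<subseteq> V"
  shows "times_cont_diff k f W \<Longrightarrow> times_cont_diff k g V \<Longrightarrow> times_cont_diff k (\<lambda>x. g (f x)) W"
proof (induction k arbitrary: g)
  case 0
  then show ?case
    using continuous_on_compose2[OF _ _ assms(3), of g] by simp
next
  case (Suc k)
  let ?Df = "\<lambda>x. frechet_derivative f (at x)" and ?Dg = "\<lambda>x. frechet_derivative g (at x)"
  show ?case
  \<comment> \<open>The derivative \<open>Dg(f x)(Df x v)\<close> depends on \<open>x\<close>
    through base point and direction at once. Expanding the direction in the basis gives products of
    coordinates of \<open>Df x v\<close> with functions \<open>Dg(f x) b\<close>, and the induction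
    hypothesis covers the latter with \<open>g\<close> replaced by a directional derivative.\<close>
  proof (rule times_cont_diff_SucI[where f' = "\<lambda>x v. \<Sum>b\<in>Basis. (?Df x v \<bullet> b) *\<^sub>R ?Dg (f x) b"])
    fix x assume x: "x \<in> W"
    then have fx: "f x \<in> V" using assms by auto
    have 1: "((\<lambda>x. g (f x)) has_derivative (\<lambda>v. ?Dg (f x) (?Df x v))) (at x)"
      using has_derivative_compose[OF times_cont_diff_has_derivative[OF Suc.prems(1) x]
          times_cont_diff_has_derivative[OF Suc.prems(2) fx]] .
    have 2: "?Dg (f x) w = (\<Sum>b\<in>Basis. (w \<bullet> b) *\<^sub>R ?Dg (f x) b)" for w
    proof -
      have "linear (?Dg (f x))"
        using times_cont_diff_has_derivative[OF Suc.prems(2) fx] has_derivative_linear by blast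
      then have "?Dg (f x) (\<Sum>b\<in>Basis. (w \<bullet> b) *\<^sub>R b) = (\<Sum>b\<in>Basis. (w \<bullet> b) *\<^sub>R ?Dg (f x) b)"
        by (simp add: linear_sum linear_cmul)
      then show ?thesis by (simp add: euclidean_representation)
    qed
    show
      "((\<lambda>x. g (f x)) has_derivative (\<lambda>v. \<Sum>b\<in>Basis. (?Df x v \<bullet> b) *\<^sub>R ?Dg (f x) b)) (at x)"
      by (rule has_derivative_eq_rhs[OF 1 ext[OF 2]])
  next
    fix v
    have "times_cont_diff k (\<lambda>x. ?Dg (f x) b) W" for b
      using Suc.IH[of "\<lambda>y. ?Dg y b"] Suc.prems times_cont_diff_SucD by auto
    moreover have "times_cont_diff k (\<lambda>x. ?Df x v \<bullet> b) W" for b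
      using Suc.prems(1)
      by (intro times_cont_diff_bilinear[OF assms(1) bounded_bilinear_inner]
          times_cont_diff_const assms(1)) simp
    ultimately show "times_cont_diff k (\<lambda>x. \<Sum>b\<in>Basis. (?Df x v \<bullet> b) *\<^sub>R ?Dg (f x) b) W"
      by (intro times_cont_diff_sum assms(1)
          times_cont_diff_bilinear[OF assms(1) bounded_bilinear_scaleR])
  qed (fact assms(1))
qed

lemma times_cont_diff_inverse:
  fixes f :: "'a::real_normed_vector \<Rightarrow> real"
  assumes "open W" "\<And>x. x \<in> W \<Longrightarrow> f x \<noteq> 0"
  shows "times_cont_diff k f W \<Longrightarrow> times_cont_diff k (\<lambda>x. inverse (f x)) W"
proof (induction k)
  case 0
  then show ?case
    using assms by (auto intro: continuous_on_inverse)
next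
  case (Suc k)
  have ih: "times_cont_diff k (\<lambda>x. inverse (f x)) W"
    using Suc times_cont_diff_SucD by blast
  show ?case
  proof (rule times_cont_diff_SucI[where f' =
      "\<lambda>x v. - (inverse (f x) * frechet_derivative f (at x) v * inverse (f x))"])
    show "((\<lambda>x. inverse (f x)) has_derivative
        (\<lambda>v. - (inverse (f x) * frechet_derivative f (at x) v * inverse (f x)))) (at x)"
      if "x \<in> W" for x
      using that assms Suc.prems
      by (intro Deriv.has_derivative_inverse times_cont_diff_has_derivative) auto
    have "times_cont_diff k (\<lambda>x. (- 1) * ((inverse (f x) * frechet_derivative f (at x) v)
        * inverse (f x))) W" for v
      using Suc.prems ih
      by (intro times_cont_diff_bilinear[OF assms(1) bounded_bilinear_mult]
          times_cont_diff_const assms(1)) auto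
    then show "times_cont_diff k
        (\<lambda>x. - (inverse (f x) * frechet_derivative f (at x) v * inverse (f x))) W" for v
      by simp
  qed (fact assms(1))
qed

text \<open>Bootstrapping: the derivative of \<open>h\<close> at \<open>y\<close> is
  \<open>A (h y)\<close>, so if \<open>h\<close> is of class C^k then so is its derivative, and
  \<open>h\<close> is of class C^(k+1). Having \<open>A\<close> as an explicit smooth family avoids
  differentiating operator inversion.\<close>

lemma times_cont_diff_inverse_map:
  fixes f h :: "'a::euclidean_space \<Rightarrow> 'a"
  assumes "open W" "open V" "h ` V \<subseteq> W"
    and fh: "\<And>y. y \<in> V \<Longrightarrow> f (h y) = y" and h: "continuous_on V h"
    and f: "\<And>x. x \<in> W \<Longrightarrow> (f has_derivative f' x) (at x)"
    and A: "\<And>x. x \<in> W \<Longrightarrow> linear (A x)" "\<And>x v. x \<in> W \<Longrightarrow> A x (f' x v) = v"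
    and smooth: "\<And>j v. times_cont_diff j (\<lambda>x. A x v) W"
  shows "times_cont_diff k h V"
proof (induction k)
  case 0
  then show ?case using h by simp
next
  case (Suc k)
  show ?case
  proof (rule times_cont_diff_SucI[where f' = "\<lambda>y. A (h y)"])
    show "(h has_derivative A (h y)) (at y)" if y: "y \<in> V" for y
    proof (rule has_derivative_inverse_basic[OF f])
      show "continuous (at y) h"
        using h y assms(2) by (simp add: continuous_on_eq_continuous_at)
    qed (use y assms in \<open>auto intro!: linear_conv_bounded_linear[THEN iffD1] simp: fun_eq_iff\<close>)
    show "times_cont_diff k (\<lambda>y. A (h y) v) V" for v
      using times_cont_diff_compose[OF assms(2,1,3) Suc smooth] .
  qed (fact assms(2))
qed

section \<open>A smooth shrinking map\<close>

text \<open>The functions t^-j exp(-1/t), extended by zero. The index makes the family closed under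
  differentiation up to linear combinations, see \<open>flat_has_derivative\<close>.\<close>

definition flat :: "nat \<Rightarrow> real \<Rightarrow> real" where
  "flat j t = (if t > 0 then inverse t ^ j * exp (- inverse t) else 0)"

lemma flat_tendsto: "(flat j \<longlongrightarrow> 0) (at 0)"
proof -
  have "((\<lambda>t::real. inverse t ^ j * exp (- inverse t)) \<longlongrightarrow> 0) (at_right 0)"
    by real_asymp
  then have "(flat j \<longlongrightarrow> 0) (at_right 0)"
    by (rule Lim_transform_eventually) (simp add: flat_def eventually_at_filter)
  moreover have "(flat j \<longlongrightarrow> 0) (at_left 0)"
    by (rule Lim_transform_eventually[OF tendsto_const]) (simp add: flat_def eventually_at_filter)
  ultimately show ?thesis
    by (simp add: filterlim_split_at_real)
qed

lemma inverse_power_has_derivative: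
  fixes t :: real
  assumes "t \<noteq> 0"
  shows "((\<lambda>t. inverse t ^ j) has_real_derivative - (real j * inverse t ^ (j + 1))) (at t)"
proof (induction j)
  case (Suc j)
  have "((\<lambda>t. inverse t * inverse t ^ j) has_real_derivative
      inverse t * (- (real j * inverse t ^ (j + 1))) + (- (inverse t * inverse t)) * inverse t ^ j) (at t)"
    using DERIV_mult'[OF _ Suc, of inverse "- (inverse t * inverse t)"] DERIV_inverse'[OF DERIV_ident assms]
    by (simp add: algebra_simps)
  then show ?case by (simp add: algebra_simps)
qed simp

lemma flat_has_derivative:
  "(flat j has_real_derivative (flat (j + 2) t - real j * flat (j + 1) t)) (at t)"
proof -
  consider "t > 0" | "t < 0" | "t = 0" by linarith
  then show ?thesis
  proof cases
    case 1
    have "((\<lambda>t. exp (- inverse t)) has_real_derivative inverse t * inverse t * exp (- inverse t)) (at t)"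
      using 1 by (auto intro!: derivative_eq_intros)
    from DERIV_mult[OF inverse_power_has_derivative this]
    have "((\<lambda>t. inverse t ^ j * exp (- inverse t)) has_real_derivative
        (flat (j + 2) t - real j * flat (j + 1) t)) (at t)"
      using 1 by (simp add: flat_def algebra_simps)
    then show ?thesis
      by (rule has_field_derivative_transform_within_open[where S = "{0<..}"])
         (use 1 in \<open>auto simp: flat_def\<close>)
  next
    case 2
    have "((\<lambda>t::real. 0) has_real_derivative (flat (j + 2) t - real j * flat (j + 1) t)) (at t)"
      using 2 by (simp add: flat_def)
    then show ?thesis
      by (rule has_field_derivative_transform_within_open[where S = "{..<0}"])
         (use 2 in \<open>auto simp: flat_def\<close>)
  next
    case 3
    \<comment> \<open>At 0 the difference quotient of \<open>flat j\<close> is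
      \<open>flat (Suc j)\<close>, so its limit is an instance of
      \<open>flat_tendsto\<close>.\<close>
    have "((\<lambda>h. flat j (0 + h) / h) \<longlongrightarrow> 0) (at 0)"
      by (rule Lim_transform_eventually[OF flat_tendsto[of "Suc j"]])
         (simp add: flat_def eventually_at_filter field_simps)
    then show ?thesis
      using 3 by (simp add: DERIV_def flat_def)
  qed
qed

lemma times_cont_diff_flat: "times_cont_diff k (flat j) UNIV"
proof (induction k arbitrary: j)
  case 0
  show ?case
    using flat_has_derivative DERIV_isCont by (fastforce intro: continuous_at_imp_continuous_on)
next
  case (Suc k)
  show ?case
  proof (rule times_cont_diff_SucI)
    show "(flat j has_derivative (\<lambda>v. (flat (j + 2) t - real j * flat (j + 1) t) * v)) (at t)" for t
      using flat_has_derivative by (simp add: has_field_derivative_def)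
    have "times_cont_diff k (\<lambda>t. (flat (j + 2) t + (- real j) * flat (j + 1) t) * v) UNIV" for v
      by (intro times_cont_diff_bilinear[OF open_UNIV bounded_bilinear_mult]
          times_cont_diff_add[OF open_UNIV] times_cont_diff_const Suc.IH open_UNIV)
    then show "times_cont_diff k (\<lambda>t. (flat (j + 2) t - real j * flat (j + 1) t) * v) UNIV" for v
      by simp
  qed simp
qed

lemma flat_bounds: "0 \<le> flat j t" "flat 0 t < 1"
  by (auto simp: flat_def)

lemma flat_mono: "s \<le> t \<Longrightarrow> flat 0 s \<le> flat 0 t"
  by (auto simp: flat_def)

context
  fixes R :: real
  assumes R: "0 < R"
begin

text \<open>Using the squared norm keeps this smooth at the origin. It is below 1 exactly on the
  open ball of radius \<open>R\<close>. The division by 2 keeps it above 1/2, which surjectivity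
  uses, and cancels the 2 from the derivative of \<open>x \<bullet> x\<close>.\<close>

definition shrink_factor :: "'e::euclidean_space \<Rightarrow> real" where
  "shrink_factor x = 1 - flat 0 (R\<^sup>2 - x \<bullet> x) / 2"

definition shrink_at_0 :: "'e::euclidean_space \<Rightarrow> 'e" where
  "shrink_at_0 x = shrink_factor x *\<^sub>R x"

lemma shrink_factor_bounds: "1 / 2 < shrink_factor x" "shrink_factor x \<le> 1"
  using flat_bounds by (auto simp: shrink_factor_def)

lemma shrink_factor_pos: "0 < shrink_factor x"
  using shrink_factor_bounds(1)[of x] by linarith

lemma shrink_factor_mono: "norm x \<le> norm y \<Longrightarrow> shrink_factor x \<le> shrink_factor y"
  unfolding shrink_factor_def
  by (simp add: flat_mono power_mono dot_square_norm)

lemma norm_shrink_at_0: "norm (shrink_at_0 x) = shrink_factor x * norm x"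
  using shrink_factor_pos[of x] by (simp add: shrink_at_0_def)

lemma shrink_at_0_outside: "R \<le> norm x \<Longrightarrow> shrink_at_0 x = x"
  using R by (auto simp: shrink_at_0_def shrink_factor_def flat_def dot_square_norm power_mono
      dest: power_mono[of R "norm x" 2])

lemma norm_shrink_at_0_strict_mono:
  "norm x < norm y \<Longrightarrow> norm (shrink_at_0 x) < norm (shrink_at_0 y)"
  unfolding norm_shrink_at_0
  using shrink_factor_mono[of x y] shrink_factor_pos by (intro mult_le_less_imp_less) auto

lemma inj_shrink_at_0: "inj (shrink_at_0 :: 'e::euclidean_space \<Rightarrow> 'e)"
proof (rule injI)
  fix x y :: 'e assume eq: "shrink_at_0 x = shrink_at_0 y"
  then have "norm x = norm y"
    using norm_shrink_at_0_strict_mono[of x y] norm_shrink_at_0_strict_mono[of y x] by fastforce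
  then have "shrink_factor x = shrink_factor y"
    using shrink_factor_mono[of x y] shrink_factor_mono[of y x] by simp
  then show "x = y"
    using eq shrink_factor_pos[of y] by (simp add: shrink_at_0_def)
qed

lemma times_cont_diff_shrink_factor: "times_cont_diff k (shrink_factor :: 'e::euclidean_space \<Rightarrow> real) UNIV"
proof -
  have "times_cont_diff k (\<lambda>x::'e. 1 + (- 1 / 2) * flat 0 (R\<^sup>2 + (- 1) * (x \<bullet> x))) UNIV"
    by (intro times_cont_diff_add times_cont_diff_const open_UNIV
        times_cont_diff_bilinear[OF open_UNIV bounded_bilinear_mult]
        times_cont_diff_bilinear[OF open_UNIV bounded_bilinear_inner]
        times_cont_diff_compose[OF open_UNIV open_UNIV _ _ times_cont_diff_flat]
        times_cont_diff_linear bounded_linear_ident) simp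
  then show ?thesis
    by (simp add: shrink_factor_def[abs_def])
qed

lemma times_cont_diff_shrink_at_0: "times_cont_diff k shrink_at_0 UNIV"
  unfolding shrink_at_0_def[abs_def]
  by (intro times_cont_diff_bilinear[OF open_UNIV bounded_bilinear_scaleR]
      times_cont_diff_shrink_factor times_cont_diff_linear open_UNIV bounded_linear_ident)

lemma surj_shrink_at_0: "surj (shrink_at_0 :: 'e::euclidean_space \<Rightarrow> 'e)"
proof -
  have "\<exists>x. shrink_at_0 x = y" for y :: 'e
  proof (cases "y = 0")
    case True
    then show ?thesis by (intro exI[of _ 0]) (simp add: shrink_at_0_def)
  next
    case False
    define e where "e = y /\<^sub>R norm y"
    have e: "norm e = 1" using False by (simp add: e_def)
    have ye: "y = norm y *\<^sub>R e" using False by (simp add: e_def)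
    \<comment> \<open>The map is radial, so a preimage is sought on the ray through
      \<open>y\<close>; parameters up to \<open>2 * norm y\<close> suffice because the factor
      exceeds 1/2.\<close>
    have "continuous_on {0..2 * norm y} (\<lambda>t. shrink_factor (t *\<^sub>R e) * t)"
      by (intro continuous_intros continuous_on_compose2
          [OF times_cont_diff_continuous[OF times_cont_diff_shrink_factor[of 0]]]) simp
    moreover have "norm y \<le> shrink_factor ((2 * norm y) *\<^sub>R e) * (2 * norm y)"
      using shrink_factor_bounds(1)[of "(2 * norm y) *\<^sub>R e"] mult_right_mono[of "1 / 2"
          "shrink_factor ((2 * norm y) *\<^sub>R e)" "2 * norm y"] by simp
    ultimately obtain t where "shrink_factor (t *\<^sub>R e) * t = norm y"
      using IVT'[of "\<lambda>t. shrink_factor (t *\<^sub>R e) * t" 0 "norm y" "2 * norm y"] by auto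
    then have "shrink_at_0 (t *\<^sub>R e) = y"
      using ye by (simp add: shrink_at_0_def)
    then show ?thesis ..
  qed
  then show ?thesis by (metis surjI)
qed

lemma shrink_at_0_has_derivative:
  "(shrink_at_0 has_derivative
     (\<lambda>v. shrink_factor x *\<^sub>R v + (flat 2 (R\<^sup>2 - x \<bullet> x) * (x \<bullet> v)) *\<^sub>R x)) (at x)"
proof -
  have "(flat 0 has_real_derivative flat 2 t) (at t)" for t
    using flat_has_derivative[of 0 t] by (simp only: add_0 of_nat_0 mult_zero_left diff_zero)
  then have fl: "(flat 0 has_derivative (\<lambda>h. flat 2 t * h)) (at t within T)" for t T
    by (rule has_derivative_at_withinI[OF has_field_derivative_imp_has_derivative])
  have "((\<lambda>x. R\<^sup>2 - x \<bullet> x) has_derivative (\<lambda>v. - (2 * (x \<bullet> v)))) (at x)"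
    by (auto intro!: derivative_eq_intros simp: inner_commute)
  from has_derivative_compose[OF this fl[of _ UNIV]]
  have "(shrink_factor has_derivative (\<lambda>v. flat 2 (R\<^sup>2 - x \<bullet> x) * (x \<bullet> v))) (at x)"
    unfolding shrink_factor_def[abs_def]
    by (auto intro!: derivative_eq_intros simp: fun_eq_iff)
  from has_derivative_scaleR[OF this has_derivative_ident]
  show ?thesis
    unfolding shrink_at_0_def[abs_def] .
qed

text \<open>The derivative is a rank one perturbation of a multiple of the identity.\<close>

lemma times_cont_diff_inv_shrink_at_0:
  "times_cont_diff k (inv_into UNIV (shrink_at_0 :: 'e::euclidean_space \<Rightarrow> 'e)) UNIV"
proof -
  let ?f = "shrink_at_0 :: 'e \<Rightarrow> 'e"
  define p where "p x = flat 2 (R\<^sup>2 - x \<bullet> x)" for x :: 'e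
  define q where "q x = shrink_factor x + p x * (x \<bullet> x)" for x :: 'e
  have p: "0 \<le> p x" for x by (simp add: p_def flat_bounds)
  have q: "0 < q x" for x
    unfolding q_def using p[of x] shrink_factor_pos[of x] by (intro add_pos_nonneg) simp_all
  \<comment> \<open>The Sherman-Morrison formula for the inverse of sigma I + p x x^T, with sigma
    the shrink factor; \<open>q x\<close> is its denominator, positive since \<open>p x\<close> is
    nonnegative. The sign is written as a factor \<open>- 1\<close> so that only sum and product
    rules are required.\<close>
  let ?A = "\<lambda>x v. inverse (shrink_factor x) *\<^sub>R (v + ((- 1) * (p x * (x \<bullet> v) * inverse (q x))) *\<^sub>R x)"
  have pd: "times_cont_diff j p UNIV" for j
  proof -
    have "times_cont_diff j (\<lambda>x::'e. flat 2 (R\<^sup>2 + (- 1) * (x \<bullet> x))) UNIV"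
      by (intro times_cont_diff_add times_cont_diff_const open_UNIV
          times_cont_diff_bilinear[OF open_UNIV bounded_bilinear_mult]
          times_cont_diff_bilinear[OF open_UNIV bounded_bilinear_inner]
          times_cont_diff_compose[OF open_UNIV open_UNIV _ _ times_cont_diff_flat]
          times_cont_diff_linear bounded_linear_ident) simp
    then show ?thesis by (simp add: p_def[abs_def])
  qed
  have id: "times_cont_diff j (\<lambda>x::'e. x) UNIV" for j
    by (intro times_cont_diff_linear bounded_linear_ident open_UNIV)
  note tcd = times_cont_diff_add[OF open_UNIV] times_cont_diff_const[OF open_UNIV] pd id
    times_cont_diff_shrink_factor
    times_cont_diff_bilinear[OF open_UNIV bounded_bilinear_mult]
    times_cont_diff_bilinear[OF open_UNIV bounded_bilinear_inner]
    times_cont_diff_bilinear[OF open_UNIV bounded_bilinear_scaleR]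
  have qd: "times_cont_diff j q UNIV" for j
    unfolding q_def[abs_def] by (intro tcd)
  \<comment> \<open>Invariance of domain gives a continuous inverse on the image, which is the whole
    space by surjectivity.\<close>
  have homeo: "continuous_on UNIV (inv_into UNIV ?f)"
  proof -
    have "continuous_on UNIV ?f"
      using times_cont_diff_continuous[OF times_cont_diff_shrink_at_0[of 0]] .
    then obtain g where g: "homeomorphism UNIV (?f ` UNIV) ?f g"
      using invariance_of_domain_homeomorphism[OF open_UNIV _ _ inj_shrink_at_0] by auto
    have "inv_into UNIV ?f y = g y" for y
    proof -
      obtain x where "y = ?f x"
        using surj_shrink_at_0 by (metis surj_def)
      then show ?thesis
        using g by (simp add: homeomorphism_def inv_f_f[OF inj_shrink_at_0])
    qed
    then have "inv_into UNIV ?f = g" ..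
    then show ?thesis
      using g by (simp add: homeomorphism_def surj_shrink_at_0)
  qed
  show ?thesis
  proof (rule times_cont_diff_inverse_map[OF open_UNIV open_UNIV _ _ homeo
        shrink_at_0_has_derivative, where A = ?A])
    show "?f (inv_into UNIV ?f y) = y" for y
      by (rule surj_f_inv_f[OF surj_shrink_at_0])
    show "linear (?A x)" for x
      by (rule linearI) (simp_all add: algebra_simps)
    show "?A x (shrink_factor x *\<^sub>R v + (flat 2 (R\<^sup>2 - x \<bullet> x) * (x \<bullet> v)) *\<^sub>R x) = v" for x v
    proof -
      let ?w = "shrink_factor x *\<^sub>R v + (p x * (x \<bullet> v)) *\<^sub>R x"
      have "x \<bullet> ?w = (x \<bullet> v) * q x"
        by (simp add: q_def algebra_simps)
      then have eq: "(- 1) * (p x * (x \<bullet> ?w) * inverse (q x)) = - (p x * (x \<bullet> v))"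
        using q[of x] by (simp only:) (simp add: field_simps)
      have "?A x ?w = inverse (shrink_factor x) *\<^sub>R (?w + (- (p x * (x \<bullet> v))) *\<^sub>R x)"
        by (simp only: eq)
      also have "\<dots> = inverse (shrink_factor x) *\<^sub>R (shrink_factor x *\<^sub>R v)"
        by simp
      finally have "?A x ?w = \<dots>" .
      then show ?thesis
        using shrink_factor_pos[of x] by (simp add: p_def)
    qed
    show "times_cont_diff j (\<lambda>x. ?A x v) UNIV" for j v
      by (intro tcd times_cont_diff_inverse[OF open_UNIV] qd)
         (simp_all add: q[THEN less_imp_neq, symmetric] shrink_factor_pos[THEN less_imp_neq, symmetric])
  qed simp
qed

text \<open>On the closed ball of radius \<open>\<rho>\<close> the factor is largest at norm
  \<open>\<rho>\<close>, and iterates never leave the ball, so that value bounds the contraction at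
  every step.\<close>

lemma shrink_at_0_contracts:
  assumes "norm x \<le> \<rho>"
  shows "norm ((shrink_at_0 ^^ n) x) \<le> (1 - flat 0 (R\<^sup>2 - \<rho>\<^sup>2) / 2) ^ n * norm x"
proof (induction n)
  case (Suc n)
  let ?y = "(shrink_at_0 ^^ n) x" and ?\<theta> = "1 - flat 0 (R\<^sup>2 - \<rho>\<^sup>2) / 2"
  have \<theta>: "0 \<le> ?\<theta>" "?\<theta> \<le> 1"
    using flat_bounds(1)[of 0 "R\<^sup>2 - \<rho>\<^sup>2"] flat_bounds(2)[of "R\<^sup>2 - \<rho>\<^sup>2"] by linarith+
  have "norm ?y \<le> 1 * norm x"
    using Suc \<theta> by (meson mult_right_mono norm_ge_zero order_trans power_le_one)
  then have "?y \<bullet> ?y \<le> \<rho>\<^sup>2"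
    using assms by (simp add: dot_square_norm power_mono)
  then have "shrink_factor ?y \<le> ?\<theta>"
    unfolding shrink_factor_def by (simp add: flat_mono)
  then have "norm (shrink_at_0 ?y) \<le> ?\<theta> * (?\<theta> ^ n * norm x)"
    unfolding norm_shrink_at_0 using Suc \<theta> by (intro mult_mono) auto
  then show ?case by simp
qed simp

end

text \<open>The shrinking map recentred at \<open>c\<close>. The last property squeezes any smaller
  concentric ball towards the centre by iteration, while the moved points stay in one fixed
  ball.\<close>

lemma shrinking_diffeo:
  fixes c :: "'e::euclidean_space"
  assumes "0 < R"
  obtains F H where "\<And>k. times_cont_diff k F UNIV" "\<And>k. times_cont_diff k H UNIV"
    "\<And>x. F (H x) = x" "\<And>x. H (F x) = x" "\<And>x. R \<le> dist c x \<Longrightarrow> F x = x"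
    "\<And>\<rho> \<epsilon>. 0 \<le> \<rho> \<Longrightarrow> \<rho> < R \<Longrightarrow> 0 < \<epsilon> \<Longrightarrow> \<exists>n. (F ^^ n) ` cball c \<rho> \<subseteq> ball c \<epsilon>"
proof -
  let ?f = "shrink_at_0 R :: 'e \<Rightarrow> 'e"
  define F where "F x = c + ?f (x + (- c))" for x
  define H where "H x = c + inv_into UNIV ?f (x + (- c))" for x
  have bij: "?f (inv_into UNIV ?f x) = x" "inv_into UNIV ?f (?f x) = x" for x
    by (simp_all add: surj_f_inv_f[OF surj_shrink_at_0[OF assms]]
        inv_f_f[OF inj_shrink_at_0[OF assms]])
  have id: "times_cont_diff k (\<lambda>x::'e. x) UNIV" for k
    by (intro times_cont_diff_linear bounded_linear_ident open_UNIV)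
  have shift: "times_cont_diff k (\<lambda>x. c + g (x + (- c))) UNIV" if "times_cont_diff k g UNIV"
    for k and g :: "'e \<Rightarrow> 'e"
    using times_cont_diff_compose[OF open_UNIV open_UNIV subset_UNIV
        times_cont_diff_add[OF open_UNIV id times_cont_diff_const[OF open_UNIV]] that]
    by (intro times_cont_diff_add times_cont_diff_const open_UNIV)
  have F_iter: "(F ^^ n) x = c + (?f ^^ n) (x - c)" for n x
    by (induction n) (simp_all add: F_def)
  show ?thesis
  proof
    show "times_cont_diff k F UNIV" for k
      unfolding F_def[abs_def]
      by (rule shift[OF times_cont_diff_shrink_at_0[OF assms]])
    show "times_cont_diff k H UNIV" for k
      unfolding H_def[abs_def]
      by (rule shift[OF times_cont_diff_inv_shrink_at_0[OF assms]])
    show "F (H x) = x" "H (F x) = x" for x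
      by (simp_all add: F_def H_def bij)
    show "F x = x" if "R \<le> dist c x" for x
      using that shrink_at_0_outside[OF assms, of "x - c"] by (simp add: F_def dist_norm norm_minus_commute)
    show "\<exists>n. (F ^^ n) ` cball c \<rho> \<subseteq> ball c \<epsilon>" if "0 \<le> \<rho>" "\<rho> < R" "0 < \<epsilon>" for \<rho> \<epsilon>
    proof -
      define \<theta> where "\<theta> = 1 - flat 0 (R\<^sup>2 - \<rho>\<^sup>2) / 2"
      have "\<rho>\<^sup>2 < R\<^sup>2" using that by (simp add: power_strict_mono)
      then have \<theta>: "0 \<le> \<theta>" "\<theta> < 1"
        using flat_bounds(2)[of "R\<^sup>2 - \<rho>\<^sup>2"] exp_gt_zero[of "- inverse (R\<^sup>2 - \<rho>\<^sup>2)"]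
        unfolding \<theta>_def by (linarith, simp add: flat_def)
      then have "(\<lambda>n. \<theta> ^ n * \<rho>) \<longlonglongrightarrow> 0"
        by (intro tendsto_mult_left_zero LIMSEQ_power_zero) simp
      then have "\<forall>\<^sub>F n in sequentially. \<theta> ^ n * \<rho> < \<epsilon>"
        using that by (intro order_tendstoD)
      then obtain n where n: "\<theta> ^ n * \<rho> < \<epsilon>"
        by (auto dest: eventually_happens)
      have "(F ^^ n) x \<in> ball c \<epsilon>" if "x \<in> cball c \<rho>" for x
      proof -
        have x: "norm (x - c) \<le> \<rho>" using that by (simp add: dist_norm norm_minus_commute)
        have "norm ((?f ^^ n) (x - c)) \<le> \<theta> ^ n * norm (x - c)"
          unfolding \<theta>_def by (rule shrink_at_0_contracts[OF assms x])
        also have "\<dots> \<le> \<theta> ^ n * \<rho>"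
          using x \<theta> by (intro mult_left_mono) simp_all
        finally show ?thesis
          using n by (simp add: F_iter dist_norm)
      qed
      then show ?thesis by blast
    qed
  qed
qed

section \<open>Maps of class \<open>C\<^sup>r\<close> between manifolds\<close>

lemma cr_onE:
  assumes "cr_on r f S" "x \<in> S"
  obtains W g where "open W" "x \<in> W" "\<And>k. enat k \<le> r \<Longrightarrow> times_cont_diff k g W"
    "\<And>y. y \<in> S \<Longrightarrow> y \<in> W \<Longrightarrow> g y = f y"
proof -
  have "\<exists>W g. open W \<and> x \<in> W \<and> (\<forall>k. enat k \<le> r \<longrightarrow> times_cont_diff k g W) \<and>
      (\<forall>y\<in>S \<inter> W. g y = f y)"
    using assms unfolding cr_on_def by (rule bspec)
  then obtain W g where "open W \<and> x \<in> W \<and> (\<forall>k. enat k \<le> r \<longrightarrow> times_cont_diff k g W) \<and>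
      (\<forall>y\<in>S \<inter> W. g y = f y)" by (elim exE)
  then show ?thesis
    by (intro that[of W g]) simp_all
qed

lemma cr_onI:
  assumes "\<And>x. x \<in> S \<Longrightarrow> \<exists>W g. open W \<and> x \<in> W \<and> (\<forall>k. enat k \<le> r \<longrightarrow> times_cont_diff k g W) \<and>
      (\<forall>y\<in>S \<inter> W. g y = f y)"
  shows "cr_on r f S"
  unfolding cr_on_def using assms by (rule ballI)

lemma cr_on_subset:
  assumes "cr_on r f S" "T \<subseteq> S"
  shows "cr_on r f T"
proof (rule cr_onI)
  fix x assume "x \<in> T"
  with assms have "x \<in> S" by auto
  with assms(1) obtain W g where "open W" "x \<in> W" "\<And>k. enat k \<le> r \<Longrightarrow> times_cont_diff k g W"
    "\<And>y. y \<in> S \<Longrightarrow> y \<in> W \<Longrightarrow> g y = f y" by (rule cr_onE) (rule that)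
  then show "\<exists>W g. open W \<and> x \<in> W \<and> (\<forall>k. enat k \<le> r \<longrightarrow> times_cont_diff k g W) \<and>
      (\<forall>y\<in>T \<inter> W. g y = f y)"
    using assms(2) by (intro exI[of _ W] exI[of _ g]) auto
qed

lemma cr_on_cong:
  assumes "\<And>x. x \<in> S \<Longrightarrow> f x = g x"
  shows "cr_on r f S \<longleftrightarrow> cr_on r g S"
  unfolding cr_on_def by (simp add: assms)

lemma cr_on_locally:
  assumes "\<And>x. x \<in> S \<Longrightarrow> \<exists>W. open W \<and> x \<in> W \<and> cr_on r f (S \<inter> W)"
  shows "cr_on r f S"
proof (rule cr_onI)
  fix x assume x: "x \<in> S"
  then obtain W where W: "open W" "x \<in> W" "cr_on r f (S \<inter> W)"
    using assms by blast
  have "x \<in> S \<inter> W" using x W by simp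
  with W(3) obtain V g where V: "open V" "x \<in> V" "\<And>k. enat k \<le> r \<Longrightarrow> times_cont_diff k g V"
    "\<And>y. y \<in> S \<inter> W \<Longrightarrow> y \<in> V \<Longrightarrow> g y = f y"
    by (rule cr_onE) (rule that)
  then have "\<forall>k. enat k \<le> r \<longrightarrow> times_cont_diff k g (V \<inter> W)"
    by (auto intro: times_cont_diff_subset)
  then show "\<exists>W g. open W \<and> x \<in> W \<and> (\<forall>k. enat k \<le> r \<longrightarrow> times_cont_diff k g W) \<and>
      (\<forall>y\<in>S \<inter> W. g y = f y)"
    using V W by (intro exI[of _ "V \<inter> W"] exI[of _ g]) auto
qed

lemma cr_on_smooth:
  assumes "open W" "\<And>k. times_cont_diff k f W"
  shows "cr_on r f W"
  by (rule cr_onI) (use assms in \<open>intro exI[of _ W] exI[of _ f], auto\<close>)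

lemma cr_on_compose:
  fixes f :: "'a::real_normed_vector \<Rightarrow> 'b::euclidean_space" and g :: "'b \<Rightarrow> 'c::real_normed_vector"
  assumes "cr_on r f S" "cr_on r g T" "f ` S \<subseteq> T"
  shows "cr_on r (\<lambda>x. g (f x)) S"
proof (rule cr_onI)
  fix x assume x: "x \<in> S"
  obtain W f' where W: "open W" "x \<in> W" "\<And>k. enat k \<le> r \<Longrightarrow> times_cont_diff k f' W"
    "\<And>y. y \<in> S \<Longrightarrow> y \<in> W \<Longrightarrow> f' y = f y"
    using assms(1) x by (rule cr_onE) (rule that)
  have fx: "f x \<in> T" using x assms(3) by auto
  obtain V g' where V: "open V" "f x \<in> V" "\<And>k. enat k \<le> r \<Longrightarrow> times_cont_diff k g' V"
    "\<And>y. y \<in> T \<Longrightarrow> y \<in> V \<Longrightarrow> g' y = g y"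
    using assms(2) fx by (rule cr_onE) (rule that)
  \<comment> \<open>Order 0 is always at most \<open>r\<close>, so the local extension is continuous
    and its domain can be cut down to where it lands in \<open>V\<close>.\<close>
  have "continuous_on W f'"
    using W(3)[of 0] by (simp add: zero_enat_def[symmetric])
  then have o: "open (W \<inter> f' -` V)"
    using W(1) V(1) by (simp add: continuous_on_open_vimage Int_commute)
  have "times_cont_diff k (\<lambda>x. g' (f' x)) (W \<inter> f' -` V)" if "enat k \<le> r" for k
    by (rule times_cont_diff_compose[OF o V(1) _ times_cont_diff_subset[OF W(3)[OF that]] V(3)[OF that]])
       auto
  moreover have "x \<in> W \<inter> f' -` V" using W(2,4) V(2) x by simp
  moreover have "g' (f' y) = g (f y)" if "y \<in> S \<inter> (W \<inter> f' -` V)" for y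
    using that W(4)[of y] V(4)[of "f y"] assms(3) by auto
  ultimately show "\<exists>W h. open W \<and> x \<in> W \<and> (\<forall>k. enat k \<le> r \<longrightarrow> times_cont_diff k h W) \<and>
      (\<forall>y\<in>S \<inter> W. h y = g (f y))"
    using o by (intro exI[of _ "W \<inter> f' -` V"] exI[of _ "\<lambda>x. g' (f' x)"]) auto
qed

lemma cr_mapI:
  assumes "continuous_on S f"
    and "\<And>U \<phi> V \<psi>. (U, \<phi>) \<in> A \<Longrightarrow> (V, \<psi>) \<in> B \<Longrightarrow>
      cr_on r (\<psi> \<circ> f \<circ> inv_into U \<phi>) (\<phi> ` (S \<inter> U \<inter> f -` V))"
  shows "cr_map r A B S f"
  unfolding cr_map_def using assms by auto

text \<open>Just the topological half of an atlas, without compatibility: enough for composition,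
  and inherited by \<open>times_line\<close> without introducing a product manifold.\<close>

definition charts_on :: "'a::topological_space set \<Rightarrow> ('a, 'e::euclidean_space) chart set \<Rightarrow> bool" where
  "charts_on P A \<longleftrightarrow> (\<Union>(U, \<phi>)\<in>A. U) = P \<and>
     (\<forall>(U, \<phi>)\<in>A. openin (top_of_set P) U \<and> homeomorphism U (\<phi> ` U) \<phi> (inv_into U \<phi>))"

lemma homeomorphism_inj_on: "homeomorphism U V f g \<Longrightarrow> inj_on f U"
  by (metis homeomorphism_def inj_on_inverseI)

lemma cr_map_cong:
  assumes "charts_on P A" "\<And>x. x \<in> S \<Longrightarrow> f x = g x"
  shows "cr_map r A B S f \<longleftrightarrow> cr_map r A B S g"
proof -
  have "continuous_on S f \<longleftrightarrow> continuous_on S g"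
    using assms(2) by (simp cong: continuous_on_cong)
  moreover have "cr_on r (\<psi> \<circ> f \<circ> inv_into U \<phi>) (\<phi> ` (S \<inter> U \<inter> f -` V)) \<longleftrightarrow>
      cr_on r (\<psi> \<circ> g \<circ> inv_into U \<phi>) (\<phi> ` (S \<inter> U \<inter> g -` V))" if "(U, \<phi>) \<in> A" for U \<phi> V and \<psi> :: "'c \<Rightarrow> 'd"
  proof -
    have "inj_on \<phi> U"
      using assms(1) that homeomorphism_inj_on unfolding charts_on_def by fast
    moreover have "S \<inter> U \<inter> f -` V = S \<inter> U \<inter> g -` V"
      using assms(2) by auto
    ultimately show ?thesis
      using assms(2) by (auto intro!: cr_on_cong)
  qed
  ultimately show ?thesis
    unfolding cr_map_def by (intro arg_cong2[of _ _ _ _ "(\<and>)"] ball_cong) auto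
qed

text \<open>A factorization through one chart of \<open>B\<close> exists only near each point, where
  continuity keeps \<open>f\<close> inside the domain of that chart; \<open>cr_on_locally\<close>
  then glues.\<close>

lemma cr_map_compose:
  fixes A :: "('a::topological_space, 'd::euclidean_space) chart set"
    and B :: "('b::topological_space, 'e::euclidean_space) chart set"
    and E :: "('c::topological_space, 'f::euclidean_space) chart set"
  assumes A: "charts_on P A" and B: "charts_on Q B"
    and f: "cr_map r A B S f" and g: "cr_map r B E T g"
    and fS: "f ` S \<subseteq> T" and TQ: "T \<subseteq> Q"
  shows "cr_map r A E S (\<lambda>x. g (f x))"
proof (rule cr_mapI)
  have cf: "continuous_on S f" and cg: "continuous_on T g"
    using f g by (auto simp: cr_map_def)
  then show "continuous_on S (\<lambda>x. g (f x))"
    using fS continuous_on_compose2 by blast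
  fix U \<phi> W \<eta> assume U: "(U, \<phi>) \<in> A" and W: "(W, \<eta>) \<in> E"
  have hU: "homeomorphism U (\<phi> ` U) \<phi> (inv_into U \<phi>)"
    using A U unfolding charts_on_def by auto
  have inj: "inv_into U \<phi> (\<phi> x) = x" if "x \<in> U" for x
    using hU that by (auto simp: homeomorphism_def)
  have fQ: "f x \<in> Q" if "x \<in> S" for x
    using that fS TQ by auto
  let ?Z = "\<phi> ` (S \<inter> U \<inter> (\<lambda>x. g (f x)) -` W)"
  show "cr_on r (\<eta> \<circ> (\<lambda>x. g (f x)) \<circ> inv_into U \<phi>) ?Z"
  proof (rule cr_on_locally)
    fix y assume "y \<in> ?Z"
    then obtain x where x: "x \<in> S" "x \<in> U" "g (f x) \<in> W" "y = \<phi> x" by auto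
    then have "f x \<in> Q" using fS TQ by auto
    then obtain V \<psi> where V: "(V, \<psi>) \<in> B" "f x \<in> V" and oV: "openin (top_of_set Q) V"
      and hV: "homeomorphism V (\<psi> ` V) \<psi> (inv_into V \<psi>)"
      using B unfolding charts_on_def by blast
    have "continuous_on (\<phi> ` (S \<inter> U)) (\<lambda>z. f (inv_into U \<phi> z))"
    proof (rule continuous_on_compose2[OF cf])
      show "continuous_on (\<phi> ` (S \<inter> U)) (inv_into U \<phi>)"
        using hU by (auto simp: homeomorphism_def intro: continuous_on_subset)
    qed (auto simp: inj)
    moreover have "(\<lambda>z. f (inv_into U \<phi> z)) \<in> \<phi> ` (S \<inter> U) \<rightarrow> Q"
      using fQ by (auto simp: inj)
    ultimately have "openin (top_of_set (\<phi> ` (S \<inter> U))) (\<phi> ` (S \<inter> U) \<inter> (\<lambda>z. f (inv_into U \<phi> z)) -` V)"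
      using oV continuous_openin_preimage by blast
    then obtain N where N: "open N"
      "\<phi> ` (S \<inter> U) \<inter> (\<lambda>z. f (inv_into U \<phi> z)) -` V = \<phi> ` (S \<inter> U) \<inter> N"
      by (auto simp: openin_open)
    have f1: "cr_on r (\<psi> \<circ> f \<circ> inv_into U \<phi>) (\<phi> ` (S \<inter> U \<inter> f -` V))"
      using f U V unfolding cr_map_def by fast
    have g1: "cr_on r (\<eta> \<circ> g \<circ> inv_into V \<psi>) (\<psi> ` (T \<inter> V \<inter> g -` W))"
      using g W V unfolding cr_map_def by fast
    have ZN: "z \<in> ?Z \<inter> N \<Longrightarrow> \<exists>x'. x' \<in> S \<and> x' \<in> U \<and> f x' \<in> V \<and> g (f x') \<in> W \<and> z = \<phi> x'" for z
    proof -
      assume z: "z \<in> ?Z \<inter> N"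
      then obtain x' where x': "x' \<in> S" "x' \<in> U" "g (f x') \<in> W" "z = \<phi> x'" by auto
      then have "\<phi> x' \<in> \<phi> ` (S \<inter> U) \<inter> N" using z by auto
      then have "f x' \<in> V" using N(2) x' inj by fastforce
      then show ?thesis using x' by blast
    qed
    have "cr_on r (\<lambda>z. (\<eta> \<circ> g \<circ> inv_into V \<psi>) ((\<psi> \<circ> f \<circ> inv_into U \<phi>) z)) (?Z \<inter> N)"
    proof (rule cr_on_compose[OF cr_on_subset[OF f1] g1])
      show "?Z \<inter> N \<subseteq> \<phi> ` (S \<inter> U \<inter> f -` V)"
        using ZN by blast
      show "(\<psi> \<circ> f \<circ> inv_into U \<phi>) ` (?Z \<inter> N) \<subseteq> \<psi> ` (T \<inter> V \<inter> g -` W)"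
      proof
        fix w assume "w \<in> (\<psi> \<circ> f \<circ> inv_into U \<phi>) ` (?Z \<inter> N)"
        then obtain z where "z \<in> ?Z \<inter> N" "w = \<psi> (f (inv_into U \<phi> z))" by auto
        with ZN obtain x' where "x' \<in> S" "x' \<in> U" "f x' \<in> V" "g (f x') \<in> W" "w = \<psi> (f x')"
          using inj by metis
        then show "w \<in> \<psi> ` (T \<inter> V \<inter> g -` W)" using fS by auto
      qed
    qed
    moreover have "(\<eta> \<circ> g \<circ> inv_into V \<psi>) ((\<psi> \<circ> f \<circ> inv_into U \<phi>) z) =
        (\<eta> \<circ> (\<lambda>x. g (f x)) \<circ> inv_into U \<phi>) z" if z: "z \<in> ?Z \<inter> N" for z
    proof -
      obtain x' where "x' \<in> U" "f x' \<in> V" "z = \<phi> x'" using ZN[OF z] by blast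
      then show ?thesis using inj hV by (auto simp: homeomorphism_def)
    qed
    ultimately have "cr_on r (\<eta> \<circ> (\<lambda>x. g (f x)) \<circ> inv_into U \<phi>) (?Z \<inter> N)"
      by (subst (asm) cr_on_cong) auto
    moreover have "y \<in> N"
      using N(2) x V inj by auto
    ultimately show "\<exists>W'. open W' \<and> y \<in> W' \<and>
        cr_on r (\<eta> \<circ> (\<lambda>x. g (f x)) \<circ> inv_into U \<phi>) (?Z \<inter> W')"
      using N(1) by blast
  qed
qed

lemma charts_on_times_line:
  assumes "charts_on P A"
  shows "charts_on (P \<times> UNIV) (times_line A)"
proof -
  have "openin (top_of_set (P \<times> UNIV)) (U \<times> (UNIV :: real set)) \<and>
      homeomorphism (U \<times> UNIV) (map_prod \<phi> id ` (U \<times> (UNIV :: real set))) (map_prod \<phi> id)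
        (inv_into (U \<times> UNIV) (map_prod \<phi> id))" if U: "(U, \<phi>) \<in> A" for U \<phi>
  proof
    have oU: "openin (top_of_set P) U" and hU: "homeomorphism U (\<phi> ` U) \<phi> (inv_into U \<phi>)"
      using assms U unfolding charts_on_def by auto
    show "openin (top_of_set (P \<times> UNIV)) (U \<times> (UNIV :: real set))"
      using oU openin_Times[of P U "UNIV :: real set" UNIV] by simp
    have inj: "inj_on (map_prod \<phi> id) (U \<times> (UNIV :: real set))"
      using homeomorphism_inj_on[OF hU] by (auto simp: inj_on_def)
    have inv: "inv_into (U \<times> UNIV) (map_prod \<phi> id) z = map_prod (inv_into U \<phi>) id z"
      if zU: "z \<in> map_prod \<phi> id ` (U \<times> (UNIV :: real set))" for z
    proof -
      obtain x t where x: "x \<in> U" and z: "z = (\<phi> x, t)"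
        using zU by auto
      have "inv_into (U \<times> UNIV) (map_prod \<phi> id) (map_prod \<phi> id (x, t)) = (x, t)"
        by (rule inv_into_f_f[OF inj]) (simp add: x)
      then show ?thesis
        using homeomorphism_apply1[OF hU x] by (simp add: z)
    qed
    have c1: "continuous_on (U \<times> (UNIV :: real set)) (map_prod \<phi> id)"
      using hU unfolding map_prod_def homeomorphism_def
      by (auto intro!: continuous_intros continuous_on_compose2[of U \<phi>] simp: case_prod_unfold)
    have "continuous_on (map_prod \<phi> id ` (U \<times> (UNIV :: real set))) (map_prod (inv_into U \<phi>) id)"
      using hU unfolding map_prod_def homeomorphism_def
      by (auto intro!: continuous_intros continuous_on_compose2[of "\<phi> ` U" "inv_into U \<phi>"] simp: case_prod_unfold)
    then have c2: "continuous_on (map_prod \<phi> id ` (U \<times> (UNIV :: real set)))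
        (inv_into (U \<times> UNIV) (map_prod \<phi> id))"
      by (rule continuous_on_eq) (simp only: inv)
    show "homeomorphism (U \<times> UNIV) (map_prod \<phi> id ` (U \<times> (UNIV :: real set))) (map_prod \<phi> id)
        (inv_into (U \<times> UNIV) (map_prod \<phi> id))"
      unfolding homeomorphism_def
      by (intro conjI ballI inv_into_f_f[OF inj] f_inv_into_f
          inv_into_image_cancel[OF inj subset_refl] refl c1 c2)
  qed
  then show ?thesis
    using assms by (auto simp: charts_on_def times_line_def)
qed

section \<open>Topology of compact manifolds with boundary\<close>

lemma normal_vec_Basis: "(normal_vec :: 'e::euclidean_space) \<in> Basis"
  unfolding normal_vec_def by (rule someI_ex) (use nonempty_Basis in blast)

lemma normal_vec_dot [simp]: "(normal_vec :: 'e::euclidean_space) \<bullet> normal_vec = 1"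
  by (simp add: inner_same_Basis normal_vec_Basis)

lemma open_subset_half_space_pos:
  fixes S :: "'e::euclidean_space set"
  assumes "open S" "S \<subseteq> half_space" "y \<in> S"
  shows "0 < y \<bullet> normal_vec"
proof -
  obtain e where e: "0 < e" "ball y e \<subseteq> S"
    using assms open_contains_ball by blast
  have "y - (e / 2) *\<^sub>R normal_vec \<in> ball y e"
    using e(1) by (simp add: dist_norm norm_Basis normal_vec_Basis)
  then have "y - (e / 2) *\<^sub>R normal_vec \<in> half_space"
    using e(2) assms(2) by blast
  then have "0 \<le> (y - (e / 2) *\<^sub>R normal_vec) \<bullet> normal_vec"
    by (simp add: half_space_def)
  then show ?thesis using e(1) by (simp add: inner_diff_left)
qed

lemma open_positive_part:
  assumes "openin (top_of_set half_space) S" "\<And>y. y \<in> S \<Longrightarrow> 0 < y \<bullet> (normal_vec :: 'e::euclidean_space)"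
  shows "open S"
proof -
  obtain T where T: "open T" "S = half_space \<inter> T"
    using assms(1) by (auto simp: openin_open)
  have "S = T \<inter> {y. 0 < y \<bullet> normal_vec}"
    using assms(2) T by (auto simp: half_space_def)
  moreover have "open {y. 0 < y \<bullet> (normal_vec :: 'e)}"
    by (intro open_Collect_less continuous_intros)
  ultimately show ?thesis
    using T by (simp add: open_Int)
qed

text \<open>\<open>inv_into\<close> depends on the domain, so restricting a chart changes its formal
  inverse; the two inverses agree where it matters.\<close>

lemma homeomorphism_inv_into_subset:
  assumes h: "homeomorphism U (\<phi> ` U) \<phi> (inv_into U \<phi>)" and W: "W \<subseteq> U"
  shows "homeomorphism W (\<phi> ` W) \<phi> (inv_into W \<phi>)"
    and "\<And>y. y \<in> \<phi> ` W \<Longrightarrow> inv_into W \<phi> y = inv_into U \<phi> y"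
proof -
  have inj: "inj_on \<phi> W"
    using homeomorphism_inj_on[OF h] W inj_on_subset by blast
  show eq: "inv_into W \<phi> y = inv_into U \<phi> y" if y: "y \<in> \<phi> ` W" for y
  proof -
    obtain x where x: "x \<in> W" "y = \<phi> x" using y by blast
    then show ?thesis
      using inv_into_f_f[OF inj x(1)] homeomorphism_apply1[OF h, of x] W by auto
  qed
  have c1: "continuous_on W \<phi>"
    using h W continuous_on_subset by (auto simp: homeomorphism_def)
  have "continuous_on (\<phi> ` W) (inv_into U \<phi>)"
    using h continuous_on_subset[OF _ image_mono[OF W]] by (auto simp: homeomorphism_def)
  then have c2: "continuous_on (\<phi> ` W) (inv_into W \<phi>)"
    by (rule continuous_on_eq) (simp only: eq)
  show "homeomorphism W (\<phi> ` W) \<phi> (inv_into W \<phi>)"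
    unfolding homeomorphism_def
    by (intro conjI ballI inv_into_f_f[OF inj] f_inv_into_f
        inv_into_image_cancel[OF inj subset_refl] refl c1 c2)
qed

locale cr_manifold =
  fixes r :: enat and X :: "('a::t2_space, 'e::euclidean_space) bmanifold"
  assumes mfd: "cr_bmanifold r X"
    and compact_points: "compact (points X)"
    and connected_points: "connected (points X)"
    and bdry_nonempty: "bdry X \<noteq> {}"
begin

abbreviation "M \<equiv> open_part X"

lemma charts_on_atlas: "charts_on (points X) (atlas X)"
  using mfd unfolding cr_bmanifold_def charts_on_def by fast

lemma atlasD:
  assumes "(U, \<phi>) \<in> atlas X"
  shows "openin (top_of_set (points X)) U" "openin (top_of_set half_space) (\<phi> ` U)"
    "homeomorphism U (\<phi> ` U) \<phi> (inv_into U \<phi>)"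
  using mfd assms unfolding cr_bmanifold_def by auto

lemma atlas_compatible: "c \<in> atlas X \<Longrightarrow> d \<in> atlas X \<Longrightarrow> compatible r c d"
  using mfd unfolding cr_bmanifold_def by blast

lemma atlas_cover:
  assumes "x \<in> points X"
  obtains U \<phi> where "(U, \<phi>) \<in> atlas X" "x \<in> U"
  using charts_on_atlas assms unfolding charts_on_def by blast

lemma chart_subset: "(U, \<phi>) \<in> atlas X \<Longrightarrow> U \<subseteq> points X"
  using atlasD(1) openin_imp_subset by blast

lemma chart_open_image:
  assumes U: "(U, \<phi>) \<in> atlas X" and W: "openin (top_of_set (points X)) W"
  shows "openin (top_of_set half_space) (\<phi> ` (U \<inter> W))"
proof -
  have "openin (top_of_set U) (U \<inter> W)"
    using W chart_subset[OF U] by (auto simp: openin_open)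
  from homeomorphism_imp_open_map[OF atlasD(3)[OF U] this] atlasD(2)[OF U]
  show ?thesis using openin_trans by blast
qed

lemma chart_nonneg: "(U, \<phi>) \<in> atlas X \<Longrightarrow> x \<in> U \<Longrightarrow> 0 \<le> \<phi> x \<bullet> normal_vec"
  using openin_imp_subset[OF atlasD(2)] by (fastforce simp: half_space_def)

text \<open>If one chart puts \<open>x\<close> off the hyperplane and another on it, the transition
  map sends an open set of the model space injectively and continuously into the half space and hits
  the hyperplane. Invariance of domain forbids this, also for \<open>r = 0\<close>.\<close>

lemma bdry_iff:
  assumes U: "(U, \<phi>) \<in> atlas X" and x: "x \<in> U"
  shows "x \<in> bdry X \<longleftrightarrow> \<phi> x \<bullet> normal_vec = 0"
proof
  assume "x \<in> bdry X"
  then obtain V \<psi> where V: "(V, \<psi>) \<in> atlas X" "x \<in> V" "\<psi> x \<bullet> normal_vec = 0"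
    unfolding bdry_def by blast
  show "\<phi> x \<bullet> normal_vec = 0"
  proof (rule ccontr)
    assume "\<phi> x \<bullet> normal_vec \<noteq> 0"
    with chart_nonneg[OF U x] have pos: "0 < \<phi> x \<bullet> normal_vec" by simp
    let ?W = "\<phi> ` (U \<inter> V) \<inter> {y. 0 < y \<bullet> normal_vec}"
    let ?g = "\<lambda>y. \<psi> (inv_into U \<phi> y)"
    note hU = atlasD(3)[OF U] and hV = atlasD(3)[OF V(1)]
    have "openin (top_of_set half_space) ?W"
      using chart_open_image[OF U atlasD(1)[OF V(1)]]
      by (intro openin_Int_open open_Collect_less continuous_intros)
    then have "open ?W"
      by (rule open_positive_part) simp
    moreover have inv: "inv_into U \<phi> y \<in> U \<inter> V \<and> \<phi> (inv_into U \<phi> y) = y" if "y \<in> ?W" for y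
      using that homeomorphism_apply1[OF hU] by auto
    have "continuous_on ?W ?g"
    proof (rule continuous_on_compose2[where g = \<psi> and f = "inv_into U \<phi>" and t = V])
      show "continuous_on V \<psi>" using hV by (simp add: homeomorphism_def)
      show "continuous_on ?W (inv_into U \<phi>)"
        using hU by (auto simp: homeomorphism_def intro: continuous_on_subset)
    qed (use inv in blast)
    moreover have "inj_on ?g ?W"
    proof (rule inj_onI)
      fix y z assume yz: "y \<in> ?W" "z \<in> ?W" "?g y = ?g z"
      then have "inv_into U \<phi> y = inv_into U \<phi> z"
        using inv homeomorphism_inj_on[OF hV] by (meson IntD2 inj_onD)
      then show "y = z" using inv yz by metis
    qed
    ultimately have o1: "open (?g ` ?W)"
      by (intro invariance_of_domain)
    have o2: "?g ` ?W \<subseteq> half_space"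
      using inv chart_nonneg[OF V(1)] by (auto simp: half_space_def)
    have o3: "\<psi> x \<in> ?g ` ?W"
      using x V(2) pos homeomorphism_apply1[OF hU x] by (intro image_eqI[of _ _ "\<phi> x"]) auto
    show False
      using open_subset_half_space_pos[OF o1 o2 o3] V(3) by simp
  qed
next
  assume "\<phi> x \<bullet> normal_vec = 0"
  then show "x \<in> bdry X"
    using U x unfolding bdry_def by blast
qed

lemma bdry_subset: "bdry X \<subseteq> points X"
  using chart_subset unfolding bdry_def by blast

lemma open_part_iff:
  assumes U: "(U, \<phi>) \<in> atlas X" and x: "x \<in> U"
  shows "x \<in> M \<longleftrightarrow> 0 < \<phi> x \<bullet> normal_vec"
  using bdry_iff[OF assms] chart_nonneg[OF assms] chart_subset[OF U] x
  unfolding open_part_def by auto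

lemma openin_open_part: "openin (top_of_set (points X)) M"
  unfolding openin_subopen[of _ M]
proof
  fix x assume x: "x \<in> M"
  then obtain U \<phi> where U: "(U, \<phi>) \<in> atlas X" "x \<in> U"
    by (auto simp: open_part_def elim: atlas_cover)
  let ?T = "U \<inter> \<phi> -` {y. 0 < y \<bullet> normal_vec}"
  have "continuous_on U \<phi>"
    using atlasD(3)[OF U(1)] by (simp add: homeomorphism_def)
  then have "openin (top_of_set U) ?T"
    by (intro continuous_openin_preimage_gen open_Collect_less continuous_intros)
  then have "openin (top_of_set (points X)) ?T"
    using atlasD(1)[OF U(1)] openin_trans by blast
  moreover have "x \<in> ?T" "?T \<subseteq> M"
    using x U open_part_iff by auto
  ultimately show "\<exists>T. openin (top_of_set (points X)) T \<and> x \<in> T \<and> T \<subseteq> M"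
    by blast
qed

lemma open_part_subset: "M \<subseteq> points X"
  by (auto simp: open_part_def)

lemma compact_bdry: "compact (bdry X)"
proof (rule closedin_compact[OF compact_points])
  have "bdry X = points X - M"
    using bdry_subset by (auto simp: open_part_def)
  then show "closedin (top_of_set (points X)) (bdry X)"
    using openin_open_part by (simp add: closedin_diff)
qed

lemma open_chart_of_atlas:
  assumes U: "(U, \<phi>) \<in> atlas X"
  shows "(U \<inter> M, \<phi>) \<in> open_charts r X"
proof -
  have 1: "openin (top_of_set M) (U \<inter> M)"
    using atlasD(1)[OF U] open_part_subset by (auto simp: openin_open)
  have 2: "open (\<phi> ` (U \<inter> M))"
    using chart_open_image[OF U openin_open_part] open_part_iff[OF U]
    by (intro open_positive_part) auto
  have UM: "U \<inter> M \<subseteq> U" by blast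
  note h = homeomorphism_inv_into_subset[OF atlasD(3)[OF U] UM]
  have "compatible r (U \<inter> M, \<phi>) (V, \<psi>)" if V: "(V, \<psi>) \<in> atlas X" for V \<psi>
  proof -
    have a: "cr_on r (\<psi> \<circ> inv_into U \<phi>) (\<phi> ` (U \<inter> V))" "cr_on r (\<phi> \<circ> inv_into V \<psi>) (\<psi> ` (U \<inter> V))"
      using atlas_compatible[OF U V] by (auto simp: compatible_def)
    have UMV: "U \<inter> M \<inter> V \<subseteq> U \<inter> V" by blast
    have c: "cr_on r (\<psi> \<circ> inv_into U \<phi>) (\<phi> ` (U \<inter> M \<inter> V))"
      "cr_on r (\<phi> \<circ> inv_into V \<psi>) (\<psi> ` (U \<inter> M \<inter> V))"
      by (rule a[THEN cr_on_subset, OF image_mono[OF UMV]])+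
    have "cr_on r (\<psi> \<circ> inv_into (U \<inter> M) \<phi>) (\<phi> ` (U \<inter> M \<inter> V))"
      by (subst cr_on_cong[OF _, of _ _ "\<psi> \<circ> inv_into U \<phi>"]) (use h(2) c(1) in auto)
    with c(2) show ?thesis by (simp add: compatible_def)
  qed
  then show ?thesis
    using 1 2 h(1) by (auto simp: open_charts_def)
qed

lemma open_chartD:
  assumes "(U, \<phi>) \<in> open_charts r X"
  shows "openin (top_of_set M) U" "open (\<phi> ` U)" "homeomorphism U (\<phi> ` U) \<phi> (inv_into U \<phi>)"
    "U \<subseteq> M" "openin (top_of_set (points X)) U" "\<And>d. d \<in> atlas X \<Longrightarrow> compatible r (U, \<phi>) d"
proof -
  show 1: "openin (top_of_set M) U" "open (\<phi> ` U)" "homeomorphism U (\<phi> ` U) \<phi> (inv_into U \<phi>)"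
    "\<And>d. d \<in> atlas X \<Longrightarrow> compatible r (U, \<phi>) d"
    using assms by (auto simp: open_charts_def)
  then show "U \<subseteq> M" "openin (top_of_set (points X)) U"
    using openin_open_part openin_trans openin_imp_subset by blast+
qed

lemma open_chart_cball:
  assumes x: "x \<in> M"
  obtains U \<phi> R where "(U, \<phi>) \<in> open_charts r X" "x \<in> U" "0 < R" "cball (\<phi> x) R \<subseteq> \<phi> ` U"
proof -
  obtain U \<phi> where U: "(U, \<phi>) \<in> atlas X" "x \<in> U"
    using x by (auto simp: open_part_def elim: atlas_cover)
  have c: "(U \<inter> M, \<phi>) \<in> open_charts r X" using open_chart_of_atlas U by blast
  have "\<phi> x \<in> \<phi> ` (U \<inter> M)" using U x by auto
  then obtain R where "0 < R" "cball (\<phi> x) R \<subseteq> \<phi> ` (U \<inter> M)"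
    using open_chartD(2)[OF c] open_contains_cball by blast
  then show ?thesis using that[OF c] U x by blast
qed

lemma compact_chart_cball:
  assumes U: "(U, \<phi>) \<in> open_charts r X" and c: "cball c R \<subseteq> \<phi> ` U"
  shows "compact (inv_into U \<phi> ` cball c R)" "inv_into U \<phi> ` cball c R \<subseteq> U"
proof -
  have "continuous_on (cball c R) (inv_into U \<phi>)"
    using open_chartD(3)[OF U] c by (auto simp: homeomorphism_def intro: continuous_on_subset)
  then show "compact (inv_into U \<phi> ` cball c R)"
    using compact_cball compact_continuous_image by blast
  show "inv_into U \<phi> ` cball c R \<subseteq> U"
    using c by (auto intro: inv_into_into)
qed

lemma closure_of_subset_compact:
  assumes "compact C" "B \<subseteq> C" "C \<subseteq> M"
  shows "compact (top_of_set M closure_of B)" "top_of_set M closure_of B \<subseteq> C"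
proof -
  have "closedin (top_of_set M) C"
    using assms compact_imp_closed closed_subset by blast
  then show 1: "top_of_set M closure_of B \<subseteq> C"
    using assms(2) closure_of_minimal by blast
  have "closedin (top_of_set M) (top_of_set M closure_of B)" by simp
  then have "closedin (top_of_set C) (top_of_set M closure_of B)"
    using 1 assms(3) closedin_subset_trans by blast
  then show "compact (top_of_set M closure_of B)"
    using assms(1) closedin_compact by blast
qed

lemma ball_around:
  assumes "x \<in> M"
  obtains B where "is_ball r X B" "x \<in> B"
proof -
  obtain U \<phi> R where U: "(U, \<phi>) \<in> open_charts r X" "x \<in> U" "0 < R" "cball (\<phi> x) R \<subseteq> \<phi> ` U"
    using open_chart_cball[OF assms] .
  let ?B = "inv_into U \<phi> ` ball (\<phi> x) R"
  note C = compact_chart_cball[OF U(1,4)]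
  have sub: "?B \<subseteq> inv_into U \<phi> ` cball (\<phi> x) R" by (intro image_mono ball_subset_cball)
  have CM: "inv_into U \<phi> ` cball (\<phi> x) R \<subseteq> M" using C(2) open_chartD(4)[OF U(1)] by blast
  have "\<phi> ` ?B = ball (\<phi> x) R"
  proof -
    have "\<phi> (inv_into U \<phi> y) = y" if "y \<in> ball (\<phi> x) R" for y
      using that U(4) by (intro f_inv_into_f) auto
    then show ?thesis by (force simp: image_image)
  qed
  moreover have "?B \<subseteq> U" using C(2) sub by blast
  moreover note closure_of_subset_compact[OF C(1) sub CM]
  ultimately have "0 < R \<and> ?B \<subseteq> U \<and> \<phi> ` ?B = ball (\<phi> x) R \<and>
      compact (top_of_set M closure_of ?B) \<and> top_of_set M closure_of ?B \<subseteq> U"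
    using U(3) C(2) by blast
  then have "is_ball r X ?B"
    unfolding is_ball_def by (intro bexI[OF _ U(1)]) blast
  moreover have "x \<in> ?B"
    using U homeomorphism_apply1[OF open_chartD(3)[OF U(1)] U(2)]
    by (intro image_eqI[of _ _ "\<phi> x"]) auto
  ultimately show ?thesis using that by blast
qed

text \<open>The closed Euclidean ball lies in the image of the compact closure of \<open>B\<close>,
  hence in the open image of the chart. Compactness leaves a margin, and the larger radius
  \<open>R\<close> is the room in which the shrinking map acts.\<close>

lemma ballE:
  assumes "is_ball r X B"
  obtains U \<phi> c \<rho> R where "(U, \<phi>) \<in> open_charts r X" "0 < \<rho>" "\<rho> < R" "cball c R \<subseteq> \<phi> ` U"
    "top_of_set M closure_of B \<subseteq> inv_into U \<phi> ` cball c \<rho>" "compact (top_of_set M closure_of B)"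
    "B \<subseteq> top_of_set M closure_of B"
proof -
  obtain U \<phi> c \<rho> where U: "(U, \<phi>) \<in> open_charts r X" and \<rho>: "0 < \<rho>" and B: "B \<subseteq> U" "\<phi> ` B = ball c \<rho>"
    and cl: "compact (top_of_set M closure_of B)" "top_of_set M closure_of B \<subseteq> U"
    using assms unfolding is_ball_def by blast
  note h = open_chartD(3)[OF U]
  have BM: "B \<subseteq> M" using B open_chartD(4)[OF U] by blast
  then have Bcl: "B \<subseteq> top_of_set M closure_of B"
    by (intro closure_of_subset) simp
  have "compact (\<phi> ` (top_of_set M closure_of B))"
    using h cl by (intro compact_continuous_image) (auto simp: homeomorphism_def intro: continuous_on_subset)
  then have "closure (ball c \<rho>) \<subseteq> \<phi> ` (top_of_set M closure_of B)"
    using B(2) Bcl by (intro closure_minimal compact_imp_closed) auto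
  then have c\<rho>: "cball c \<rho> \<subseteq> \<phi> ` U" using \<rho> cl(2) by auto
  then obtain e where e: "0 < e" "(\<Union>x\<in>cball c \<rho>. ball x e) \<subseteq> \<phi> ` U"
    using compact_subset_open_imp_ball_epsilon_subset[OF compact_cball open_chartD(2)[OF U]] by metis
  have "cball c (\<rho> + e / 2) \<subseteq> \<phi> ` U"
  proof
    fix y assume y: "y \<in> cball c (\<rho> + e / 2)"
    show "y \<in> \<phi> ` U"
    proof (cases "dist c y \<le> \<rho>")
      case True
      then show ?thesis using c\<rho> by auto
    next
      case False
      define d where "d = dist c y"
      have d: "\<rho> < d" "d \<le> \<rho> + e / 2" using False y by (auto simp: d_def)
      \<comment> \<open>The point of the sphere of radius \<open>\<rho>\<close> on the ray from
        \<open>c\<close> through \<open>y\<close>; its distance to \<open>y\<close> is at most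
        \<open>e / 2\<close>.\<close>
      define x where "x = c + (\<rho> / d) *\<^sub>R (y - c)"
      have nd: "norm (y - c) = d" by (simp add: d_def dist_norm norm_minus_commute)
      have "dist c x = \<rho>" using d \<rho> nd by (simp add: x_def dist_norm)
      moreover have "dist x y = d - \<rho>"
      proof -
        have "x - y = (\<rho> / d - 1) *\<^sub>R (y - c)" by (simp add: x_def algebra_simps)
        then have "dist x y = \<bar>\<rho> / d - 1\<bar> * d" by (simp add: dist_norm nd)
        also have "\<bar>\<rho> / d - 1\<bar> = 1 - \<rho> / d" using d \<rho> by simp
        finally show ?thesis using d \<rho> by (simp add: left_diff_distrib)
      qed
      ultimately have "y \<in> (\<Union>x\<in>cball c \<rho>. ball x e)"
        using d e(1) by (intro UN_I[of x]) auto
      then show ?thesis using e(2) by blast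
    qed
  qed
  moreover have "top_of_set M closure_of B \<subseteq> inv_into U \<phi> ` cball c \<rho>"
  proof (rule closure_of_subset_compact(2))
    note C = compact_chart_cball[OF U c\<rho>]
    show "compact (inv_into U \<phi> ` cball c \<rho>)" by (fact C)
    show "inv_into U \<phi> ` cball c \<rho> \<subseteq> M" using C(2) open_chartD(4)[OF U] by blast
    show "B \<subseteq> inv_into U \<phi> ` cball c \<rho>"
    proof
      fix x assume x: "x \<in> B"
      then have "\<phi> x \<in> cball c \<rho>" using B(2) ball_subset_cball by blast
      moreover have "x = inv_into U \<phi> (\<phi> x)" using homeomorphism_apply1[OF h] x B by auto
      ultimately show "x \<in> inv_into U \<phi> ` cball c \<rho>" by blast
    qed
  qed
  ultimately show ?thesis
    using that[OF U \<rho> _ _ _ cl(1) Bcl] e(1) by (metis half_gt_zero less_add_same_cancel1)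
qed

end

section \<open>Product neighbourhoods\<close>

locale product_nbhd_in = cr_manifold r X
  for r :: enat and X :: "('a::t2_space, 'e::euclidean_space) bmanifold" +
  fixes \<kappa> :: "'a \<times> real \<Rightarrow> 'a"
  assumes nbhd: "product_nbhd r X \<kappa>"
begin

abbreviation "strp \<equiv> strip X \<kappa>"

lemma inj_kappa: "inj_on \<kappa> (bdry X \<times> {0..1})"
  using nbhd by (simp add: product_nbhd_def)

lemma continuous_kappa: "continuous_on (bdry X \<times> {0..1}) \<kappa>"
  using nbhd by (simp add: product_nbhd_def cr_map_def)

lemma continuous_inv_kappa: "continuous_on (strp {0..1}) (inv_into (bdry X \<times> {0..1}) \<kappa>)"
  using nbhd by (simp add: product_nbhd_def cr_map_def)

lemma kappa_1: "b \<in> bdry X \<Longrightarrow> \<kappa> (b, 1) = b"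
  using nbhd by (simp add: product_nbhd_def)

lemma closedin_strip: "closedin (top_of_set M) (strp {0..<1})"
  using nbhd by (simp add: product_nbhd_def)

lemma strip_mono: "I \<subseteq> J \<Longrightarrow> strp I \<subseteq> strp J"
  unfolding strip_def by blast

lemma strip_Un: "strp (I \<union> J) = strp I \<union> strp J"
  unfolding strip_def by blast

lemma strip_Int:
  assumes "I \<subseteq> {0..1}" "J \<subseteq> {0..1}"
  shows "strp I \<inter> strp J = strp (I \<inter> J)"
proof -
  have "strp I \<inter> strp J = \<kappa> ` ((bdry X \<times> I) \<inter> (bdry X \<times> J))"
    unfolding strip_def using assms by (intro inj_on_image_Int[OF inj_kappa, symmetric]) auto
  then show ?thesis by (simp add: strip_def Times_Int_distrib1 Sigma_Int_distrib1 Times_Int_Times)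
qed

lemma strip_disjoint:
  assumes "x \<in> strp I" "x \<in> strp J" "I \<subseteq> {0..1}" "J \<subseteq> {0..1}" "I \<inter> J = {}"
  shows False
  using strip_Int[OF assms(3,4)] assms by (auto simp: strip_def)

lemma strip_points: "I \<subseteq> {0..1} \<Longrightarrow> strp I \<subseteq> points X"
  using nbhd strip_mono[of I "{0..1}"] by (auto simp: product_nbhd_def)

lemma strip_1: "strp {1} = bdry X"
  using kappa_1 by (force simp: strip_def)

lemma strip_open_part:
  assumes "I \<subseteq> {0..<1}"
  shows "strp I \<subseteq> M"
proof
  fix x assume x: "x \<in> strp I"
  have I: "I \<subseteq> {0..1}" using assms by force
  have "x \<notin> strp {1}"
    using strip_disjoint[OF x, of "{1}"] I assms by force
  then show "x \<in> M"
    using x strip_points[OF I] by (auto simp: strip_1 open_part_def)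
qed

text \<open>Invariance of domain needs a map from an open set of the model space. It is built from a
  boundary chart: the hyperplane directions parametrize boundary points, and the normal coordinate,
  which is free there, shifts the parameter around \<open>t\<close>.\<close>

lemma openin_strip:
  assumes I: "open I" "I \<subseteq> {0<..<1}"
  shows "openin (top_of_set M) (strp I)"
  unfolding openin_subopen[of _ "strp I"]
proof
  fix p assume p: "p \<in> strp I"
  then obtain b t where b: "b \<in> bdry X" "t \<in> I" "p = \<kappa> (b, t)" by (auto simp: strip_def)
  have IM: "strp I \<subseteq> M" using I by (intro strip_open_part) force
  obtain V \<psi> where V: "(V, \<psi>) \<in> atlas X" "b \<in> V"
    by (rule atlas_cover[OF subsetD[OF bdry_subset b(1)]])
  obtain U \<phi> where U: "(U, \<phi>) \<in> atlas X" "p \<in> U"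
    by (rule atlas_cover[OF subsetD[OF open_part_subset subsetD[OF IM p]]])
  note hV = atlasD(3)[OF V(1)] and hU = atlasD(3)[OF U(1)]
  obtain N where N: "open N" "\<psi> ` V = half_space \<inter> N"
    using atlasD(2)[OF V(1)] by (auto simp: openin_open)
  \<comment> \<open>Orthogonal projection onto the bounding hyperplane; within a chart image, the
    points of the hyperplane are those of \<open>bdry X\<close>.\<close>
  define proj where "proj y = y - (y \<bullet> normal_vec) *\<^sub>R normal_vec" for y :: 'e
  have proj_dot: "proj y \<bullet> normal_vec = 0" for y
    by (simp add: proj_def inner_diff_left)
  have contp: "continuous_on S proj" for S
    unfolding proj_def by (intro continuous_intros)
  define W where "W = {y. proj y \<in> N} \<inter> {y. t + y \<bullet> normal_vec \<in> I}"
  have "open {y. proj y \<in> N}"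
    using open_vimage[OF N(1) contp] by (simp add: vimage_def)
  moreover have "open {y. t + y \<bullet> (normal_vec :: 'e) \<in> I}"
    using open_vimage[OF I(1), of "\<lambda>y. t + y \<bullet> (normal_vec :: 'e)"]
    by (simp add: vimage_def continuous_intros)
  ultimately have oW: "open W"
    unfolding W_def by (rule open_Int)
  define \<beta> where "\<beta> y = inv_into V \<psi> (proj y)" for y
  have projV: "proj y \<in> \<psi> ` V" if "y \<in> W" for y
    using that N(2) proj_dot by (auto simp: W_def half_space_def)
  have \<beta>V: "\<beta> y \<in> V" "\<psi> (\<beta> y) = proj y" if "y \<in> W" for y
    using inv_into_into[OF projV[OF that]] f_inv_into_f[OF projV[OF that]] by (simp_all add: \<beta>_def)
  have \<beta>b: "\<beta> y \<in> bdry X" if "y \<in> W" for y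
    using bdry_iff[OF V(1) \<beta>V(1)[OF that]] \<beta>V(2)[OF that] proj_dot by simp
  have WI: "t + y \<bullet> normal_vec \<in> I" if "y \<in> W" for y
    using that by (simp add: W_def)
  \<comment> \<open>A continuous injection of the open set \<open>W\<close> into the strip, passing
    through \<open>p\<close> at \<open>\<psi> b\<close>. Read in the chart \<open>\<phi>\<close> it
    maps into the space that contains \<open>W\<close>, so its image is open.\<close>
  define Y where "Y y = \<kappa> (\<beta> y, t + y \<bullet> normal_vec)" for y
  have Ystrip: "Y y \<in> strp I" if "y \<in> W" for y
    using \<beta>b[OF that] WI[OF that] by (auto simp: Y_def strip_def)
  have contb: "continuous_on W \<beta>"
    unfolding \<beta>_def
  proof (rule continuous_on_compose2[where g = "inv_into V \<psi>" and f = proj and t = "\<psi> ` V"])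
    show "continuous_on (\<psi> ` V) (inv_into V \<psi>)" using hV by (simp add: homeomorphism_def)
  qed (use contp projV in auto)
  have mem: "(\<beta> y, t + y \<bullet> normal_vec) \<in> bdry X \<times> {0..1}" if "y \<in> W" for y
    using \<beta>b[OF that] subsetD[OF I(2) WI[OF that]] by simp
  have contY: "continuous_on W Y"
    unfolding Y_def
  proof (rule continuous_on_compose2[OF continuous_kappa])
    show "continuous_on W (\<lambda>y. (\<beta> y, t + y \<bullet> normal_vec))"
      by (intro continuous_intros contb)
    show "(\<lambda>y. (\<beta> y, t + y \<bullet> normal_vec)) ` W \<subseteq> bdry X \<times> {0..1}"
      using mem by blast
  qed
  have injY: "inj_on Y W"
  proof (rule inj_onI)
    fix y z assume yz: "y \<in> W" "z \<in> W" "Y y = Y z"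
    have "(\<beta> y, t + y \<bullet> normal_vec) = (\<beta> z, t + z \<bullet> normal_vec)"
      using yz(3) unfolding Y_def
      by (rule inj_onD[OF inj_kappa _ mem[OF yz(1)] mem[OF yz(2)]])
    then have "\<beta> y = \<beta> z" and d: "y \<bullet> normal_vec = z \<bullet> normal_vec" by auto
    then have "proj y = proj z" using \<beta>V(2) yz by metis
    then show "y = z" using d by (simp add: proj_def)
  qed
  let ?W' = "W \<inter> Y -` U"
  have "openin (top_of_set W) ?W'"
  proof (rule continuous_openin_preimage[OF contY _ atlasD(1)[OF U(1)]])
    show "Y \<in> W \<rightarrow> points X" using Ystrip IM open_part_subset by blast
  qed
  then have oW': "open ?W'" using oW openin_open_trans by blast
  have "open ((\<lambda>y. \<phi> (Y y)) ` ?W')"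
  proof (rule invariance_of_domain[OF _ oW'])
    show "continuous_on ?W' (\<lambda>y. \<phi> (Y y))"
    proof (rule continuous_on_compose2[where g = \<phi> and f = Y and t = U])
      show "continuous_on U \<phi>" using hU by (simp add: homeomorphism_def)
      show "continuous_on ?W' Y" using contY by (rule continuous_on_subset) blast
    qed blast
    show "inj_on (\<lambda>y. \<phi> (Y y)) ?W'"
    proof (rule inj_onI)
      fix y z assume yz: "y \<in> ?W'" "z \<in> ?W'" "\<phi> (Y y) = \<phi> (Y z)"
      then have "Y y = Y z" using inj_onD[OF homeomorphism_inj_on[OF hU]] by blast
      then show "y = z" using inj_onD[OF injY] yz by blast
    qed
  qed
  moreover have "continuous_on U \<phi>" using hU by (simp add: homeomorphism_def)
  ultimately have "openin (top_of_set U) (U \<inter> \<phi> -` ((\<lambda>y. \<phi> (Y y)) ` ?W'))"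
    by (intro continuous_openin_preimage_gen)
  moreover have "U \<inter> \<phi> -` ((\<lambda>y. \<phi> (Y y)) ` ?W') = Y ` ?W'"
    using inj_onD[OF homeomorphism_inj_on[OF hU]] by blast
  ultimately have "openin (top_of_set (points X)) (Y ` ?W')"
    using atlasD(1)[OF U(1)] openin_trans by auto
  moreover have sub: "Y ` ?W' \<subseteq> strp I" using Ystrip by blast
  ultimately have "openin (top_of_set M) (Y ` ?W')"
    using IM open_part_subset openin_subset_trans[of "points X" "Y ` ?W'" M] by blast
  moreover have "p \<in> Y ` ?W'"
  proof
    have pb: "proj (\<psi> b) = \<psi> b" "\<psi> b \<bullet> normal_vec = 0"
      using bdry_iff[OF V] b by (simp_all add: proj_def)
    then have "\<psi> b \<in> W" using b V N(2) by (auto simp: W_def)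
    moreover show "p = Y (\<psi> b)"
      using b pb homeomorphism_apply1[OF hV V(2)] by (simp add: Y_def \<beta>_def)
    ultimately show "\<psi> b \<in> ?W'" using U(2) by simp
  qed
  ultimately show "\<exists>T. openin (top_of_set M) T \<and> p \<in> T \<and> T \<subseteq> strp I"
    using sub by blast
qed

lemma compact_strip: "compact I \<Longrightarrow> I \<subseteq> {0..1} \<Longrightarrow> compact (strp I)"
  unfolding strip_def
  by (intro compact_continuous_image continuous_on_subset[OF continuous_kappa] compact_Times compact_bdry) auto

lemma strip_collar:
  assumes "t < 1"
  shows "strp {t<..1} = strp {t<..<1} \<union> bdry X"
proof -
  have "{t<..1} = {t<..<1} \<union> {1}" using assms by auto
  then show ?thesis using strip_1 strip_Un by metis
qed

text \<open>That the embedding fills a whole neighbourhood of the boundary is not part of its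
  definition. Near a boundary point the interior side \<open>V \<inter> M\<close> is a half ball,
  hence connected; its part in the strip is open by \<open>openin_strip\<close>, closed because
  product neighbourhoods are closed in \<open>M\<close>, and nonempty, so it is everything.\<close>

lemma openin_collar:
  assumes t: "0 \<le> t" "t < 1"
  shows "openin (top_of_set (points X)) (strp {t<..1})"
  unfolding openin_subopen[of _ "strp {t<..1}"]
proof
  fix p assume p: "p \<in> strp {t<..1}"
  note eq = strip_collar[OF t(2)]
  have o: "openin (top_of_set M) (strp {t<..<1})"
    using t by (intro openin_strip) auto
  show "\<exists>T. openin (top_of_set (points X)) T \<and> p \<in> T \<and> T \<subseteq> strp {t<..1}"
  proof (cases "p \<in> strp {t<..<1}")
    case True
    then show ?thesis using o openin_trans[OF o openin_open_part] eq by blast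
  next
    case False
    with p eq have pb: "p \<in> bdry X" by blast
    obtain U \<phi> where U: "(U, \<phi>) \<in> atlas X" "p \<in> U"
      by (rule atlas_cover[OF subsetD[OF bdry_subset pb]])
    note hU = atlasD(3)[OF U(1)]
    have cl: "closed (strp {0..t})"
      using t by (intro compact_imp_closed compact_strip) auto
    have "p \<notin> strp {0..t}"
    proof
      assume "p \<in> strp {0..t}"
      moreover have "p \<in> strp {1}" using pb strip_1 by simp
      ultimately show False
        using t by (elim strip_disjoint) auto
    qed
    have "openin (top_of_set (points X)) (points X - strp {0..t})"
      using cl unfolding openin_open by (intro exI[of _ "- strp {0..t}"]) auto
    from chart_open_image[OF U(1) this] obtain N where
      N: "open N" "\<phi> ` (U \<inter> (points X - strp {0..t})) = half_space \<inter> N"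
      by (auto simp: openin_open)
    have "\<phi> p \<in> N"
      using N(2) U pb bdry_subset \<open>p \<notin> strp {0..t}\<close> by blast
    then obtain e where e: "0 < e" "ball (\<phi> p) e \<subseteq> N"
      using N(1) open_contains_ball by blast
    define V where "V = U \<inter> \<phi> -` ball (\<phi> p) e"
    have Vmem: "x \<in> points X - strp {0..t}" if "x \<in> V" for x
    proof -
      have x: "x \<in> U" "\<phi> x \<in> half_space \<inter> N"
        using that e chart_nonneg[OF U(1)] by (auto simp: V_def half_space_def)
      then obtain x' where x': "x' \<in> U \<inter> (points X - strp {0..t})" "\<phi> x = \<phi> x'"
        using N(2) by blast
      then have "x = x'" using inj_onD[OF homeomorphism_inj_on[OF hU]] x by blast
      then show ?thesis using x' by blast
    qed
    have contU: "continuous_on U \<phi>" "continuous_on (\<phi> ` U) (inv_into U \<phi>)"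
      using hU by (simp_all add: homeomorphism_def)
    have "openin (top_of_set U) V"
      unfolding V_def by (intro continuous_openin_preimage_gen contU open_ball)
    then have oV: "openin (top_of_set (points X)) V"
      using atlasD(1)[OF U(1)] openin_trans by blast
    have pV: "p \<in> V" using U e by (simp add: V_def)
    let ?H = "ball (\<phi> p) e \<inter> {y. 0 < y \<bullet> normal_vec}"
    have H: "?H \<subseteq> \<phi> ` U"
      using e N(2) by (auto simp: half_space_def)
    have "V \<inter> M = inv_into U \<phi> ` ?H"
    proof (intro equalityI subsetI)
      fix x assume "x \<in> V \<inter> M"
      then have "x \<in> U" "\<phi> x \<in> ?H" using open_part_iff[OF U(1)] by (auto simp: V_def)
      then show "x \<in> inv_into U \<phi> ` ?H"
        using homeomorphism_apply1[OF hU] by (intro image_eqI[of _ _ "\<phi> x"]) simp_all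
    next
      fix x assume "x \<in> inv_into U \<phi> ` ?H"
      then obtain y where y: "y \<in> ?H" "x = inv_into U \<phi> y" by blast
      then have "y \<in> \<phi> ` U" using H by blast
      then have "x \<in> U" "\<phi> x = y" using y by (simp_all add: inv_into_into f_inv_into_f)
      then show "x \<in> V \<inter> M" using y open_part_iff[OF U(1)] by (auto simp: V_def)
    qed
    moreover have "convex {y. 0 < y \<bullet> (normal_vec :: 'e)}"
      using convex_halfspace_gt[of 0 "normal_vec :: 'e"] by (simp add: inner_commute)
    then have "connected ?H"
      by (intro convex_connected convex_Int convex_ball)
    ultimately have conn: "connected (V \<inter> M)"
      using continuous_on_subset[OF contU(2) H] connected_continuous_image by metis
    let ?S = "(V \<inter> M) \<inter> strp {t<..<1}"
    have "openin (top_of_set (V \<inter> M)) ?S"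
      using o by (auto simp: openin_open)
    \<comment> \<open>\<open>V\<close> avoids the compact strip over \<open>[0, t]\<close>, so the
      open strip and the whole product neighbourhood cut out the same part of \<open>V\<close>, and
      closedness is inherited.\<close>
    moreover have "?S = (V \<inter> M) \<inter> strp {0..<1}"
    proof -
      have "strp {0..<1} = strp {0..t} \<union> strp {t<..<1}"
        using t by (simp add: ivl_disj_un_two flip: strip_Un)
      then show ?thesis using Vmem by blast
    qed
    then have "closedin (top_of_set (V \<inter> M)) ?S"
      using closedin_strip by (auto simp: closedin_closed)
    moreover have "?S \<noteq> {}"
    proof -
      \<comment> \<open>The fibre over \<open>p\<close> ends in \<open>p\<close> at parameter 1, so
        it enters \<open>V\<close>; \<open>s\<close> is then chosen both beyond \<open>t\<close> and
        within \<open>d\<close> of 1.\<close>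
      let ?g = "\<lambda>s. \<kappa> (p, s)"
      have "continuous_on {0..1} ?g"
        by (rule continuous_on_compose2[OF continuous_kappa])
           (use pb in \<open>auto intro!: continuous_intros\<close>)
      moreover have "?g \<in> {0..1} \<rightarrow> points X"
        using pb strip_points[of "{0..1}"] by (auto simp: strip_def)
      ultimately have "openin (top_of_set {0..1}) ({0..1} \<inter> ?g -` V)"
        using oV continuous_openin_preimage by blast
      moreover have "1 \<in> {0..1} \<inter> ?g -` V"
        using pV pb kappa_1 by simp
      ultimately obtain d where d: "0 < d" "\<And>s. s \<in> {0..1} \<Longrightarrow> dist s 1 < d \<Longrightarrow> ?g s \<in> V"
        unfolding openin_euclidean_subtopology_iff by (metis Int_iff vimageE)
      define s where "s = max ((t + 1) / 2) (1 - d / 2)"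
      have s: "t < s" "s < 1" "dist s 1 < d"
      proof -
        show "t < s" unfolding s_def less_max_iff_disj using t by simp
        show s1: "s < 1" using t d(1) by (simp add: s_def)
        have "1 - d / 2 \<le> s" by (simp add: s_def)
        then show "dist s 1 < d" using s1 d(1) by (simp add: dist_real_def)
      qed
      then have "?g s \<in> V" using d(2) t by simp
      moreover have "?g s \<in> strp {t<..<1}" using s pb by (auto simp: strip_def)
      moreover have "strp {t<..<1} \<subseteq> M" using t by (intro strip_open_part) auto
      ultimately show ?thesis by blast
    qed
    ultimately have "?S = V \<inter> M"
      using conn unfolding connected_clopen by blast
    then have "V \<subseteq> strp {t<..1}"
      using eq Vmem by (auto simp: open_part_def)
    then show ?thesis using oV pV by blast
  qed
qed

lemma compact_core:
  assumes "0 \<le> t" "t < 1"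
  shows "compact (M - strp {t<..<1})"
proof -
  have "M - strp {t<..<1} = points X - strp {t<..1}"
    using strip_collar[OF assms(2)] by (auto simp: open_part_def)
  moreover have "closedin (top_of_set (points X)) (points X - strp {t<..1})"
    using openin_collar[OF assms] by (simp add: closedin_diff)
  ultimately show ?thesis
    using closedin_compact[OF compact_points] by simp
qed

text \<open>The collar coordinate attains its maximum on the part of \<open>K\<close> in the strip,
  and the maximum is below 1 because \<open>K\<close> contains no boundary point; \<open>T\<close>
  is taken halfway between it and 1.\<close>

lemma compact_misses_end:
  assumes K: "compact K" "K \<subseteq> M"
  obtains T where "0 < T" "T < 1" "K \<inter> strp {T..<1} = {}"
proof -
  let ?K = "K \<inter> strp {0..1}"
  have cK: "compact ?K"
    using K by (intro compact_Int_closed compact_imp_closed compact_strip) auto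
  let ?h = "\<lambda>x. snd (inv_into (bdry X \<times> {0..1}) \<kappa> x)"
  have h: "?h (\<kappa> (b, s)) = s" if "b \<in> bdry X" "s \<in> {0..1}" for b s
    using that by (subst inv_into_f_f[OF inj_kappa]) auto
  show ?thesis
  proof (cases "?K = {}")
    case True
    have "strp {1/2..<1} \<subseteq> strp {0..1}" by (rule strip_mono) auto
    with True have "K \<inter> strp {1/2..<1} = {}" by blast
    then show ?thesis by (intro that[of "1/2"]) auto
  next
    case False
    have "continuous_on ?K ?h"
      using continuous_on_subset[OF continuous_inv_kappa] by (intro continuous_intros) auto
    then obtain x where x: "x \<in> ?K" "\<And>y. y \<in> ?K \<Longrightarrow> ?h y \<le> ?h x"
      using continuous_attains_sup[OF cK False] by blast
    then obtain b s where b: "b \<in> bdry X" "s \<in> {0..1}" "x = \<kappa> (b, s)" by (auto simp: strip_def)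
    have "s \<noteq> 1"
    proof
      assume "s = 1"
      then have "x \<in> bdry X" using b kappa_1 by simp
      then show False using x K by (auto simp: open_part_def)
    qed
    then have s: "0 \<le> s" "s < 1" using b by auto
    have "K \<inter> strp {(s + 1) / 2..<1} = {}"
    proof (rule ccontr)
      assume "K \<inter> strp {(s + 1) / 2..<1} \<noteq> {}"
      then obtain c u where c: "c \<in> bdry X" "(s + 1) / 2 \<le> u" "u < 1" "\<kappa> (c, u) \<in> K"
        by (auto simp: strip_def)
      then have u: "u \<in> {0..1}" using s by auto
      then have "\<kappa> (c, u) \<in> ?K" using c by (auto simp: strip_def)
      from x(2)[OF this] have "u \<le> s" using h c b u by simp
      then show False using c s by simp
    qed
    then show ?thesis using s by (intro that[of "(s + 1) / 2"]) auto
  qed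
qed

end

section \<open>Pushing balls into product neighbourhoods\<close>

lemma cr_map_subset:
  assumes "cr_map r A B S f" "T \<subseteq> S"
  shows "cr_map r A B T f"
proof (rule cr_mapI)
  show "continuous_on T f"
    using assms continuous_on_subset by (auto simp: cr_map_def)
  fix U \<phi> V \<psi> assume "(U, \<phi>) \<in> A" "(V, \<psi>) \<in> B"
  then have "cr_on r (\<psi> \<circ> f \<circ> inv_into U \<phi>) (\<phi> ` (S \<inter> U \<inter> f -` V))"
    using assms(1) unfolding cr_map_def by fast
  moreover have "\<phi> ` (T \<inter> U \<inter> f -` V) \<subseteq> \<phi> ` (S \<inter> U \<inter> f -` V)"
    using assms(2) by blast
  ultimately show "cr_on r (\<psi> \<circ> f \<circ> inv_into U \<phi>) (\<phi> ` (T \<inter> U \<inter> f -` V))"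
    by (rule cr_on_subset)
qed

definition chart_map :: "'a set \<Rightarrow> ('a \<Rightarrow> 'e) \<Rightarrow> ('e \<Rightarrow> 'e) \<Rightarrow> 'a \<Rightarrow> 'a" where
  "chart_map U \<phi> F x = (if x \<in> U then inv_into U \<phi> (F (\<phi> x)) else x)"

locale chart_diffeo = cr_manifold r X
  for r :: enat and X :: "('a::t2_space, 'e::euclidean_space) bmanifold" +
  fixes U :: "'a set" and \<phi> :: "'a \<Rightarrow> 'e" and c :: 'e and R :: real and F H :: "'e \<Rightarrow> 'e"
  assumes chart: "(U, \<phi>) \<in> open_charts r X" and cball: "cball c R \<subseteq> \<phi> ` U"
    and smooth: "\<And>k. times_cont_diff k F UNIV" "\<And>k. times_cont_diff k H UNIV"
    and FH: "\<And>x. F (H x) = x" "\<And>x. H (F x) = x"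
    and outside: "\<And>x. R \<le> dist c x \<Longrightarrow> F x = x"
begin

text \<open>Every fact about \<open>\<Phi>\<close> thereby holds for its inverse. The one condition
  that is not visibly symmetric follows by applying \<open>H\<close> to
  \<open>F x = x\<close>.\<close>

lemma swap: "chart_diffeo r X U \<phi> c R H F"
proof
  show "H x = x" if "R \<le> dist c x" for x
    using outside[OF that] FH(2)[of x] by simp
qed (use chart cball smooth FH in auto)

abbreviation "\<Phi> \<equiv> chart_map U \<phi> F"

lemma homeo: "homeomorphism U (\<phi> ` U) \<phi> (inv_into U \<phi>)"
  by (rule open_chartD(3)[OF chart])

lemma F_chart: "y \<in> \<phi> ` U \<Longrightarrow> F y \<in> \<phi> ` U"
proof (cases "R \<le> dist c (F y)")
  \<comment> \<open>A point sent outside the ball is sent to a fixed point of \<open>F\<close>,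
    hence was that point already.\<close>
  case True
  then have "F (F y) = F y" by (rule outside)
  then have "F y = y" using FH(2) by metis
  then show "y \<in> \<phi> ` U \<Longrightarrow> F y \<in> \<phi> ` U" by simp
next
  case False
  then show "F y \<in> \<phi> ` U" using cball by auto
qed

lemma Phi_chart:
  assumes "x \<in> U"
  shows "\<Phi> x \<in> U" "\<phi> (\<Phi> x) = F (\<phi> x)"
  using F_chart[of "\<phi> x"] assms by (simp_all add: chart_map_def inv_into_into f_inv_into_f)

lemma Phi_outside: "x \<notin> U \<Longrightarrow> \<Phi> x = x"
  by (simp add: chart_map_def)

lemma Phi_outside_cball:
  assumes "x \<in> U" "R \<le> dist c (\<phi> x)"
  shows "\<Phi> x = x"
  using assms homeomorphism_apply1[OF homeo] outside by (simp add: chart_map_def)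

lemma Phi_iter_chart:
  assumes "x \<in> U"
  shows "(\<Phi> ^^ n) x \<in> U \<and> \<phi> ((\<Phi> ^^ n) x) = (F ^^ n) (\<phi> x)"
  using assms by (induction n) (simp_all add: Phi_chart)

lemma Phi_inverse: "chart_map U \<phi> H (\<Phi> x) = x"
proof (cases "x \<in> U")
  case True
  then show ?thesis
    using Phi_chart[OF True] homeomorphism_apply1[OF homeo] FH
    by (simp add: chart_map_def[of U \<phi> H])
qed (simp add: chart_map_def)

lemma Phi_open_part: "x \<in> M \<Longrightarrow> \<Phi> x \<in> M"
  using Phi_chart(1)[of x] Phi_outside[of x] open_chartD(4)[OF chart] by (cases "x \<in> U") auto

lemma Phi_points: "x \<in> points X \<Longrightarrow> \<Phi> x \<in> points X"
  using Phi_chart(1)[of x] Phi_outside[of x] open_chartD(4)[OF chart] open_part_subset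
  by (cases "x \<in> U") auto

text \<open>Two relatively open pieces cover the manifold: the chart domain, where the map is
  \<open>F\<close> in coordinates, and the complement of the compact ball, where it is the identity.
  The boundary lies in the second piece and so causes no difficulty.\<close>

lemma Phi_cr_map: "cr_map r (atlas X) (atlas X) (points X) \<Phi>"
proof (rule cr_mapI)
  let ?K = "inv_into U \<phi> ` cball c R"
  have K: "compact ?K" "?K \<subseteq> U" by (rule compact_chart_cball[OF chart cball])+
  have off: "\<Phi> x = x" if "x \<notin> ?K" for x
  proof (cases "x \<in> U")
    case True
    have "\<phi> x \<notin> cball c R"
      using that homeomorphism_apply1[OF homeo True] by (metis imageI)
    then show ?thesis using Phi_outside_cball[OF True] by simp
  qed (rule Phi_outside)
  have oU: "openin (top_of_set (points X)) U" by (rule open_chartD(5)[OF chart])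
  have oK: "openin (top_of_set (points X)) (points X - ?K)"
    using compact_imp_closed[OF K(1)] unfolding openin_open by (intro exI[of _ "- ?K"]) auto
  have un: "U \<union> (points X - ?K) = points X"
    using K(2) openin_imp_subset[OF oU] by blast
  have contF: "continuous_on S F" for S
    using times_cont_diff_continuous[OF smooth(1)[of 0]] continuous_on_subset by blast
  have "continuous_on U \<Phi>"
  proof (rule continuous_on_eq)
    show "continuous_on U (\<lambda>x. inv_into U \<phi> (F (\<phi> x)))"
    proof (rule continuous_on_compose2[where g = "inv_into U \<phi>" and t = "\<phi> ` U"])
      show "continuous_on (\<phi> ` U) (inv_into U \<phi>)" using homeo by (simp add: homeomorphism_def)
      show "continuous_on U (\<lambda>x. F (\<phi> x))"
        by (rule continuous_on_compose2[OF contF[of UNIV]])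
           (use homeo in \<open>auto simp: homeomorphism_def\<close>)
      show "(\<lambda>x. F (\<phi> x)) ` U \<subseteq> \<phi> ` U" using F_chart by blast
    qed
  qed (simp add: chart_map_def)
  moreover have "continuous_on (points X - ?K) \<Phi>"
    by (rule continuous_on_eq[OF continuous_on_id]) (use off in auto)
  ultimately show "continuous_on (points X) \<Phi>"
    using continuous_on_Un_local_open[of U "points X - ?K" \<Phi>] oU oK un by simp
  fix V \<psi> V' \<psi>' assume V: "(V, \<psi>) \<in> atlas X" and V': "(V', \<psi>') \<in> atlas X"
  note hV = atlasD(3)[OF V]
  have inv: "inv_into V \<psi> (\<psi> x) = x" if "x \<in> V" for x
    using that homeomorphism_apply1[OF hV] by blast
  have injV: "x = y" if "\<psi> x = \<psi> y" "x \<in> V" "y \<in> V" for x y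
    using that inv by metis
  let ?Z = "\<psi> ` (points X \<inter> V \<inter> \<Phi> -` V')"
  \<comment> \<open>Chart images are only relatively open in the half space; this yields an open set
    of the model space that detects membership in \<open>W\<close> for points of the chart.\<close>
  have nbhd: "\<exists>N. open N \<and> \<psi> x \<in> N \<and> (\<forall>y\<in>V. \<psi> y \<in> N \<longrightarrow> y \<in> W)"
    if W: "openin (top_of_set (points X)) W" and x: "x \<in> W" "x \<in> V" for W x
  proof -
    obtain N where N: "open N" "\<psi> ` (V \<inter> W) = half_space \<inter> N"
      using chart_open_image[OF V W] by (auto simp: openin_open)
    moreover have "\<psi> x \<in> N" using N(2) x by blast
    moreover have "y \<in> W" if y: "y \<in> V" "\<psi> y \<in> N" for y
    proof -
      have "\<psi> y \<in> \<psi> ` (V \<inter> W)"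
        using y N(2) chart_nonneg[OF V y(1)] by (simp add: half_space_def)
      then obtain z where "z \<in> V" "z \<in> W" "\<psi> y = \<psi> z" by blast
      then show ?thesis using injV y by blast
    qed
    ultimately show ?thesis by blast
  qed
  show "cr_on r (\<psi>' \<circ> \<Phi> \<circ> inv_into V \<psi>) ?Z"
  proof (rule cr_on_locally)
    fix z assume "z \<in> ?Z"
    then obtain x where x: "x \<in> points X" "x \<in> V" "\<Phi> x \<in> V'" "z = \<psi> x" by auto
    show "\<exists>N. open N \<and> z \<in> N \<and> cr_on r (\<psi>' \<circ> \<Phi> \<circ> inv_into V \<psi>) (?Z \<inter> N)"
    proof (cases "x \<in> U")
      case True
      obtain N where N: "open N" "\<psi> x \<in> N" "\<forall>y\<in>V. \<psi> y \<in> N \<longrightarrow> y \<in> U"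
        using nbhd[OF oU True x(2)] by blast
      have ZN: "\<exists>y. y \<in> V \<and> y \<in> U \<and> \<Phi> y \<in> V' \<and> w = \<psi> y" if "w \<in> ?Z \<inter> N" for w
        using that N(3) by auto
      have c1: "cr_on r (\<phi> \<circ> inv_into V \<psi>) (\<psi> ` (U \<inter> V))"
        and c2: "cr_on r (\<psi>' \<circ> inv_into U \<phi>) (\<phi> ` (U \<inter> V'))"
        using open_chartD(6)[OF chart V] open_chartD(6)[OF chart V'] by (auto simp: compatible_def)
      have c12: "cr_on r (\<lambda>w. F ((\<phi> \<circ> inv_into V \<psi>) w)) (\<psi> ` (U \<inter> V))"
        by (rule cr_on_compose[OF c1 cr_on_smooth[OF open_UNIV smooth(1)]]) simp
      have "cr_on r (\<lambda>w. (\<psi>' \<circ> inv_into U \<phi>) (F ((\<phi> \<circ> inv_into V \<psi>) w))) (?Z \<inter> N)"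
      proof (rule cr_on_compose[OF cr_on_subset[OF c12] c2])
        show "?Z \<inter> N \<subseteq> \<psi> ` (U \<inter> V)" using ZN by blast
        show "(\<lambda>w. F ((\<phi> \<circ> inv_into V \<psi>) w)) ` (?Z \<inter> N) \<subseteq> \<phi> ` (U \<inter> V')"
        proof (rule image_subsetI)
          fix w assume "w \<in> ?Z \<inter> N"
          then obtain y where y: "y \<in> V" "y \<in> U" "\<Phi> y \<in> V'" "w = \<psi> y" using ZN by blast
          then have "F ((\<phi> \<circ> inv_into V \<psi>) w) = \<phi> (\<Phi> y)"
            using inv Phi_chart by simp
          then show "F ((\<phi> \<circ> inv_into V \<psi>) w) \<in> \<phi> ` (U \<inter> V')"
            using y by (intro image_eqI[of _ _ "\<Phi> y"]) (simp_all add: Phi_chart)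
        qed
      qed
      moreover have "(\<psi>' \<circ> inv_into U \<phi>) (F ((\<phi> \<circ> inv_into V \<psi>) w)) = (\<psi>' \<circ> \<Phi> \<circ> inv_into V \<psi>) w"
        if w: "w \<in> ?Z \<inter> N" for w
      proof -
        obtain y where y: "y \<in> V" "y \<in> U" "w = \<psi> y" using ZN[OF w] by blast
        then show ?thesis using inv by (simp add: chart_map_def)
      qed
      ultimately have "cr_on r (\<psi>' \<circ> \<Phi> \<circ> inv_into V \<psi>) (?Z \<inter> N)"
        by (subst (asm) cr_on_cong) auto
      then show ?thesis using N x by blast
    next
      case False
      then have xK: "x \<in> points X - ?K" using x K(2) by blast
      obtain N where N: "open N" "\<psi> x \<in> N" "\<forall>y\<in>V. \<psi> y \<in> N \<longrightarrow> y \<in> points X - ?K"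
        using nbhd[OF oK xK x(2)] by blast
      have ZN: "\<exists>y. y \<in> V \<and> \<Phi> y = y \<and> y \<in> V' \<and> w = \<psi> y" if w: "w \<in> ?Z \<inter> N" for w
      proof -
        obtain y where y: "y \<in> V" "\<Phi> y \<in> V'" "w = \<psi> y" using w by auto
        then have "\<Phi> y = y" using N(3) w off by auto
        then show ?thesis using y by metis
      qed
      have c1: "cr_on r (\<psi>' \<circ> inv_into V \<psi>) (\<psi> ` (V \<inter> V'))"
        using atlas_compatible[OF V V'] by (auto simp: compatible_def)
      have "cr_on r (\<psi>' \<circ> inv_into V \<psi>) (?Z \<inter> N)"
        using ZN by (intro cr_on_subset[OF c1]) blast
      moreover have "(\<psi>' \<circ> inv_into V \<psi>) w = (\<psi>' \<circ> \<Phi> \<circ> inv_into V \<psi>) w" if w: "w \<in> ?Z \<inter> N" for w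
        using ZN[OF w] inv by auto
      ultimately have "cr_on r (\<psi>' \<circ> \<Phi> \<circ> inv_into V \<psi>) (?Z \<inter> N)"
        by (subst (asm) cr_on_cong) auto
      then show ?thesis using N x by blast
    qed
  qed
qed

lemma strip_Phi: "strip X (\<lambda>z. \<Phi> (\<kappa> z)) J = \<Phi> ` strip X \<kappa> J"
  by (auto simp: strip_def)

text \<open>This is how diffeomorphisms outside \<open>G\<close> enter: a group with translation
  systems has translations along the new neighbourhood too. The condition at parameter 1 survives
  because the chart lies in \<open>M\<close>, so that \<open>\<Phi>\<close> fixes the
  boundary.\<close>

lemma product_nbhd_Phi:
  assumes \<kappa>: "product_nbhd r X \<kappa>"
  shows "product_nbhd r X (\<lambda>z. \<Phi> (\<kappa> z))"
proof -
  interpret swp: chart_diffeo r X U \<phi> c R H F by (rule swap)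
  interpret \<kappa>: product_nbhd_in r X \<kappa> by unfold_locales (fact \<kappa>)
  let ?\<Psi> = "chart_map U \<phi> H" and ?D = "bdry X \<times> {0..1::real}"
  have cr\<kappa>: "cr_map r (times_line (atlas X)) (atlas X) ?D \<kappa>"
    "cr_map r (atlas X) (times_line (atlas X)) (strip X \<kappa> {0..1}) (inv_into ?D \<kappa>)"
    using \<kappa> by (simp_all add: product_nbhd_def)
  have inj: "inj_on (\<lambda>z. \<Phi> (\<kappa> z)) ?D"
  proof (rule inj_onI)
    fix y z assume yz: "y \<in> ?D" "z \<in> ?D" "\<Phi> (\<kappa> y) = \<Phi> (\<kappa> z)"
    have "\<kappa> y = ?\<Psi> (\<Phi> (\<kappa> y))" by (rule Phi_inverse[symmetric])
    also have "\<dots> = ?\<Psi> (\<Phi> (\<kappa> z))" by (rule arg_cong[OF yz(3)])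
    also have "\<dots> = \<kappa> z" by (rule Phi_inverse)
    finally have "\<kappa> y = \<kappa> z" .
    then show "y = z" using yz(1,2) by (rule inj_onD[OF \<kappa>.inj_kappa])
  qed
  have sub: "strip X \<kappa> {0..1} \<subseteq> points X" by (rule \<kappa>.strip_points) simp
  then have sub': "\<Phi> ` strip X \<kappa> {0..1} \<subseteq> points X" using Phi_points by blast
  have "cr_map r (times_line (atlas X)) (atlas X) ?D (\<lambda>z. \<Phi> (\<kappa> z))"
    by (rule cr_map_compose[OF charts_on_times_line[OF charts_on_atlas] charts_on_atlas cr\<kappa>(1) Phi_cr_map])
       (use sub in \<open>auto simp: strip_def\<close>)
  moreover have "cr_map r (atlas X) (times_line (atlas X)) (\<Phi> ` strip X \<kappa> {0..1})
      (\<lambda>y. inv_into ?D \<kappa> (?\<Psi> y))"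
    by (rule cr_map_compose[OF charts_on_atlas charts_on_atlas
          cr_map_subset[OF swp.Phi_cr_map sub'] cr\<kappa>(2)])
       (use sub Phi_inverse in auto)
  then have "cr_map r (atlas X) (times_line (atlas X)) (\<Phi> ` strip X \<kappa> {0..1})
      (inv_into ?D (\<lambda>z. \<Phi> (\<kappa> z)))"
  proof (subst (asm) cr_map_cong[OF charts_on_atlas])
    fix y assume "y \<in> \<Phi> ` strip X \<kappa> {0..1}"
    then obtain z where z: "z \<in> ?D" "y = \<Phi> (\<kappa> z)" by (auto simp: strip_def)
    then show "inv_into ?D \<kappa> (?\<Psi> y) = inv_into ?D (\<lambda>z. \<Phi> (\<kappa> z)) y"
      using inv_into_f_f[OF inj z(1)] inv_into_f_f[OF \<kappa>.inj_kappa z(1)] Phi_inverse by simp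
  qed
  moreover have "\<Phi> (\<kappa> (b, 1)) = b" if "b \<in> bdry X" for b
  proof -
    have "b \<notin> U" using that open_chartD(4)[OF chart] by (auto simp: open_part_def)
    then show ?thesis using \<kappa>.kappa_1[OF that] Phi_outside by simp
  qed
  moreover have "closedin (top_of_set M) (\<Phi> ` strip X \<kappa> {0..<1})"
  proof -
    have "continuous_on M ?\<Psi>"
      using swp.Phi_cr_map continuous_on_subset[OF _ open_part_subset] by (auto simp: cr_map_def)
    then have "closedin (top_of_set M) (M \<inter> ?\<Psi> -` strip X \<kappa> {0..<1})"
      using \<kappa>.closedin_strip swp.Phi_open_part
      by (intro continuous_closedin_preimage_gen[where T = M]) auto
    moreover have "M \<inter> ?\<Psi> -` strip X \<kappa> {0..<1} = \<Phi> ` strip X \<kappa> {0..<1}"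
    proof (intro equalityI subsetI)
      fix x assume "x \<in> M \<inter> ?\<Psi> -` strip X \<kappa> {0..<1}"
      then show "x \<in> \<Phi> ` strip X \<kappa> {0..<1}"
        using swp.Phi_inverse[of x] by (metis IntD2 imageI vimageE)
    next
      fix x assume "x \<in> \<Phi> ` strip X \<kappa> {0..<1}"
      then show "x \<in> M \<inter> ?\<Psi> -` strip X \<kappa> {0..<1}"
        using \<kappa>.strip_open_part[of "{0..<1}"] Phi_open_part Phi_inverse by auto
    qed
    ultimately show ?thesis by simp
  qed
  ultimately show ?thesis
    unfolding product_nbhd_def strip_Phi using inj sub' by blast
qed

end

section \<open>Every point and every ball of the interior lies in some open collar\<close>

context cr_manifold
begin

definition in_collar :: "'a \<Rightarrow> bool" where
  "in_collar x \<longleftrightarrow> (\<exists>\<kappa>. product_nbhd r X \<kappa> \<and> x \<in> strip X \<kappa> {0<..<1})"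

text \<open>The collar is moved instead of the ball: once an iterate of the shrinking map takes the
  ball into the collar around its centre, the collar pulled back by that iterate contains the
  ball.\<close>

lemma cball_into_collar:
  assumes U: "(U, \<phi>) \<in> open_charts r X" and cb: "cball c R \<subseteq> \<phi> ` U"
    and \<rho>: "0 \<le> \<rho>" "\<rho> < R" and col: "in_collar (inv_into U \<phi> c)"
  shows "\<exists>\<kappa>. product_nbhd r X \<kappa> \<and> inv_into U \<phi> ` cball c \<rho> \<subseteq> strip X \<kappa> {0<..<1}"
proof -
  have R: "0 < R" using \<rho> by simp
  obtain \<kappa> where \<kappa>: "product_nbhd r X \<kappa>" "inv_into U \<phi> c \<in> strip X \<kappa> {0<..<1}"
    using col by (auto simp: in_collar_def)
  interpret \<kappa>: product_nbhd_in r X \<kappa> by unfold_locales (fact \<kappa>(1))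
  note hU = open_chartD(3)[OF U]
  obtain F H where FH: "\<And>k. times_cont_diff k F UNIV" "\<And>k. times_cont_diff k H UNIV"
    "\<And>x. F (H x) = x" "\<And>x. H (F x) = x" "\<And>x. R \<le> dist c x \<Longrightarrow> F x = x"
    "\<And>\<rho> \<epsilon>. 0 \<le> \<rho> \<Longrightarrow> \<rho> < R \<Longrightarrow> 0 < \<epsilon> \<Longrightarrow> \<exists>n. (F ^^ n) ` cball c \<rho> \<subseteq> ball c \<epsilon>"
    by (rule shrinking_diffeo[OF R, of c]) (rule that)
  interpret cd: chart_diffeo r X U \<phi> c R F H
    by unfold_locales (use U cb FH(1-5) in auto)
  interpret swp: chart_diffeo r X U \<phi> c R H F by (rule cd.swap)
  have cU: "c \<in> \<phi> ` U" using cb R by auto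
  have "openin (top_of_set M) (U \<inter> strip X \<kappa> {0<..<1})"
    using open_chartD(1)[OF U] by (intro openin_Int \<kappa>.openin_strip) auto
  then have "openin (top_of_set U) (U \<inter> strip X \<kappa> {0<..<1})"
    using open_chartD(4)[OF U] openin_subset_trans[of M "U \<inter> strip X \<kappa> {0<..<1}" U] by blast
  then have "open (\<phi> ` (U \<inter> strip X \<kappa> {0<..<1}))"
    using homeomorphism_imp_open_map[OF hU] open_chartD(2)[OF U] openin_open_trans by blast
  moreover have "c \<in> \<phi> ` (U \<inter> strip X \<kappa> {0<..<1})"
    using cU \<kappa>(2) by (intro image_eqI[of _ _ "inv_into U \<phi> c"]) (auto simp: f_inv_into_f inv_into_into)
  ultimately obtain \<epsilon> where \<epsilon>: "0 < \<epsilon>" "ball c \<epsilon> \<subseteq> \<phi> ` (U \<inter> strip X \<kappa> {0<..<1})"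
    using open_contains_ball by blast
  obtain n where n: "(F ^^ n) ` cball c \<rho> \<subseteq> ball c \<epsilon>"
    using FH(6)[OF \<rho> \<epsilon>(1)] by blast
  \<comment> \<open>The pullback is made one step at a time, each step composing the neighbourhood
    with the inverse chart map.\<close>
  have "\<exists>\<kappa>'. product_nbhd r X \<kappa>' \<and>
      (\<forall>x. x \<in> strip X \<kappa>' {0<..<1} \<longleftrightarrow> (cd.\<Phi> ^^ n) x \<in> strip X \<kappa> {0<..<1})" for n
  proof (induction n)
    case 0
    show ?case using \<kappa>(1) by auto
  next
    case (Suc n)
    then obtain \<kappa>' where \<kappa>': "product_nbhd r X \<kappa>'"
      "\<And>x. x \<in> strip X \<kappa>' {0<..<1} \<longleftrightarrow> (cd.\<Phi> ^^ n) x \<in> strip X \<kappa> {0<..<1}" by blast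
    have "x \<in> strip X (\<lambda>z. swp.\<Phi> (\<kappa>' z)) {0<..<1} \<longleftrightarrow> (cd.\<Phi> ^^ Suc n) x \<in> strip X \<kappa> {0<..<1}" for x
    proof -
      have "x \<in> swp.\<Phi> ` strip X \<kappa>' {0<..<1} \<longleftrightarrow> cd.\<Phi> x \<in> strip X \<kappa>' {0<..<1}"
      proof
        assume "x \<in> swp.\<Phi> ` strip X \<kappa>' {0<..<1}"
        then show "cd.\<Phi> x \<in> strip X \<kappa>' {0<..<1}" by (auto simp: swp.Phi_inverse)
      next
        assume "cd.\<Phi> x \<in> strip X \<kappa>' {0<..<1}"
        then show "x \<in> swp.\<Phi> ` strip X \<kappa>' {0<..<1}"
          by (intro image_eqI[of _ _ "cd.\<Phi> x"]) (simp_all add: cd.Phi_inverse)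
      qed
      then show ?thesis
        by (simp add: swp.strip_Phi \<kappa>'(2) funpow_swap1)
    qed
    then show ?case using swp.product_nbhd_Phi[OF \<kappa>'(1)] by blast
  qed
  then obtain \<kappa>' where \<kappa>': "product_nbhd r X \<kappa>'"
    "\<And>x. x \<in> strip X \<kappa>' {0<..<1} \<longleftrightarrow> (cd.\<Phi> ^^ n) x \<in> strip X \<kappa> {0<..<1}" by blast
  have "x \<in> strip X \<kappa>' {0<..<1}" if x: "x \<in> inv_into U \<phi> ` cball c \<rho>" for x
  proof -
    obtain y where y: "y \<in> cball c \<rho>" "x = inv_into U \<phi> y" using x by blast
    have "y \<in> \<phi> ` U" using y(1) \<rho> cb by auto
    then have xU: "x \<in> U" "\<phi> x = y" using y(2) by (simp_all add: inv_into_into f_inv_into_f)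
    have "(F ^^ n) y \<in> ball c \<epsilon>" using n y(1) by blast
    then have "(F ^^ n) y \<in> \<phi> ` (U \<inter> strip X \<kappa> {0<..<1})" using \<epsilon>(2) by blast
    then have "\<phi> ((cd.\<Phi> ^^ n) x) \<in> \<phi> ` (U \<inter> strip X \<kappa> {0<..<1})"
      using cd.Phi_iter_chart[OF xU(1), of n] xU(2) by simp
    then obtain z where "z \<in> U" "z \<in> strip X \<kappa> {0<..<1}" "\<phi> ((cd.\<Phi> ^^ n) x) = \<phi> z" by blast
    then have "(cd.\<Phi> ^^ n) x \<in> strip X \<kappa> {0<..<1}"
      using inj_onD[OF homeomorphism_inj_on[OF hU]] cd.Phi_iter_chart[OF xU(1), of n] by metis
    then show ?thesis using \<kappa>'(2) by blast
  qed
  then show ?thesis using \<kappa>'(1) by blast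
qed

text \<open>The property is locally constant on \<open>M\<close>, since
  \<open>cball_into_collar\<close> spreads it from a centre over a ball. Together with the boundary,
  near which \<open>\<kappa>\<close> itself provides it, it defines a nonempty clopen subset of the
  connected manifold.\<close>

lemma in_collar_open_part:
  assumes \<kappa>: "product_nbhd r X \<kappa>" and p: "p \<in> M"
  shows "in_collar p"
proof -
  interpret \<kappa>: product_nbhd_in r X \<kappa> by unfold_locales (fact \<kappa>)
  have local: "\<exists>N. openin (top_of_set (points X)) N \<and> x \<in> N \<and> N \<subseteq> M \<and> (\<forall>y\<in>N. in_collar y \<longleftrightarrow> in_collar x)"
    if x: "x \<in> M" for x
  proof -
    obtain U \<phi> R where U: "(U, \<phi>) \<in> open_charts r X" "x \<in> U" "0 < R" "cball (\<phi> x) R \<subseteq> \<phi> ` U"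
      using open_chart_cball[OF x] .
    note hU = open_chartD(3)[OF U(1)]
    \<comment> \<open>Half the radius: the ball of radius \<open>R / 2\<close> about the image of
      any \<open>y\<close> in this set still fits the chart and contains the image of
      \<open>x\<close>, so the property spreads in both directions.\<close>
    let ?N = "U \<inter> \<phi> -` ball (\<phi> x) (R / 2)"
    have "continuous_on U \<phi>" using hU by (simp add: homeomorphism_def)
    then have "openin (top_of_set U) ?N"
      by (intro continuous_openin_preimage_gen open_ball)
    then have "openin (top_of_set (points X)) ?N"
      using open_chartD(5)[OF U(1)] openin_trans by blast
    moreover have "x \<in> ?N" using U by simp
    moreover have "?N \<subseteq> M" using open_chartD(4)[OF U(1)] by blast
    moreover have "in_collar y \<longleftrightarrow> in_collar x" if y: "y \<in> ?N" for y
    proof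
      have inv: "inv_into U \<phi> (\<phi> x) = x" "inv_into U \<phi> (\<phi> y) = y"
        using homeomorphism_apply1[OF hU] U y by auto
      let ?d = "dist (\<phi> x) (\<phi> y)"
      have d: "0 \<le> ?d" "?d < R / 2" using y by auto
      {
        assume "in_collar x"
        then have "\<exists>\<kappa>. product_nbhd r X \<kappa> \<and> inv_into U \<phi> ` cball (\<phi> x) ?d \<subseteq> strip X \<kappa> {0<..<1}"
          using d U(3) inv by (intro cball_into_collar[OF U(1,4)]) auto
        moreover have "y \<in> inv_into U \<phi> ` cball (\<phi> x) ?d"
          using inv(2) by (intro image_eqI[of _ _ "\<phi> y"]) auto
        ultimately show "in_collar y" unfolding in_collar_def by blast
      }
      {
        assume "in_collar y"
        have "cball (\<phi> y) (R / 2) \<subseteq> cball (\<phi> x) R"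
        proof
          fix z assume "z \<in> cball (\<phi> y) (R / 2)"
          then show "z \<in> cball (\<phi> x) R"
            using d dist_triangle[of "\<phi> x" z "\<phi> y"] by simp
        qed
        then have cb: "cball (\<phi> y) (R / 2) \<subseteq> \<phi> ` U" using U(4) by blast
        then have "\<exists>\<kappa>. product_nbhd r X \<kappa> \<and> inv_into U \<phi> ` cball (\<phi> y) ?d \<subseteq> strip X \<kappa> {0<..<1}"
          using d inv \<open>in_collar y\<close> by (intro cball_into_collar[OF U(1) cb]) auto
        moreover have "x \<in> inv_into U \<phi> ` cball (\<phi> y) ?d"
          using inv(1) by (intro image_eqI[of _ _ "\<phi> x"]) (auto simp: dist_commute)
        ultimately show "in_collar x" unfolding in_collar_def by blast
      }
    qed
    ultimately show ?thesis by blast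
  qed
  let ?Y = "{x \<in> M. in_collar x} \<union> bdry X"
  have "openin (top_of_set (points X)) ?Y"
    unfolding openin_subopen[of _ ?Y]
  proof
    fix x assume x: "x \<in> ?Y"
    show "\<exists>T. openin (top_of_set (points X)) T \<and> x \<in> T \<and> T \<subseteq> ?Y"
    proof (cases "x \<in> M")
      case True
      then have "in_collar x" using x by (auto simp: open_part_def)
      then show ?thesis using local[OF True] by blast
    next
      case False
      have "strip X \<kappa> {0<..1} \<subseteq> ?Y"
        using \<kappa>.strip_collar[of 0] \<kappa>.strip_open_part[of "{0<..<1}"] \<kappa>
        unfolding in_collar_def by fastforce
      moreover have "x \<in> strip X \<kappa> {0<..1}"
        using False x \<kappa>.strip_collar[of 0] by auto
      ultimately show ?thesis using \<kappa>.openin_collar[of 0] by auto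
    qed
  qed
  moreover have "openin (top_of_set (points X)) (points X - ?Y)"
    unfolding openin_subopen[of _ "points X - ?Y"]
  proof
    fix x assume "x \<in> points X - ?Y"
    then have x: "x \<in> M" "\<not> in_collar x" by (auto simp: open_part_def)
    then obtain N where N: "openin (top_of_set (points X)) N" "x \<in> N" "N \<subseteq> M"
      "\<forall>y\<in>N. in_collar y \<longleftrightarrow> in_collar x" using local by blast
    have "N \<subseteq> points X - ?Y" using N x by (auto simp: open_part_def)
    then show "\<exists>T. openin (top_of_set (points X)) T \<and> x \<in> T \<and> T \<subseteq> points X - ?Y"
      using N by blast
  qed
  then have "closedin (top_of_set (points X)) ?Y"
    using bdry_subset open_part_subset by (auto simp: closedin_def)
  ultimately have "?Y = {} \<or> ?Y = points X"
    using connected_points unfolding connected_clopen by blast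
  then have "?Y = points X" using bdry_nonempty by blast
  then show ?thesis using p by (auto simp: open_part_def)
qed

lemma ball_into_collar:
  assumes \<kappa>: "product_nbhd r X \<kappa>" and B: "is_ball r X B"
  obtains \<kappa>' where "product_nbhd r X \<kappa>'" "top_of_set M closure_of B \<subseteq> strip X \<kappa>' {0<..<1}"
proof -
  obtain U \<phi> c \<rho> R where U: "(U, \<phi>) \<in> open_charts r X" and \<rho>: "0 < \<rho>" "\<rho> < R" and cb: "cball c R \<subseteq> \<phi> ` U"
    and cl: "top_of_set M closure_of B \<subseteq> inv_into U \<phi> ` cball c \<rho>"
    using B by (rule ballE) (rule that)
  have "c \<in> \<phi> ` U" using cb \<rho> by auto
  then have "inv_into U \<phi> c \<in> M"
    by (rule subsetD[OF open_chartD(4)[OF U] inv_into_into])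
  then have "in_collar (inv_into U \<phi> c)"
    by (rule in_collar_open_part[OF \<kappa>])
  from cball_into_collar[OF U cb less_imp_le[OF \<rho>(1)] \<rho>(2) this]
  obtain \<kappa>' where "product_nbhd r X \<kappa>'" "inv_into U \<phi> ` cball c \<rho> \<subseteq> strip X \<kappa>' {0<..<1}" by blast
  then show ?thesis using cl by (intro that[of \<kappa>']) auto
qed

end

section \<open>Sequences of gaps\<close>

text \<open>The gaps are the intervals \<open>[s n, t n]\<close> of the collar parameter, which is 1
  on the boundary; block \<open>n\<close> lies between gaps \<open>n\<close> and
  \<open>Suc n\<close>.\<close>

definition gap_seq :: "(nat \<Rightarrow> real) \<Rightarrow> (nat \<Rightarrow> real) \<Rightarrow> bool" where
  "gap_seq s t \<longleftrightarrow> (\<forall>n. 0 < s n \<and> s n < t n \<and> t n < s (Suc n) \<and> t n < 1) \<and> s \<longlonglongrightarrow> 1"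

lemma gap_seqD:
  assumes "gap_seq s t"
  shows "0 < s n" "s n < t n" "t n < s (Suc n)" "t n < 1" "s n < 1" "0 < t n" "s \<longlonglongrightarrow> 1"
proof -
  have "0 < s n \<and> s n < t n \<and> t n < s (Suc n) \<and> t n < 1" "s \<longlonglongrightarrow> 1"
    using assms unfolding gap_seq_def by blast+
  then show "0 < s n" "s n < t n" "t n < s (Suc n)" "t n < 1" "s n < 1" "0 < t n" "s \<longlonglongrightarrow> 1"
    by auto
qed

lemma gap_seq_tendsto:
  assumes "gap_seq s t"
  shows "t \<longlonglongrightarrow> 1"
proof (rule tendsto_sandwich)
  show "\<forall>\<^sub>F n in sequentially. s n \<le> t n" "\<forall>\<^sub>F n in sequentially. t n \<le> 1"
    using gap_seqD(2,4)[OF assms] by (simp_all add: less_imp_le)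
  show "s \<longlonglongrightarrow> 1" by (rule gap_seqD(7)[OF assms])
qed (rule tendsto_const)

lemma gap_seq_mono:
  assumes "gap_seq s t"
  shows "strict_mono s" "strict_mono t"
proof -
  show "strict_mono s"
    using gap_seqD(2,3)[OF assms] by (intro strict_monoI_Suc) (metis less_trans)
  show "strict_mono t"
    using gap_seqD(2,3)[OF assms] by (intro strict_monoI_Suc) (metis less_trans)
qed

lemma gap_seq_eventually:
  assumes "gap_seq s t" "T < 1"
  obtains m where "k < m" "T < s m"
proof -
  have "\<forall>\<^sub>F n in sequentially. T < s n"
    using gap_seqD(7)[OF assms(1)] assms(2) by (rule order_tendstoD)
  then obtain m where "\<And>n. m \<le> n \<Longrightarrow> T < s n" by (auto simp: eventually_sequentially)
  then show ?thesis by (intro that[of "max m (Suc k)"]) auto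
qed

lemma strict_mono_bracket:
  fixes N :: "nat \<Rightarrow> nat"
  assumes "strict_mono N" "N 0 = 0"
  shows "\<exists>i. N i \<le> n \<and> n < N (Suc i)"
proof (induction n)
  case 0
  then show ?case using assms strict_monoD[OF assms(1), of 0 1] by (intro exI[of _ 0]) simp
next
  case (Suc n)
  then obtain i where i: "N i \<le> n" "n < N (Suc i)" by blast
  show ?case
  proof (cases "Suc n < N (Suc i)")
    case True
    then show ?thesis using i by (intro exI[of _ i]) simp
  next
    case False
    then have "N (Suc i) = Suc n" using i by simp
    then show ?thesis
      using strict_monoD[OF assms(1), of "Suc i" "Suc (Suc i)"] by (intro exI[of _ "Suc i"]) simp
  qed
qed

lemma gap_seq_thin:
  assumes "gap_seq s t" "strict_mono N"
  shows "gap_seq (\<lambda>i. s (N i)) (\<lambda>i. t (N i))"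
proof -
  have "t (N i) < s (N (Suc i))" for i
  proof -
    have "Suc (N i) \<le> N (Suc i)" using strict_monoD[OF assms(2), of i "Suc i"] by simp
    then have "s (Suc (N i)) \<le> s (N (Suc i))"
      using strict_mono_mono[OF gap_seq_mono(1)[OF assms(1)]] by (simp add: monoD)
    then show ?thesis using gap_seqD(3)[OF assms(1), of "N i"] by simp
  qed
  moreover have "(\<lambda>i. s (N i)) \<longlonglongrightarrow> 1"
    using LIMSEQ_subseq_LIMSEQ[OF gap_seqD(7)[OF assms(1)] assms(2)] by (simp add: comp_def)
  ultimately show ?thesis
    using gap_seqD(1,2,4)[OF assms(1)] by (simp add: gap_seq_def)
qed

section \<open>Blocks and gaps of a product neighbourhood\<close>

context product_nbhd_in
begin

definition blocks :: "(nat \<Rightarrow> real) \<Rightarrow> (nat \<Rightarrow> real) \<Rightarrow> 'a set" where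
  "blocks s t = (\<Union>n. strp {t n<..<s (Suc n)})"

text \<open>Indices start at 1, as gap \<open>Suc n\<close> is the one that follows block
  \<open>n\<close>; gap 0 only marks where the first block begins. The half-open form matches the
  intervals that a translation permutes forward.\<close>

definition gaps :: "(nat \<Rightarrow> real) \<Rightarrow> (nat \<Rightarrow> real) \<Rightarrow> 'a set" where
  "gaps s t = (\<Union>n. strp {s (Suc n)..<t (Suc n)})"

lemma gap_block_disjoint:
  assumes st: "gap_seq s t"
  shows "gaps s t \<inter> blocks s t = {}"
proof (rule ccontr)
  assume "gaps s t \<inter> blocks s t \<noteq> {}"
  then obtain x m n where x: "x \<in> strp {s (Suc m)..<t (Suc m)}" "x \<in> strp {t n<..<s (Suc n)}"
    unfolding blocks_def gaps_def by blast
  have "{s (Suc m)..<t (Suc m)} \<inter> {t n<..<s (Suc n)} = {}"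
  proof (cases "m < n")
    case True
    then have "t (Suc m) \<le> t n"
      using strict_mono_mono[OF gap_seq_mono(2)[OF st]] by (simp add: monoD)
    then show ?thesis by auto
  next
    case False
    then have "s (Suc n) \<le> s (Suc m)"
      using strict_mono_mono[OF gap_seq_mono(1)[OF st]] by (simp add: monoD)
    then show ?thesis by auto
  qed
  moreover have "{s (Suc m)..<t (Suc m)} \<subseteq> {0..1}" "{t n<..<s (Suc n)} \<subseteq> {0..1}"
    using gap_seqD(1,4)[OF st, of "Suc m"] gap_seqD(5)[OF st, of "Suc n"] gap_seqD(6)[OF st, of n]
    by auto
  ultimately show False using strip_disjoint[OF x] by blast
qed

text \<open>Dropping gaps merges neighbouring blocks, so their union grows; \<open>N 0 = 0\<close>
  keeps the first block from losing its beginning.\<close>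

lemma blocks_thin:
  assumes st: "gap_seq s t" and N: "strict_mono N" "N 0 = 0"
  shows "blocks s t \<subseteq> blocks (\<lambda>i. s (N i)) (\<lambda>i. t (N i))"
proof
  fix x assume "x \<in> blocks s t"
  then obtain n where n: "x \<in> strp {t n<..<s (Suc n)}" by (auto simp: blocks_def)
  obtain i where i: "N i \<le> n" "n < N (Suc i)" using strict_mono_bracket[OF N] by blast
  have "t (N i) \<le> t n" "s (Suc n) \<le> s (N (Suc i))"
    using i strict_mono_mono[OF gap_seq_mono(1)[OF st]] strict_mono_mono[OF gap_seq_mono(2)[OF st]]
    by (simp_all add: monoD)
  then have "{t n<..<s (Suc n)} \<subseteq> {t (N i)<..<s (N (Suc i))}" by auto
  then have "x \<in> strp {t (N i)<..<s (N (Suc i))}" using n strip_mono by blast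
  then show "x \<in> blocks (\<lambda>i. s (N i)) (\<lambda>i. t (N i))" by (auto simp: blocks_def)
qed

lemma compact_in_strip:
  assumes C: "compact C" "C \<subseteq> strp {0<..<1}"
  obtains s T where "0 < s" "s < T" "T < 1" "C \<subseteq> strp {s..<T}"
proof (cases "C = {}")
  case True
  then show ?thesis by (intro that[of "1/3" "1/2"]) auto
next
  case False
  let ?h = "\<lambda>x. snd (inv_into (bdry X \<times> {0..1}) \<kappa> x)"
  have h: "?h (\<kappa> (b, s)) = s" if "b \<in> bdry X" "s \<in> {0..1}" for b s
    using that by (subst inv_into_f_f[OF inj_kappa]) auto
  have "strp {0<..<1} \<subseteq> strp {0..1}" by (rule strip_mono) auto
  then have "continuous_on C ?h"
    using C(2) by (intro continuous_on_snd continuous_on_subset[OF continuous_inv_kappa]) blast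
  then obtain x where x: "x \<in> C" "\<And>y. y \<in> C \<Longrightarrow> ?h x \<le> ?h y"
    using continuous_attains_inf[OF C(1) False] by blast
  with C(2) have "x \<in> strp {0<..<1}" by blast
  then obtain b u where b: "b \<in> bdry X" "u \<in> {0<..<1}" "x = \<kappa> (b, u)"
    by (auto simp: strip_def)
  have hu: "?h x = u" using h b by simp
  have "strp {0<..<1} \<subseteq> M" by (rule strip_open_part) auto
  with C(2) have CM: "C \<subseteq> M" by blast
  obtain T where T: "0 < T" "T < 1" "C \<inter> strp {T..<1} = {}"
    by (rule compact_misses_end[OF C(1) CM])
  have y: "\<exists>c v. c \<in> bdry X \<and> y = \<kappa> (c, v) \<and> u \<le> v \<and> v < T" if yC: "y \<in> C" for y
  proof -
    have "y \<in> strp {0<..<1}" using C(2) yC by blast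
    then obtain c v where c: "c \<in> bdry X" "v \<in> {0<..<1}" "y = \<kappa> (c, v)"
      by (auto simp: strip_def)
    have "u \<le> v" using x(2)[OF yC] hu h c by simp
    moreover have "v < T"
    proof (rule ccontr)
      assume "\<not> v < T"
      then have "y \<in> strp {T..<1}" using c by (auto simp: strip_def)
      then show False using T(3) yC by blast
    qed
    ultimately show ?thesis using c by blast
  qed
  have "u < T" using y[OF x(1)] by auto
  moreover have "C \<subseteq> strp {u..<T}"
  proof
    fix z assume "z \<in> C"
    with y obtain c v where "c \<in> bdry X" "z = \<kappa> (c, v)" "u \<le> v" "v < T" by blast
    then show "z \<in> strp {u..<T}" by (auto simp: strip_def)
  qed
  ultimately show ?thesis using b(2) T by (intro that[of u T]) auto
qed

end

section \<open>Commuting diffeomorphisms\<close>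

locale diffeo_group = cr_manifold r X + bij_subgroup "open_part X" G
  for r :: enat and X :: "('a::t2_space, 'e::euclidean_space) bmanifold" and G :: "('a \<Rightarrow> 'a) set" +
  assumes factorizable: "factorizable r X G"
    and translation_systems: "admits_translation_systems r X G"
    and localizable: "localizable r X G"
begin

abbreviation "commutes \<equiv> derived_commute M G"

lemma local_subgroup_moves:
  assumes "g \<in> local_subgroup r X G U"
  shows "g \<in> G" "g x \<noteq> x \<Longrightarrow> x \<in> U"
proof -
  obtain F where F: "g \<in> G" "F 1 = g" "family_supp X {0..1} F \<subseteq> U"
    using assms unfolding local_subgroup_def by blast
  show "g \<in> G" by (fact F(1))
  assume x: "g x \<noteq> x"
  then have "x \<in> M" using permutes[OF F(1)] by (auto simp: permutes_def)
  then have "x \<in> {x \<in> M. \<exists>t\<in>{0..1}. F t x \<noteq> x}" using x F(2) by force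
  moreover have "{x \<in> M. \<exists>t\<in>{0..1}. F t x \<noteq> x} \<subseteq> family_supp X {0..1} F"
    unfolding family_supp_def by (rule closure_of_subset) auto
  ultimately show "x \<in> U" using F(3) by blast
qed

lemma factorizable_balls: "factorizable_wrt r X {B. is_ball r X B} G"
proof -
  have "\<Union> {B. is_ball r X B} = M"
  proof (intro equalityI subsetI)
    fix x assume "x \<in> \<Union> {B. is_ball r X B}"
    then obtain B where B: "is_ball r X B" "x \<in> B" by blast
    have "B \<subseteq> top_of_set M closure_of B" using B(1) by (rule ballE)
    then show "x \<in> M" using B(2) closure_of_subset_topspace[of "top_of_set M" B] by auto
  next
    fix x assume "x \<in> M"
    then obtain B where "is_ball r X B" "x \<in> B" by (rule ball_around)
    then show "x \<in> \<Union> {B. is_ball r X B}" by blast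
  qed
  then show ?thesis
    using factorizable unfolding factorizable_def by simp
qed

lemma ball_closure:
  assumes "is_ball r X B"
  shows "compact (top_of_set M closure_of B)" "B \<subseteq> top_of_set M closure_of B"
    "top_of_set M closure_of B \<subseteq> M"
proof -
  show "compact (top_of_set M closure_of B)" using assms by (rule ballE)
  show "B \<subseteq> top_of_set M closure_of B" using assms by (rule ballE)
  show "top_of_set M closure_of B \<subseteq> M"
    using closure_of_subset_topspace[of "top_of_set M" B] by simp
qed

lemma compact_partD:
  assumes "c \<in> compact_part r X G"
  shows "c \<in> G" "\<exists>gs. (\<forall>u\<in>set gs. \<exists>B. is_ball r X B \<and> u \<in> local_subgroup r X G B) \<and> c = foldr (\<circ>) gs id"
  using assms by (simp_all add: compact_part_def)

lemma foldr_closed: "set gs \<subseteq> G \<Longrightarrow> foldr (\<circ>) gs id \<in> G"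
  by (induction gs) (auto intro: id_closed[unfolded id_def] comp_closed simp: id_closed)

lemma compact_part_moves:
  assumes "c \<in> compact_part r X G"
  obtains K where "compact K" "K \<subseteq> M" "\<And>x. c x \<noteq> x \<Longrightarrow> x \<in> K"
proof -
  obtain gs where gs: "\<forall>u\<in>set gs. \<exists>B. is_ball r X B \<and> u \<in> local_subgroup r X G B"
    "c = foldr (\<circ>) gs id"
    using compact_partD(2)[OF assms] by blast
  have "\<exists>K. compact K \<and> K \<subseteq> M \<and> (\<forall>x. foldr (\<circ>) gs id x \<noteq> x \<longrightarrow> x \<in> K)"
    using gs(1)
  proof (induction gs)
    case Nil
    then show ?case by (intro exI[of _ "{}"]) simp
  next
    case (Cons u gs)
    have "\<exists>K. compact K \<and> K \<subseteq> M \<and> (\<forall>x. foldr (\<circ>) gs id x \<noteq> x \<longrightarrow> x \<in> K)"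
      by (rule Cons.IH) (use Cons.prems in simp)
    then obtain K where K: "compact K" "K \<subseteq> M" "\<And>x. foldr (\<circ>) gs id x \<noteq> x \<Longrightarrow> x \<in> K"
      by blast
    obtain B where B: "is_ball r X B" "u \<in> local_subgroup r X G B" using Cons.prems by auto
    let ?C = "top_of_set M closure_of B"
    have "x \<in> K \<union> ?C" if "foldr (\<circ>) (u # gs) id x \<noteq> x" for x
    proof (cases "foldr (\<circ>) gs id x = x")
      case True
      then have "u x \<noteq> x" using that by simp
      then show ?thesis using local_subgroup_moves(2)[OF B(2)] ball_closure(2)[OF B(1)] by blast
    next
      case False
      then show ?thesis using K(3) by blast
    qed
    moreover have "compact (K \<union> ?C)" "K \<union> ?C \<subseteq> M"
      using K(1,2) ball_closure[OF B(1)] by (simp_all add: compact_Un)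
    ultimately show ?case by blast
  qed
  then show ?thesis using that gs(2) by blast
qed

text \<open>A factorization of the identity already supplies one.\<close>

lemma product_nbhd_exists:
  obtains \<kappa> where "product_nbhd r X \<kappa>"
  using factorizable_balls id_closed unfolding factorizable_wrt_def by blast

text \<open>The time-one map shifts the tails \<open>[\<mu> n, 1)\<close>; being injective, it also
  shifts their successive differences, which is the form used for displacement.\<close>

lemma translation:
  assumes "product_nbhd r X \<kappa>" "range \<mu> \<subseteq> {0<..<1}" "strict_mono \<mu>" "\<mu> \<longlonglongrightarrow> 1"
  obtains \<tau> where "\<tau> \<in> G"
    "\<And>n x. x \<in> strip X \<kappa> {\<mu> n..<\<mu> (Suc n)} \<Longrightarrow> \<tau> x \<in> strip X \<kappa> {\<mu> (Suc n)..<\<mu> (Suc (Suc n))}"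
proof -
  interpret \<kappa>: product_nbhd_in r X \<kappa> by unfold_locales (fact assms(1))
  have "product_nbhd r X \<kappa> \<and> range \<mu> \<subseteq> {0<..<1} \<and> strict_mono \<mu> \<and> \<mu> \<longlonglongrightarrow> 1"
    using assms by simp
  from mp[OF spec[OF spec[OF translation_systems[unfolded admits_translation_systems_def]]] this]
  obtain F :: "real \<Rightarrow> 'a \<Rightarrow> 'a" where F: "\<forall>t\<ge>0. F t \<in> G"
    "\<forall>n. F 1 ` strip X \<kappa> {\<mu> n..<1} = strip X \<kappa> {\<mu> (Suc n)..<1}"
    by blast
  have G: "F 1 \<in> G" using F(1) by simp
  have inj: "F 1 x = F 1 y \<longleftrightarrow> x = y" for x y using bij[OF G] by (simp add: bij_def inj_eq)
  have \<mu>: "0 < \<mu> n" "\<mu> n < 1" "\<mu> n < \<mu> (Suc n)" for n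
    using subsetD[OF assms(2) rangeI[of \<mu> n]] assms(3) by (simp_all add: strict_mono_Suc_iff)
  have split: "strip X \<kappa> {\<mu> n..<1} = strip X \<kappa> {\<mu> n..<\<mu> (Suc n)} \<union> strip X \<kappa> {\<mu> (Suc n)..<1}" for n
    using \<mu>(2)[of "Suc n"] \<mu>(3)[of n] \<kappa>.strip_Un[of "{\<mu> n..<\<mu> (Suc n)}" "{\<mu> (Suc n)..<1}"]
    by (simp add: ivl_disj_un_two)
  have "F 1 x \<in> strip X \<kappa> {\<mu> (Suc n)..<\<mu> (Suc (Suc n))}" if x: "x \<in> strip X \<kappa> {\<mu> n..<\<mu> (Suc n)}" for n x
  proof (rule ccontr)
    assume "F 1 x \<notin> strip X \<kappa> {\<mu> (Suc n)..<\<mu> (Suc (Suc n))}"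
    moreover have "F 1 x \<in> strip X \<kappa> {\<mu> (Suc n)..<1}"
      using x F(2)[rule_format, of n] split[of n] by blast
    ultimately have "F 1 x \<in> F 1 ` strip X \<kappa> {\<mu> (Suc n)..<1}"
      using split[of "Suc n"] F(2)[rule_format, of "Suc n"] by blast
    then have x2: "x \<in> strip X \<kappa> {\<mu> (Suc n)..<1}" using inj by auto
    show False
      by (rule \<kappa>.strip_disjoint[OF x x2]) (use \<mu>[of n] \<mu>[of "Suc n"] in auto)
  qed
  then show ?thesis using that G by blast
qed

lemma localize:
  assumes "f \<in> G" "compact C" "C \<subseteq> M"
  shows "\<exists>g\<in>compact_part r X G. \<forall>x\<in>C. f x = g x"
  using bspec[OF localizable[unfolded localizable_def] assms(1)] assms(2,3) by simp

lemma ball_commutes: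
  assumes B: "is_ball r X B" and u: "u \<in> local_subgroup r X G B" and f: "f \<in> G"
  shows "commutes f u"
proof -
  let ?C = "top_of_set M closure_of B"
  note C = ball_closure[OF B]
  have uG: "u \<in> G" and uC: "u x \<noteq> x \<Longrightarrow> x \<in> ?C" for x
    using local_subgroup_moves[OF u] C(2) by blast+
  obtain f' where f': "f' \<in> compact_part r X G" "\<And>x. x \<in> ?C \<Longrightarrow> f x = f' x"
    using localize[OF f C(1,3)] by blast
  have f'G: "f' \<in> G" using compact_partD(1)[OF f'(1)] .
  obtain K where K: "compact K" "K \<subseteq> M" "\<And>x. f' x \<noteq> x \<Longrightarrow> x \<in> K"
    using f'(1) by (rule compact_part_moves) (rule that)
  obtain \<kappa>0 where "product_nbhd r X \<kappa>0" by (rule product_nbhd_exists)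
  then obtain \<kappa> where \<kappa>: "product_nbhd r X \<kappa>" "?C \<subseteq> strip X \<kappa> {0<..<1}"
    using B by (rule ball_into_collar)
  interpret \<kappa>: product_nbhd_in r X \<kappa> by unfold_locales (fact \<kappa>(1))
  obtain s S where s: "0 < s" "s < S" "S < 1" "?C \<subseteq> strip X \<kappa> {s..<S}"
    using C(1) \<kappa>(2) by (rule \<kappa>.compact_in_strip)
  obtain T where T: "0 < T" "T < 1" "K \<inter> strip X \<kappa> {T..<1} = {}"
    using K(1,2) by (rule \<kappa>.compact_misses_end)
  define p where "p = max S T"
  have p: "s < p" "p < 1" "S \<le> p" "T \<le> p" using s T by (auto simp: p_def)
  \<comment> \<open>Here \<open>\<mu> 0 = s\<close> and \<open>\<mu> 1 = p\<close>: the first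
    interval contains the ball, and all later ones lie beyond \<open>T\<close>, where
    \<open>f'\<close> is the identity.\<close>
  define \<mu> where "\<mu> n = (if n = 0 then s else 1 - (1 - p) / real n)" for n
  have "\<mu> n < \<mu> (Suc n)" for n
    using p by (cases n) (auto simp: \<mu>_def divide_strict_left_mono)
  then have mono: "strict_mono \<mu>" by (rule strict_monoI_Suc)
  have "\<mu> n \<in> {0<..<1}" for n
  proof -
    have "s \<le> \<mu> n" using strict_mono_mono[OF mono] monoD[of \<mu> 0 n] by (simp add: \<mu>_def)
    moreover have "\<mu> n < 1" using s p by (simp add: \<mu>_def)
    ultimately show ?thesis using s by simp
  qed
  then have range: "range \<mu> \<subseteq> {0<..<1}" by blast
  have "(\<lambda>n. 1 - (1 - p) / real (Suc n)) \<longlonglongrightarrow> 1 - 0"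
    by (intro tendsto_diff tendsto_const LIMSEQ_Suc[OF lim_const_over_n])
  then have "(\<lambda>n. \<mu> (Suc n)) \<longlonglongrightarrow> 1" by (simp add: \<mu>_def)
  then have lim: "\<mu> \<longlonglongrightarrow> 1" by (rule LIMSEQ_imp_Suc)
  obtain \<tau> where \<tau>: "\<tau> \<in> G"
    "\<And>n x. x \<in> strip X \<kappa> {\<mu> n..<\<mu> (Suc n)} \<Longrightarrow> \<tau> x \<in> strip X \<kappa> {\<mu> (Suc n)..<\<mu> (Suc (Suc n))}"
    using \<kappa>(1) range mono lim by (rule translation) (rule that)
  have end_fix: "f' y = y" if y: "y \<in> strip X \<kappa> {\<mu> (Suc n)..<\<mu> (Suc (Suc n))}" for y n
  proof -
    have "p \<le> \<mu> (Suc n)" using strict_mono_mono[OF mono] monoD[of \<mu> 1 "Suc n"] by (simp add: \<mu>_def)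
    moreover have "\<mu> (Suc (Suc n)) < 1" using subsetD[OF range rangeI] by simp
    ultimately have "{\<mu> (Suc n)..<\<mu> (Suc (Suc n))} \<subseteq> {T..<1}" using p by auto
    then have "y \<in> strip X \<kappa> {T..<1}" using y \<kappa>.strip_mono by blast
    then show ?thesis using K(3) T(3) by blast
  qed
  have start: "x \<in> strip X \<kappa> {\<mu> 0..<\<mu> (Suc 0)}" if "u x \<noteq> x" for x
  proof -
    have "{s..<S} \<subseteq> {\<mu> 0..<\<mu> (Suc 0)}" using p by (auto simp: \<mu>_def)
    then show ?thesis using uC[OF that] s(4) \<kappa>.strip_mono by blast
  qed
  have "commutes f' u"
    by (rule derived_commute_displaced[OF f'G uG \<tau>(1)]) (use start \<tau>(2) end_fix in blast)+
  then show ?thesis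
    using f'(2) uC by (intro derived_commute_local[OF f f'G uG]) auto
qed

lemma compact_part_commutes:
  assumes c: "c \<in> compact_part r X G" and f: "f \<in> G"
  shows "commutes f c"
proof -
  obtain gs where gs: "\<forall>u\<in>set gs. \<exists>B. is_ball r X B \<and> u \<in> local_subgroup r X G B"
    "c = foldr (\<circ>) gs id"
    using compact_partD(2)[OF c] by blast
  have "foldr (\<circ>) gs id \<in> G \<and> commutes f (foldr (\<circ>) gs id)"
    using gs(1)
  proof (induction gs)
    case Nil
    then show ?case using id_closed f derived_commute_commute[of f id] by (simp add: id_def comp_def)
  next
    case (Cons u gs)
    obtain B where B: "is_ball r X B" "u \<in> local_subgroup r X G B" using Cons.prems by auto
    then have "u \<in> G" "commutes f u" using local_subgroup_moves(1) ball_commutes f by blast+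
    moreover have "foldr (\<circ>) gs id \<in> G \<and> commutes f (foldr (\<circ>) gs id)"
      by (rule Cons.IH) (use Cons.prems in simp)
    moreover have "foldr (\<circ>) (u # gs) id = u \<circ> foldr (\<circ>) gs id" by simp
    ultimately show ?case
      using f comp_closed derived_commute_comp by metis
  qed
  then show ?thesis using gs(2) by simp
qed

text \<open>
  Each block is followed by one half of the next gap and then by the other half; a translation
  along these intervals moves every block into a gap twice.
\<close>

lemma block_translation:
  assumes \<kappa>: "product_nbhd r X \<kappa>" and st: "gap_seq s t"
  obtains \<tau> where "\<tau> \<in> G"
    "\<And>x. x \<in> product_nbhd_in.blocks X \<kappa> s t \<Longrightarrow> \<tau> x \<in> product_nbhd_in.gaps X \<kappa> s t"
    "\<And>x. x \<in> product_nbhd_in.blocks X \<kappa> s t \<Longrightarrow> \<tau> (\<tau> x) \<in> product_nbhd_in.gaps X \<kappa> s t"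
proof -
  interpret \<kappa>: product_nbhd_in r X \<kappa> by unfold_locales (fact \<kappa>)
  \<comment> \<open>For each \<open>n\<close> the sequence lists the start \<open>t n\<close> of
    block \<open>n\<close>, its end \<open>s (Suc n)\<close> and the midpoint of the gap after it,
    encoded by remainders modulo 3.\<close>
  define \<mu> where "\<mu> k = (let n = k div 3 in if k mod 3 = 0 then t n else if k mod 3 = 1 then s (Suc n)
    else (s (Suc n) + t (Suc n)) / 2)" for k
  have \<mu>: "\<mu> (3 * n) = t n" "\<mu> (Suc (3 * n)) = s (Suc n)"
    "\<mu> (Suc (Suc (3 * n))) = (s (Suc n) + t (Suc n)) / 2" "\<mu> (Suc (Suc (Suc (3 * n)))) = t (Suc n)" for n
  proof -
    have "Suc (3 * n) div 3 = n" "Suc (3 * n) mod 3 = 1" "Suc (Suc (3 * n)) div 3 = n"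
      "Suc (Suc (3 * n)) mod 3 = 2" "Suc (Suc (Suc (3 * n))) div 3 = Suc n"
      "Suc (Suc (Suc (3 * n))) mod 3 = 0" by presburger+
    then show "\<mu> (3 * n) = t n" "\<mu> (Suc (3 * n)) = s (Suc n)"
      "\<mu> (Suc (Suc (3 * n))) = (s (Suc n) + t (Suc n)) / 2" "\<mu> (Suc (Suc (Suc (3 * n)))) = t (Suc n)"
      by (simp_all add: \<mu>_def)
  qed
  have k3: "\<exists>n. k = 3 * n \<or> k = Suc (3 * n) \<or> k = Suc (Suc (3 * n))" for k :: nat by presburger
  note g = gap_seqD[OF st]
  \<comment> \<open>The bound below by \<open>t (k div 3)\<close> is what squeezes
    \<open>\<mu>\<close> to 1.\<close>
  have step: "\<mu> k < \<mu> (Suc k)" "0 < \<mu> k" "\<mu> k < 1" "t (k div 3) \<le> \<mu> k" for k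
  proof -
    obtain n where n: "k = 3 * n \<or> k = Suc (3 * n) \<or> k = Suc (Suc (3 * n))" using k3 by blast
    have d: "Suc (3 * n) div 3 = n" "Suc (Suc (3 * n)) div 3 = n" by presburger+
    show "\<mu> k < \<mu> (Suc k)" "0 < \<mu> k" "\<mu> k < 1" "t (k div 3) \<le> \<mu> k"
      using n g(2)[of "Suc n"] g(3)[of n] g(5)[of "Suc n"] g(6)[of n] g(4)[of n] g(1,4)[of "Suc n"]
      by (elim disjE; simp add: \<mu> d)+
  qed
  have mono: "strict_mono \<mu>" using step(1) by (rule strict_monoI_Suc)
  have range: "range \<mu> \<subseteq> {0<..<1}" using step(2,3) by auto
  have lim: "\<mu> \<longlonglongrightarrow> 1"
  proof (rule tendsto_sandwich)
    have "filterlim (\<lambda>k::nat. k div 3) at_top sequentially"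
      by (rule filterlim_at_top_div_const_nat) simp
    then show "(\<lambda>k. t (k div 3)) \<longlonglongrightarrow> 1"
      by (rule filterlim_compose[OF gap_seq_tendsto[OF st]])
    show "\<forall>\<^sub>F k in sequentially. t (k div 3) \<le> \<mu> k" "\<forall>\<^sub>F k in sequentially. \<mu> k \<le> 1"
      using step(3,4) by (simp_all add: less_imp_le)
  qed (rule tendsto_const)
  obtain \<tau> where \<tau>: "\<tau> \<in> G"
    "\<And>n x. x \<in> strip X \<kappa> {\<mu> n..<\<mu> (Suc n)} \<Longrightarrow> \<tau> x \<in> strip X \<kappa> {\<mu> (Suc n)..<\<mu> (Suc (Suc n))}"
    using \<kappa> range mono lim by (rule translation) (rule that)
  have "\<tau> x \<in> \<kappa>.gaps s t \<and> \<tau> (\<tau> x) \<in> \<kappa>.gaps s t" if "x \<in> \<kappa>.blocks s t" for x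
  proof -
    obtain n where n: "x \<in> strip X \<kappa> {t n<..<s (Suc n)}" using \<open>x \<in> \<kappa>.blocks s t\<close> by (auto simp: \<kappa>.blocks_def)
    have "{t n<..<s (Suc n)} \<subseteq> {\<mu> (3 * n)..<\<mu> (Suc (3 * n))}" by (auto simp: \<mu>)
    then have 0: "x \<in> strip X \<kappa> {\<mu> (3 * n)..<\<mu> (Suc (3 * n))}" using n \<kappa>.strip_mono by blast
    note 1 = \<tau>(2)[OF 0]
    note 2 = \<tau>(2)[OF 1]
    have "{\<mu> (Suc (3 * n))..<\<mu> (Suc (Suc (3 * n)))} \<subseteq> {s (Suc n)..<t (Suc n)}"
      "{\<mu> (Suc (Suc (3 * n)))..<\<mu> (Suc (Suc (Suc (3 * n))))} \<subseteq> {s (Suc n)..<t (Suc n)}"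
      using g(2)[of "Suc n"] by (auto simp: \<mu>)
    then have "\<tau> x \<in> strip X \<kappa> {s (Suc n)..<t (Suc n)}" "\<tau> (\<tau> x) \<in> strip X \<kappa> {s (Suc n)..<t (Suc n)}"
      using 1 2 \<kappa>.strip_mono by blast+
    then show ?thesis by (auto simp: \<kappa>.gaps_def)
  qed
  then show ?thesis using that[OF \<tau>(1)] by blast
qed

text \<open>The translation of the common blocks takes the points moved by \<open>g\<close> into
  gaps, once and twice applied, and \<open>f\<close> is the identity on gaps.\<close>

lemma blocks_commute:
  assumes \<kappa>: "product_nbhd r X \<kappa>" and st: "gap_seq s t" and fg: "f \<in> G" "g \<in> G"
    and f: "\<And>x. f x \<noteq> x \<Longrightarrow> x \<in> product_nbhd_in.blocks X \<kappa> s t"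
    and g: "\<And>x. g x \<noteq> x \<Longrightarrow> x \<in> product_nbhd_in.blocks X \<kappa> s t"
  shows "commutes f g"
proof -
  interpret \<kappa>: product_nbhd_in r X \<kappa> by unfold_locales (fact \<kappa>)
  obtain \<tau> where \<tau>: "\<tau> \<in> G" "\<And>x. x \<in> \<kappa>.blocks s t \<Longrightarrow> \<tau> x \<in> \<kappa>.gaps s t"
    "\<And>x. x \<in> \<kappa>.blocks s t \<Longrightarrow> \<tau> (\<tau> x) \<in> \<kappa>.gaps s t"
    using \<kappa> st by (rule block_translation) (rule that)
  have unmoved: "f y = y" if "y \<in> \<kappa>.gaps s t" for y
    using that f \<kappa>.gap_block_disjoint[OF st] by blast
  show ?thesis
    by (rule derived_commute_displaced[OF fg \<tau>(1)]) (use g \<tau>(2,3) unmoved in blast)+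
qed

lemma conjugate_moves:
  assumes "\<tau> \<in> G" "f \<in> G" and f: "\<And>x. f x \<noteq> x \<Longrightarrow> \<tau> x \<in> A"
  shows "\<tau> \<circ> f \<circ> inv_into UNIV \<tau> \<in> G" "(\<tau> \<circ> f \<circ> inv_into UNIV \<tau>) y \<noteq> y \<Longrightarrow> y \<in> A"
proof -
  show "\<tau> \<circ> f \<circ> inv_into UNIV \<tau> \<in> G"
    by (intro comp_closed inv_closed assms)
  assume y: "(\<tau> \<circ> f \<circ> inv_into UNIV \<tau>) y \<noteq> y"
  have e: "\<tau> (inv_into UNIV \<tau> y) = y"
    using bij[OF assms(1)] by (simp add: bij_def surj_f_inv_f)
  then have "f (inv_into UNIV \<tau> y) \<noteq> inv_into UNIV \<tau> y" using y by auto
  then show "y \<in> A" using f[of "inv_into UNIV \<tau> y"] e by simp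
qed

text \<open>The conjugate of \<open>f\<close> lives in gaps of the first neighbourhood, hence in the
  same blocks as \<open>g\<close>; symmetrically for \<open>g\<close>. The two conjugates are
  disjoint because gaps of the second neighbourhood lie in blocks of the first, away from its gaps.
  No translation ever has to respect both neighbourhoods.\<close>

lemma interleaved_blocks_commute:
  assumes \<kappa>: "product_nbhd r X \<kappa>" "product_nbhd r X \<kappa>'" and st: "gap_seq s t" "gap_seq s' t'"
    and fg: "f \<in> G" "g \<in> G"
    and f: "\<And>x. f x \<noteq> x \<Longrightarrow> x \<in> product_nbhd_in.blocks X \<kappa> s t"
    and g: "\<And>x. g x \<noteq> x \<Longrightarrow> x \<in> product_nbhd_in.blocks X \<kappa>' s' t'"
    and I1: "product_nbhd_in.gaps X \<kappa> s t \<subseteq> product_nbhd_in.blocks X \<kappa>' s' t'"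
    and I2: "product_nbhd_in.gaps X \<kappa>' s' t' \<subseteq> product_nbhd_in.blocks X \<kappa> s t"
  shows "commutes f g"
proof -
  interpret \<kappa>: product_nbhd_in r X \<kappa> by unfold_locales (fact \<kappa>)
  interpret \<kappa>': product_nbhd_in r X \<kappa>' by unfold_locales (fact \<kappa>)
  obtain \<sigma> where \<sigma>: "\<sigma> \<in> G" "\<And>x. x \<in> \<kappa>.blocks s t \<Longrightarrow> \<sigma> x \<in> \<kappa>.gaps s t"
    using \<kappa>(1) st(1) by (rule block_translation) (rule that)
  obtain \<tau> where \<tau>: "\<tau> \<in> G" "\<And>x. x \<in> \<kappa>'.blocks s' t' \<Longrightarrow> \<tau> x \<in> \<kappa>'.gaps s' t'"
    using \<kappa>(2) st(2) by (rule block_translation) (rule that)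
  note w = conjugate_moves[OF \<sigma>(1) fg(1) \<sigma>(2)[OF f]]
  note u = conjugate_moves[OF \<tau>(1) fg(2) \<tau>(2)[OF g]]
  show ?thesis
  proof (rule derived_commute_conjugates[OF fg \<sigma>(1) \<tau>(1)])
    show "commutes (\<sigma> \<circ> f \<circ> inv_into UNIV \<sigma>) g"
      by (rule blocks_commute[OF \<kappa>(2) st(2) w(1) fg(2) subsetD[OF I1 w(2)] g])
    show "commutes f (\<tau> \<circ> g \<circ> inv_into UNIV \<tau>)"
      by (rule blocks_commute[OF \<kappa>(1) st(1) fg(1) u(1) f subsetD[OF I2 u(2)]])
    show "commutes (\<sigma> \<circ> f \<circ> inv_into UNIV \<sigma>) (\<tau> \<circ> g \<circ> inv_into UNIV \<tau>)"
    proof (rule derived_commute_disjoint[OF w(1) u(1)])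
      show "(\<sigma> \<circ> f \<circ> inv_into UNIV \<sigma>) x = x \<or> (\<tau> \<circ> g \<circ> inv_into UNIV \<tau>) x = x" for x
        using w(2)[of x] u(2)[of x] I2 \<kappa>.gap_block_disjoint[OF st(1)] by blast
    qed
  qed
qed

text \<open>Removing an open collar from \<open>M\<close> leaves a compact set, which misses the end
  of every product neighbourhood. This is the only relation used between two unrelated
  neighbourhoods.\<close>

lemma strip_cofinal:
  assumes \<kappa>: "product_nbhd r X \<kappa>" "product_nbhd r X \<kappa>'" and t: "0 \<le> t" "t < 1"
  obtains T where "T < 1" "0 < T" "strip X \<kappa> {T..<1} \<subseteq> strip X \<kappa>' {t<..<1}"
proof -
  interpret \<kappa>: product_nbhd_in r X \<kappa> by unfold_locales (fact \<kappa>)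
  interpret \<kappa>': product_nbhd_in r X \<kappa>' by unfold_locales (fact \<kappa>)
  obtain T where T: "0 < T" "T < 1" "(M - strip X \<kappa>' {t<..<1}) \<inter> strip X \<kappa> {T..<1} = {}"
    by (rule \<kappa>.compact_misses_end[OF \<kappa>'.compact_core[OF t]]) auto
  have "strip X \<kappa> {T..<1} \<subseteq> M" using T by (intro \<kappa>.strip_open_part) auto
  then show ?thesis using T by (intro that[of T]) auto
qed

text \<open>Gaps are chosen alternately, each so far out that the tail starting with it lies beyond
  the gap chosen before. Towards the boundary the order is \<open>L i\<close>,
  \<open>N (Suc i)\<close>, \<open>L (Suc i)\<close>, \<open>N (Suc (Suc i))\<close>, so each gap
  falls between consecutive gaps of the other sequence, that is, into a block.\<close>

lemma gap_seq_interleave: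
  assumes \<kappa>: "product_nbhd r X \<kappa>" "product_nbhd r X \<kappa>'" and st: "gap_seq s t" "gap_seq s' t'"
  obtains N L where "strict_mono N" "N 0 = 0" "strict_mono L" "L 0 = 0"
    "product_nbhd_in.gaps X \<kappa> (\<lambda>i. s (N i)) (\<lambda>i. t (N i)) \<subseteq>
     product_nbhd_in.blocks X \<kappa>' (\<lambda>i. s' (L i)) (\<lambda>i. t' (L i))"
    "product_nbhd_in.gaps X \<kappa>' (\<lambda>i. s' (L i)) (\<lambda>i. t' (L i)) \<subseteq>
     product_nbhd_in.blocks X \<kappa> (\<lambda>i. s (N i)) (\<lambda>i. t (N i))"
proof -
  interpret \<kappa>: product_nbhd_in r X \<kappa> by unfold_locales (fact \<kappa>)
  interpret \<kappa>': product_nbhd_in r X \<kappa>' by unfold_locales (fact \<kappa>)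
  note g = gap_seqD[OF st(1)] and g' = gap_seqD[OF st(2)]
  \<comment> \<open>The state \<open>(a, b)\<close> records the last choice on either side. The new
    \<open>n\<close> is compared with the old \<open>b\<close>, but the new \<open>l\<close> with
    the new \<open>n\<close>; this produces the alternation.\<close>
  let ?Q = "\<lambda>(a, b) (n, l). a < n \<and> b < l \<and>
    strip X \<kappa> {s n..<1} \<subseteq> strip X \<kappa>' {t' b<..<1} \<and> strip X \<kappa>' {s' l..<1} \<subseteq> strip X \<kappa> {t n<..<1}"
  have "\<exists>p :: nat \<Rightarrow> nat \<times> nat. \<forall>i. (i = 0 \<longrightarrow> p i = (0, 0)) \<and> ?Q (p i) (p (Suc i))"
  proof (rule dependent_nat_choice)
    fix x :: "nat \<times> nat" and i :: nat
    obtain a b where x: "x = (a, b)" by force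
    obtain T where T: "T < 1" "0 < T" "strip X \<kappa> {T..<1} \<subseteq> strip X \<kappa>' {t' b<..<1}"
      using \<kappa> less_imp_le[OF g'(6)] g'(4) by (rule strip_cofinal) (rule that)
    obtain n where n: "a < n" "T < s n" using st(1) T(1) by (rule gap_seq_eventually)
    obtain T' where T': "T' < 1" "0 < T'" "strip X \<kappa>' {T'..<1} \<subseteq> strip X \<kappa> {t n<..<1}"
      using \<kappa>(2,1) less_imp_le[OF g(6)] g(4) by (rule strip_cofinal) (rule that)
    obtain l where l: "b < l" "T' < s' l" using st(2) T'(1) by (rule gap_seq_eventually)
    have "strip X \<kappa> {s n..<1} \<subseteq> strip X \<kappa> {T..<1}" using n by (intro \<kappa>.strip_mono) auto
    moreover have "strip X \<kappa>' {s' l..<1} \<subseteq> strip X \<kappa>' {T'..<1}" using l by (intro \<kappa>'.strip_mono) auto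
    ultimately show "\<exists>y. (Suc i = 0 \<longrightarrow> y = (0, 0)) \<and> ?Q x y"
      using T(3) T'(3) n l by (intro exI[of _ "(n, l)"]) (auto simp: x)
  qed simp
  then obtain p :: "nat \<Rightarrow> nat \<times> nat" where p: "\<And>i. (i = 0 \<longrightarrow> p i = (0, 0)) \<and> ?Q (p i) (p (Suc i))"
    by blast
  define N L where "N i = fst (p i)" and "L i = snd (p i)" for i
  have NL: "N i < N (Suc i)" "L i < L (Suc i)"
    "strip X \<kappa> {s (N (Suc i))..<1} \<subseteq> strip X \<kappa>' {t' (L i)<..<1}"
    "strip X \<kappa>' {s' (L (Suc i))..<1} \<subseteq> strip X \<kappa> {t (N (Suc i))<..<1}" for i
    using p[of i] by (simp_all add: N_def L_def case_prod_unfold)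
  have split: "y \<in> strip X k {u<..<v}" if "y \<in> strip X k {u<..<1}" "y \<notin> strip X k {v..<1}" for y k u v
    using that unfolding strip_def by (force simp: not_le)
  have gsub: "strip X \<kappa> {s n..<t n} \<subseteq> strip X \<kappa> {s n..<1}" for n
    using g(4)[of n] by (intro \<kappa>.strip_mono) auto
  have gsub': "strip X \<kappa>' {s' n..<t' n} \<subseteq> strip X \<kappa>' {s' n..<1}" for n
    using g'(4)[of n] by (intro \<kappa>'.strip_mono) auto
  show ?thesis
  proof (rule that[of N L])
    show "strict_mono N" "strict_mono L" using NL by (simp_all add: strict_mono_Suc_iff)
    show "N 0 = 0" "L 0 = 0" using p[of 0] by (simp_all add: N_def L_def)
    show "\<kappa>.gaps (\<lambda>i. s (N i)) (\<lambda>i. t (N i)) \<subseteq> \<kappa>'.blocks (\<lambda>i. s' (L i)) (\<lambda>i. t' (L i))"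
    proof
      fix y assume "y \<in> \<kappa>.gaps (\<lambda>i. s (N i)) (\<lambda>i. t (N i))"
      then obtain i where y: "y \<in> strip X \<kappa> {s (N (Suc i))..<t (N (Suc i))}"
        by (auto simp: \<kappa>.gaps_def)
      have a: "y \<notin> strip X \<kappa>' {s' (L (Suc i))..<1}"
      proof
        assume "y \<in> strip X \<kappa>' {s' (L (Suc i))..<1}"
        then have y2: "y \<in> strip X \<kappa> {t (N (Suc i))<..<1}" using NL(4) by blast
        show False
          by (rule \<kappa>.strip_disjoint[OF y y2])
             (use g(1,4)[of "N (Suc i)"] g(6)[of "N (Suc i)"] in auto)
      qed
      have b: "y \<in> strip X \<kappa>' {t' (L i)<..<1}" using y gsub NL(3) by blast
      have "y \<in> strip X \<kappa>' {t' (L i)<..<s' (L (Suc i))}" by (rule split[OF b a])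
      then show "y \<in> \<kappa>'.blocks (\<lambda>i. s' (L i)) (\<lambda>i. t' (L i))" by (auto simp: \<kappa>'.blocks_def)
    qed
    show "\<kappa>'.gaps (\<lambda>i. s' (L i)) (\<lambda>i. t' (L i)) \<subseteq> \<kappa>.blocks (\<lambda>i. s (N i)) (\<lambda>i. t (N i))"
    proof
      fix y assume "y \<in> \<kappa>'.gaps (\<lambda>i. s' (L i)) (\<lambda>i. t' (L i))"
      then obtain i where y: "y \<in> strip X \<kappa>' {s' (L (Suc i))..<t' (L (Suc i))}"
        by (auto simp: \<kappa>'.gaps_def)
      have a: "y \<notin> strip X \<kappa> {s (N (Suc (Suc i)))..<1}"
      proof
        assume "y \<in> strip X \<kappa> {s (N (Suc (Suc i)))..<1}"
        then have y2: "y \<in> strip X \<kappa>' {t' (L (Suc i))<..<1}" using NL(3) by blast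
        show False
          by (rule \<kappa>'.strip_disjoint[OF y y2])
             (use g'(1,4)[of "L (Suc i)"] g'(6)[of "L (Suc i)"] in auto)
      qed
      have b: "y \<in> strip X \<kappa> {t (N (Suc i))<..<1}" using y gsub' NL(4) by blast
      have "y \<in> strip X \<kappa> {t (N (Suc i))<..<s (N (Suc (Suc i)))}" by (rule split[OF b a])
      then show "y \<in> \<kappa>.blocks (\<lambda>i. s (N i)) (\<lambda>i. t (N i))" by (auto simp: \<kappa>.blocks_def)
    qed
  qed
qed

text \<open>Neighbourhood and gaps may depend on the element, since factorizations supply no common
  ones.\<close>

definition block_elements :: "('a \<Rightarrow> 'a) set" where
  "block_elements = {v \<in> G. \<exists>\<kappa> s t. product_nbhd r X \<kappa> \<and> gap_seq s t \<and>
     (\<forall>x. v x \<noteq> x \<longrightarrow> x \<in> product_nbhd_in.blocks X \<kappa> s t)}"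

text \<open>Thinning only enlarges the unions of blocks, so both maps stay supported in theirs while
  the remaining gaps become interleaved.\<close>

lemma block_elements_commute:
  assumes "f \<in> block_elements" "g \<in> block_elements"
  shows "commutes f g"
proof -
  obtain \<kappa> s t where f: "f \<in> G" "product_nbhd r X \<kappa>" "gap_seq s t"
    "\<And>x. f x \<noteq> x \<Longrightarrow> x \<in> product_nbhd_in.blocks X \<kappa> s t"
    using assms(1) unfolding block_elements_def by blast
  obtain \<kappa>' s' t' where g: "g \<in> G" "product_nbhd r X \<kappa>'" "gap_seq s' t'"
    "\<And>x. g x \<noteq> x \<Longrightarrow> x \<in> product_nbhd_in.blocks X \<kappa>' s' t'"
    using assms(2) unfolding block_elements_def by blast
  interpret \<kappa>: product_nbhd_in r X \<kappa> by unfold_locales (fact f(2))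
  interpret \<kappa>': product_nbhd_in r X \<kappa>' by unfold_locales (fact g(2))
  obtain N L where NL: "strict_mono N" "N 0 = 0" "strict_mono L" "L 0 = 0"
    "\<kappa>.gaps (\<lambda>i. s (N i)) (\<lambda>i. t (N i)) \<subseteq> \<kappa>'.blocks (\<lambda>i. s' (L i)) (\<lambda>i. t' (L i))"
    "\<kappa>'.gaps (\<lambda>i. s' (L i)) (\<lambda>i. t' (L i)) \<subseteq> \<kappa>.blocks (\<lambda>i. s (N i)) (\<lambda>i. t (N i))"
    using f(2) g(2) f(3) g(3) by (rule gap_seq_interleave) (rule that)
  show ?thesis
    by (rule interleaved_blocks_commute[OF f(2) g(2) gap_seq_thin[OF f(3) NL(1)]
          gap_seq_thin[OF g(3) NL(3)] f(1) g(1)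
          subsetD[OF \<kappa>.blocks_thin[OF f(3) NL(1,2)] f(4)]
          subsetD[OF \<kappa>'.blocks_thin[OF g(3) NL(3,4)] g(4)] NL(5,6)])
qed

text \<open>Take a compactly supported \<open>c\<close> equal to \<open>q\<close> off the strip over
  \<open>(t 0, 1)\<close>. Then \<open>c^-1 \<circ> q\<close> is the identity there and in all gaps
  beyond the support of \<open>c\<close>; the gaps in between, which \<open>c\<close> may spoil, are
  dropped.\<close>

lemma gapped_decomposition:
  assumes \<kappa>: "product_nbhd r X \<kappa>" and st: "gap_seq s t" and q: "q \<in> G"
    and unmoved: "\<And>n x. x \<in> strip X \<kappa> {s n..t n} \<Longrightarrow> q x = x"
  obtains c v where "c \<in> compact_part r X G" "v \<in> block_elements" "q = c \<circ> v"
proof -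
  interpret \<kappa>: product_nbhd_in r X \<kappa> by unfold_locales (fact \<kappa>)
  note g = gap_seqD[OF st]
  let ?C = "M - strip X \<kappa> {t 0<..<1}"
  have C: "compact ?C" "?C \<subseteq> M"
    using \<kappa>.compact_core[OF less_imp_le[OF g(6)] g(4)] by auto
  obtain c where c: "c \<in> compact_part r X G" "\<And>x. x \<in> ?C \<Longrightarrow> q x = c x"
    using localize[OF q C] by blast
  obtain K where K: "compact K" "K \<subseteq> M" "\<And>x. c x \<noteq> x \<Longrightarrow> x \<in> K"
    using c(1) by (rule compact_part_moves) (rule that)
  obtain T where T: "0 < T" "T < 1" "K \<inter> strip X \<kappa> {T..<1} = {}"
    using K(1,2) by (rule \<kappa>.compact_misses_end)
  obtain m where m: "0 < m" "T < s m" using st T(2) by (rule gap_seq_eventually)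
  have cG: "c \<in> G" using compact_partD(1)[OF c(1)] .
  have ci: "inv_into UNIV c (c x) = x" "c (inv_into UNIV c x) = x" for x
    using bij[OF cG] by (simp_all add: bij_def surj_f_inv_f)
  define v where "v = inv_into UNIV c \<circ> q"
  have vG: "v \<in> G" unfolding v_def using q cG by (intro comp_closed inv_closed)
  have qcv: "q = c \<circ> v" by (simp add: v_def fun_eq_iff ci)
  \<comment> \<open>Gap 0 is kept because the first block has to begin at \<open>t 0\<close>; the
    next gap kept has index \<open>m + 1\<close> and lies beyond \<open>T\<close>, where
    \<open>c\<close> moves nothing.\<close>
  define s' t' where "s' i = (if i = 0 then s 0 else s (m + i))"
    and "t' i = (if i = 0 then t 0 else t (m + i))" for i
  have st': "gap_seq s' t'"
    unfolding gap_seq_def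
  proof (intro conjI allI)
    show "0 < s' n" "s' n < t' n" "t' n < 1" for n
      using g(1,2,4) by (simp_all add: s'_def t'_def)
    show "t' n < s' (Suc n)" for n
    proof (cases "n = 0")
      case True
      have "t 0 < t m" using m(1) gap_seq_mono(2)[OF st] by (simp add: strict_mono_less)
      then show ?thesis using g(3)[of m] True by (simp add: s'_def t'_def)
    next
      case False
      then show ?thesis using g(3)[of "m + n"] by (simp add: s'_def t'_def)
    qed
    have "(\<lambda>i. s (Suc i + m)) \<longlonglongrightarrow> 1"
      using LIMSEQ_ignore_initial_segment[OF g(7), of "Suc m"] by (simp add: add.commute)
    then have "(\<lambda>i. s' (Suc i)) \<longlonglongrightarrow> 1" by (simp add: s'_def add.commute)
    then show "s' \<longlonglongrightarrow> 1" by (rule LIMSEQ_imp_Suc)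
  qed
  have "x \<in> \<kappa>.blocks s' t'" if vx: "v x \<noteq> x" for x
  proof -
    have "x \<in> M" using vx permutes[OF vG] by (auto simp: permutes_def)
    moreover have "x \<notin> ?C"
    proof
      assume "x \<in> ?C"
      then have "v x = x" using c(2)[of x] ci(1)[of x] by (simp add: v_def)
      then show False using vx by simp
    qed
    ultimately have xs: "x \<in> strip X \<kappa> {t 0<..<1}" by blast
    then obtain b y where b: "b \<in> bdry X" "t 0 < y" "y < 1" "x = \<kappa> (b, y)" by (auto simp: strip_def)
    have gap: "\<not> (s' i \<le> y \<and> y \<le> t' i)" if i: "0 < i" for i
    proof
      assume a: "s' i \<le> y \<and> y \<le> t' i"
      then have "x \<in> strip X \<kappa> {s (m + i)..t (m + i)}" using b i by (auto simp: strip_def s'_def t'_def)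
      then have "q x = x" by (rule unmoved)
      moreover have "T < s (m + i)"
        using m(2) strict_mono_mono[OF gap_seq_mono(1)[OF st]] monoD[of s m "m + i"] by simp
      then have "x \<in> strip X \<kappa> {T..<1}" using a b i by (auto simp: strip_def s'_def)
      then have "c x = x" using K(3) T(3) by blast
      ultimately have "v x = x" using ci(1)[of x] by (simp add: v_def)
      then show False using vx by simp
    qed
    obtain j where "y < s' j" using st' b(3) by (rule gap_seq_eventually[of _ _ _ 0])
    then have ex: "\<exists>j. y < s' (Suc j)"
      using strict_monoD[OF gap_seq_mono(1)[OF st'], of j "Suc j"] by (intro exI[of _ j]) simp
    \<comment> \<open>This finds the block of \<open>y\<close>: gap \<open>Suc i\<close> starts
      after \<open>y\<close>, and by minimality and avoidance of gaps \<open>y\<close> lies after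
      gap \<open>i\<close>.\<close>
    define i where "i = (LEAST j. y < s' (Suc j))"
    have i: "y < s' (Suc i)" unfolding i_def using ex by (rule LeastI_ex)
    have "t' i < y"
    proof (cases i)
      case 0
      then show ?thesis using b by (simp add: t'_def)
    next
      case (Suc j)
      then have "\<not> y < s' (Suc j)" using not_less_Least[of j "\<lambda>j. y < s' (Suc j)"] by (simp add: i_def)
      then show ?thesis using gap[of i] Suc by simp
    qed
    then have "x \<in> strip X \<kappa> {t' i<..<s' (Suc i)}" using i b by (auto simp: strip_def)
    then show ?thesis by (auto simp: \<kappa>.blocks_def)
  qed
  then have vb: "v \<in> block_elements"
    using vG \<kappa> st' unfolding block_elements_def by blast
  show ?thesis by (rule that[OF c(1) vb qcv])
qed

text \<open>The ball factors give \<open>c3\<close>. The other factor splits as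
  \<open>p = h \<circ> (h^-1 \<circ> p)\<close>: \<open>h\<close> is the identity between the strips
  containing its support, and \<open>h^-1 \<circ> p\<close> is the identity where \<open>h\<close>
  agrees with \<open>p\<close>. Both parts therefore have gaps.\<close>

lemma decomposition:
  assumes f: "f \<in> G"
  obtains c1 v1 c2 v2 c3 where "c1 \<in> compact_part r X G" "c2 \<in> compact_part r X G"
    "c3 \<in> compact_part r X G" "v1 \<in> block_elements" "v2 \<in> block_elements"
    "f = (c1 \<circ> v1) \<circ> ((c2 \<circ> v2) \<circ> c3)"
proof -
  note fw = factorizable_balls[unfolded factorizable_wrt_def]
  obtain \<kappa> p gs where \<kappa>: "product_nbhd r X \<kappa>" and p: "p \<in> local_subgroup r X G (strip X \<kappa> {0..<1})"
    and gs: "\<forall>u\<in>set gs. \<exists>B\<in>{B. is_ball r X B}. u \<in> local_subgroup r X G B"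
    and fp: "f = p \<circ> foldr (\<circ>) gs id"
    using bspec[OF conjunct1[OF fw] f] by (elim exE bexE conjE) (rule that)
  interpret \<kappa>: product_nbhd_in r X \<kappa> by unfold_locales (fact \<kappa>)
  have pG: "p \<in> G" using local_subgroup_moves(1)[OF p] .
  have "set gs \<subseteq> G" using gs local_subgroup_moves(1) by blast
  then have c3: "foldr (\<circ>) gs id \<in> compact_part r X G"
    using gs foldr_closed unfolding compact_part_def by blast
  obtain a a' b' b :: "nat \<Rightarrow> real" and h where h: "h \<in> local_subgroup r X G (strip X \<kappa> {0..<1})"
    and ab: "\<forall>n. 0 < a n \<and> a n < a' n \<and> a' n < b' n \<and> b' n < b n \<and> b n < a (Suc n) \<and> a (Suc n) < 1"
    and a1: "a \<longlonglongrightarrow> 1" and hp: "\<forall>n. \<forall>x\<in>strip X \<kappa> {a' n..b' n}. h x = p x"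
    and hs: "supp_on X h \<subseteq> (\<Union>n. strip X \<kappa> {a n<..<b n})"
    using bspec[OF mp[OF spec[OF conjunct2[OF fw]] \<kappa>] p] by (elim exE bexE conjE) (rule that)
  have ab: "0 < a n" "a n < a' n" "a' n < b' n" "b' n < b n" "b n < a (Suc n)" "a (Suc n) < 1" for n
    using ab by simp_all
  have hG: "h \<in> G" using local_subgroup_moves(1)[OF h] .
  have bi: "inv_into UNIV h (h x) = x" "h (inv_into UNIV h x) = x" for x
    using bij[OF hG] by (simp_all add: bij_def surj_f_inv_f)
  have gap_ab: "gap_seq a b"
  proof -
    have "a n < b n" "b n < 1" for n using ab[of n] by linarith+
    then show ?thesis using ab a1 by (simp add: gap_seq_def)
  qed
  \<comment> \<open>The gaps of \<open>h\<close> reach from the end \<open>b n\<close> of one strip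
    to the start \<open>a (Suc n)\<close> of the next, hence the shifted index.\<close>
  have gap_h: "gap_seq b (\<lambda>n. a (Suc n))"
  proof -
    have "0 < b n" "a (Suc n) < b (Suc n)" for n using ab[of n] ab[of "Suc n"] by linarith+
    then show ?thesis using ab gap_seq_tendsto[OF gap_ab] by (simp add: gap_seq_def)
  qed
  have gap_k: "gap_seq a' b'"
  proof -
    have *: "0 < a' n" "b' n < a' (Suc n)" "b' n < 1" "a n \<le> a' n" "a' n \<le> 1" for n
      using ab[of n] ab[of "Suc n"] by linarith+
    have "a' \<longlonglongrightarrow> 1"
      by (rule tendsto_sandwich[OF _ _ a1 tendsto_const]) (simp_all add: *)
    then show ?thesis using * ab by (simp add: gap_seq_def)
  qed
  have h_fix: "h x = x" if x: "x \<in> strip X \<kappa> {b n..a (Suc n)}" for n x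
  proof (rule ccontr)
    assume hx: "h x \<noteq> x"
    then have "x \<in> {x \<in> M. h x \<noteq> x}" using permutes[OF hG] by (auto simp: permutes_def)
    moreover have "{x \<in> M. h x \<noteq> x} \<subseteq> supp_on X h"
      unfolding supp_on_def by (rule closure_of_subset) auto
    ultimately obtain m where m: "x \<in> strip X \<kappa> {a m<..<b m}" using hs by blast
    have "{b n..a (Suc n)} \<inter> {a m<..<b m} = {}"
    proof (cases "m \<le> n")
      case True
      then have "b m \<le> b n" using strict_mono_mono[OF gap_seq_mono(2)[OF gap_ab]] by (simp add: monoD)
      then show ?thesis by auto
    next
      case False
      then have "a (Suc n) \<le> a m" using strict_mono_mono[OF gap_seq_mono(1)[OF gap_ab]] by (simp add: monoD)
      then show ?thesis by auto
    qed
    moreover have "{b n..a (Suc n)} \<subseteq> {0..1}" "{a m<..<b m} \<subseteq> {0..1}"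
      using gap_seqD(4)[OF gap_ab, of m] gap_seqD(6)[OF gap_ab, of n] ab(1)[of m] ab(6)[of n] by auto
    ultimately show False using \<kappa>.strip_disjoint[OF x m] by blast
  qed
  obtain c1 v1 where 1: "c1 \<in> compact_part r X G" "v1 \<in> block_elements" "h = c1 \<circ> v1"
    by (rule gapped_decomposition[OF \<kappa> gap_h hG h_fix])
  have kG: "inv_into UNIV h \<circ> p \<in> G" by (intro comp_closed inv_closed hG pG)
  have k_fix: "(inv_into UNIV h \<circ> p) x = x" if "x \<in> strip X \<kappa> {a' n..b' n}" for n x
    using bspec[OF spec[OF hp] that] bi(1)[of x] by simp
  obtain c2 v2 where 2: "c2 \<in> compact_part r X G" "v2 \<in> block_elements" "inv_into UNIV h \<circ> p = c2 \<circ> v2"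
    by (rule gapped_decomposition[OF \<kappa> gap_k kG k_fix])
  have "p = h \<circ> (inv_into UNIV h \<circ> p)" by (simp add: fun_eq_iff bi)
  then have "f = (c1 \<circ> v1) \<circ> ((c2 \<circ> v2) \<circ> foldr (\<circ>) gs id)"
    unfolding fp 1(3)[symmetric] 2(3)[symmetric] by (metis comp_assoc)
  then show ?thesis using 1 2 c3 by (intro that[of c1 c2 "foldr (\<circ>) gs id" v1 v2])
qed

text \<open>Compactly supported factors are related to everything, so block elements decide. It is
  applied twice in \<open>all_commute\<close>, first with \<open>g\<close> itself a block element
  and then with \<open>g\<close> arbitrary.\<close>

lemma commutes_if_commutes_with_blocks:
  assumes g: "g \<in> G" and f: "f \<in> G" and v: "\<And>v. v \<in> block_elements \<Longrightarrow> commutes g v"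
  shows "commutes g f"
proof -
  obtain c1 v1 c2 v2 c3 where d: "c1 \<in> compact_part r X G" "c2 \<in> compact_part r X G"
    "c3 \<in> compact_part r X G" "v1 \<in> block_elements" "v2 \<in> block_elements"
    "f = (c1 \<circ> v1) \<circ> ((c2 \<circ> v2) \<circ> c3)"
    using f by (rule decomposition) (rule that)
  have G: "c1 \<in> G" "c2 \<in> G" "c3 \<in> G" "v1 \<in> G" "v2 \<in> G"
    using d(1-5) compact_partD(1) by (auto simp: block_elements_def)
  note c = compact_part_commutes[OF _ g]
  have 1: "commutes g (c1 \<circ> v1)" by (rule derived_commute_comp[OF g G(1,4) c[OF d(1)] v[OF d(4)]])
  have 2: "commutes g (c2 \<circ> v2)" by (rule derived_commute_comp[OF g G(2,5) c[OF d(2)] v[OF d(5)]])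
  have 3: "commutes g ((c2 \<circ> v2) \<circ> c3)"
    by (rule derived_commute_comp[OF g comp_closed[OF G(2,5)] G(3) 2 c[OF d(3)]])
  show ?thesis
    unfolding d(6)
    by (rule derived_commute_comp[OF g comp_closed[OF G(1,4)] comp_closed[OF comp_closed[OF G(2,5)] G(3)] 1 3])
qed

lemma all_commute:
  assumes "f \<in> G" "g \<in> G"
  shows "commutes f g"
proof (rule commutes_if_commutes_with_blocks[OF assms])
  fix v assume v: "v \<in> block_elements"
  then have vG: "v \<in> G" by (simp add: block_elements_def)
  have "commutes v f"
    using vG assms(1) block_elements_commute[OF v] by (rule commutes_if_commutes_with_blocks)
  then show "commutes f v" using vG assms(1) by (intro derived_commute_sym[of v f])
qed

end

theorem theorem6p9:
  fixes r :: enat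
    and X :: "('a::t2_space, 'e::euclidean_space) bmanifold"
    and G :: "('a \<Rightarrow> 'a) set"
  assumes "cr_bmanifold r X" and "compact (points X)" and "connected (points X)"
    and "bdry X \<noteq> {}"
    and "subgroup G (bij_group (open_part X))" and "G \<subseteq> isotopic_diffeos r X"
    and "factorizable r X G"
    and "determined_on_compacts r X G"
    and "admits_translation_systems r X G"
    and "localizable r X G"
    and "non_fixing (open_part X) (compact_part r X G)"
  shows "perfect (bij_group (open_part X)) (derived (bij_group (open_part X)) G)"
proof -
  interpret diffeo_group r X G
    by (intro diffeo_group.intro cr_manifold.intro bij_subgroup.intro diffeo_group_axioms.intro; fact assms)
  show ?thesis
    using all_commute by (rule perfect_derived)
qed

end
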